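(* Let $d\ge1$ be an integer, $T>0$, and let $p,q\in[1,\infty]$ satisfy $\frac1p+\frac1q\le1$. Let $b\in L^1([0,T];L^p(\mathbb{T}^d))$ be a divergence-free vector field and let $u_0\in L^q(\mathbb{T}^d)$. Then there exists a distributional solution $u\in L^\infty([0,T];L^q(\mathbb{T}^d))$ to the Cauchy problem $\partial_t u+\operatorname{div}(bu)=\Delta u$ in $(0,T)\times\mathbb{T}^d$, $u|_{t=0}=u_0$.
   Context: $\mathbb{T}^d=\mathbb{R}^d/\mathbb{Z}^d$ is the flat torus. A vector field $b:[0,T]\times\mathbb{T}^d\to\mathbb{R}^d$ is divergence-free if $\operatorname{div}_x b=0$ in the sense of distributions. Distributional solution: a function $u\in L^\infty([0,T];L^q(\mathbb{T}^d))$ is a distributional solution to the Cauchy problem if for every $\varphi\in C_c^\infty([0,T)\times\mathbb{T}^d)$ $$\int_0^T\int_{\mathbb{T}^d}u(\partial_t\varphi+b\cdot\nabla\varphi+\Delta\varphi)\,dx\,dt+\int_{\mathbb{T}^d}u_0\,\varphi(0,\cdot)\,dx=0.$$ *)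

theory Defs
  imports "HOL-Analysis.Analysis" "HOL-Probability.Essential_Supremum"
begin

section \<open>The flat torus\<close>

text \<open>Functions on the torus are encoded as functions on \<open>real ^ 'd\<close> that are periodic with
  respect to the integer lattice; integration over the torus is Lebesgue integration over the
  unit cube. The dimension \<open>CARD('d)\<close> is an arbitrary positive natural number.\<close>

definition periodic :: "(real ^ 'd \<Rightarrow> 'b) \<Rightarrow> bool" where
  "periodic f \<longleftrightarrow> (\<forall>x k. (\<forall>i. k $ i \<in> \<int>) \<longrightarrow> f (x + k) = f x)"

definition torus :: "(real ^ 'd) measure" where
  "torus = lebesgue_on (cbox 0 1)"


section \<open>Lebesgue and Lebesgue-Bochner spaces\<close>

text \<open>Power of an extended nonnegative number to a positive real exponent.\<close>

definition epowr :: "ennreal \<Rightarrow> real \<Rightarrow> ennreal" where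
  "epowr x a = (if x = \<infinity> then \<infinity> else ennreal (enn2real x powr a))"

text \<open>The norm takes a function with values in \<open>ennreal\<close>, to be applied to the pointwise norm of
  the function of interest, so that it can be iterated in space and time. It is meant for
  exponents in \<open>[1, \<infinity>]\<close>.\<close>

definition Lp_norm :: "ennreal \<Rightarrow> 'a measure \<Rightarrow> ('a \<Rightarrow> ennreal) \<Rightarrow> ennreal" where
  "Lp_norm p M g =
     (if p = \<infinity> then esssup M g
      else epowr (\<integral>\<^sup>+ x. epowr (g x) (enn2real p) \<partial>M) (1 / enn2real p))"

text \<open>Elements of these spaces are representatives, not classes modulo null sets.\<close>

definition Lp_torus :: "ennreal \<Rightarrow> (real ^ 'd \<Rightarrow> 'b::euclidean_space) set" where
  "Lp_torus q = {f. f \<in> borel_measurable lebesgue \<and> periodic f \<and>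
                    Lp_norm q torus (\<lambda>x. ennreal (norm (f x))) < \<infinity>}"

text \<open>The space \<open>L^r([0,T]; L^q)\<close> over the torus: jointly Lebesgue measurable functions of
  time and space whose mixed norm is finite. Values at times outside \<open>[0,T]\<close> are irrelevant.\<close>

definition LrLq :: "real \<Rightarrow> ennreal \<Rightarrow> ennreal \<Rightarrow> (real \<times> (real ^ 'd) \<Rightarrow> 'b::euclidean_space) set" where
  "LrLq T r q = {f. f \<in> borel_measurable (lebesgue_on ({0..T} \<times> UNIV)) \<and>
                    (\<forall>t\<in>{0..T}. periodic (\<lambda>x. f (t, x))) \<and>
                    Lp_norm r (lebesgue_on {0..T})
                      (\<lambda>t. Lp_norm q torus (\<lambda>x. ennreal (norm (f (t, x))))) < \<infinity>}"


section \<open>Test functions and differential operators\<close>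

primrec C_k :: "nat \<Rightarrow> ('a::real_normed_vector \<Rightarrow> 'b::real_normed_vector) \<Rightarrow> bool" where
  "C_k 0 f \<longleftrightarrow> continuous_on UNIV f"
| "C_k (Suc n) f \<longleftrightarrow> (\<forall>z. f differentiable (at z)) \<and>
                    (\<forall>v. C_k n (\<lambda>z. frechet_derivative f (at z) v))"

definition smooth :: "('a::real_normed_vector \<Rightarrow> 'b::real_normed_vector) \<Rightarrow> bool" where
  "smooth f \<longleftrightarrow> (\<forall>n. C_k n f)"

text \<open>For an open set \<open>I\<close> of times, smooth functions with compact support in the product of \<open>I\<close>
  with the torus, extended by zero to all times.\<close>

definition test_functions :: "real set \<Rightarrow> (real \<times> (real ^ 'd) \<Rightarrow> real) set" where
  "test_functions I = {\<phi>. smooth \<phi> \<and> (\<forall>t. periodic (\<lambda>x. \<phi> (t, x))) \<and>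
                          (\<exists>K. compact K \<and> K \<subseteq> I \<and> (\<forall>t x. t \<notin> K \<longrightarrow> \<phi> (t, x) = 0))}"

definition dt :: "(real \<times> (real ^ 'd) \<Rightarrow> real) \<Rightarrow> real \<times> (real ^ 'd) \<Rightarrow> real" where
  "dt \<phi> = (\<lambda>(t, x). deriv (\<lambda>s. \<phi> (s, x)) t)"

definition dx :: "'d \<Rightarrow> (real \<times> (real ^ 'd) \<Rightarrow> real) \<Rightarrow> real \<times> (real ^ 'd) \<Rightarrow> real" where
  "dx i \<phi> = (\<lambda>(t, x). deriv (\<lambda>s. \<phi> (t, x + s *\<^sub>R axis i 1)) 0)"

definition grad :: "(real \<times> (real ^ 'd) \<Rightarrow> real) \<Rightarrow> real \<times> (real ^ 'd) \<Rightarrow> real ^ 'd" where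
  "grad \<phi> z = (\<chi> i. dx i \<phi> z)"

definition laplacian :: "(real \<times> (real ^ 'd) \<Rightarrow> real) \<Rightarrow> real \<times> (real ^ 'd) \<Rightarrow> real" where
  "laplacian \<phi> z = (\<Sum>i\<in>UNIV. dx i (dx i \<phi>) z)"


section \<open>Divergence-free fields and distributional solutions\<close>

text \<open>The integral below converges absolutely for \<open>b \<in> LrLq T 1 p\<close>, \<open>p \<ge> 1\<close>.\<close>

definition divergence_free :: "real \<Rightarrow> (real \<times> (real ^ 'd) \<Rightarrow> real ^ 'd) \<Rightarrow> bool" where
  "divergence_free T b \<longleftrightarrow>
     (\<forall>\<phi>\<in>test_functions {0<..<T}.
        (LINT t|lebesgue_on {0..T}. LINT x|torus. b (t, x) \<bullet> grad \<phi> (t, x)) = 0)"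

text \<open>Smooth functions with compact support in the product of \<open>[0,T)\<close> with the torus are the
  restrictions of the elements of \<open>test_functions {..<T}\<close>. For \<open>b \<in> LrLq T 1 p\<close> and
  \<open>u \<in> LrLq T \<infinity> q\<close> with \<open>1/p + 1/q \<le> 1\<close> the integrals converge absolutely by Hoelder's
  inequality, so the default value of the integral of a non-integrable function plays no role.\<close>

definition distributional_solution ::
    "real \<Rightarrow> ennreal \<Rightarrow> (real \<times> (real ^ 'd) \<Rightarrow> real ^ 'd) \<Rightarrow> (real ^ 'd \<Rightarrow> real) \<Rightarrow>
     (real \<times> (real ^ 'd) \<Rightarrow> real) \<Rightarrow> bool" where
  "distributional_solution T q b u0 u \<longleftrightarrow>
     u \<in> LrLq T \<infinity> q \<and>
     (\<forall>\<phi>\<in>test_functions {..<T}.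
        (LINT t|lebesgue_on {0..T}. LINT x|torus.
           u (t, x) * (dt \<phi> (t, x) + b (t, x) \<bullet> grad \<phi> (t, x) + laplacian \<phi> (t, x)))
        + (LINT x|torus. u0 x * \<phi> (0, x)) = 0)"

end

theory Submission
  imports Defs "HOL-Real_Asymp.Real_Asymp"
begin

text \<open>The existence of a weak solution is reduced by duality to an estimate for smooth functions, so that
no parabolic equation is ever solved. Write
\<open>L \<phi> = \<partial>\<^sub>t \<phi> + b \<bullet> \<nabla>\<phi> + \<Delta>\<phi>\<close>. A solution is a function \<open>u\<close> for which the affine functionals
\<open>E \<phi> u = \<integral>\<integral> u L \<phi> + \<integral> u\<^sub>0 \<phi>(0)\<close> vanish for all test functions \<open>\<phi>\<close>; it is sought in the convex set of
all \<open>u\<close> whose time slices have \<open>L\<^sup>q\<close> norm at most \<open>A = \<parallel>u\<^sub>0\<parallel>\<close>.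

For a single \<open>\<phi>\<close> that set contains an explicit \<open>u\<close> with \<open>E \<phi> u \<ge> -\<epsilon>\<close> (\<open>a_priori_test\<close>). Let \<open>r\<close> be the
exponent conjugate to \<open>q\<close> and take for \<open>-u(t)/A\<close> the derivative at \<open>\<phi>(t)\<close> of the regularised norm
\<open>N(f) = (\<integral> (f\<^sup>2 + e)\<^bsup>r/2\<^esup>)\<^bsup>1/r\<^esup>\<close>. Testing \<open>L \<phi>\<close> with it, the time derivative integrates to the difference of
\<open>N\<close> at the two ends, the drift contributes the integral of \<open>b \<bullet> \<nabla>(g \<circ> \<phi>)\<close> for a smooth function \<open>g\<close>, which
vanishes because \<open>b\<close> is divergence-free, and the Laplacian has a sign because the derivative of \<open>N\<close> is
monotone. What remains is \<open>A N(\<phi>(0))\<close>, which dominates \<open>- \<integral> u\<^sub>0 \<phi>(0)\<close>.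

Since \<open>E\<close> is linear in \<open>\<phi>\<close>, a least squares argument (\<open>convex_set_near_zero\<close>) turns this into admissible \<open>u\<close>
that satisfy finitely many equations up to a small error. To satisfy all of them at once, the sets of
such approximate solutions form a family of convex sets, directed downwards, and minimising the strictly
convex functional \<open>\<integral> sqrt (1 + u\<^sup>2)\<close> over them yields almost everywhere convergent sequences
(\<open>convex_family_limit\<close>); this replaces weak compactness. The equations survive the limit by Vitali's
argument (\<open>dual_ball_vitali\<close>, \<open>defect_tendsto\<close>), which needs \<open>r < \<infinity>\<close>, that is \<open>q > 1\<close>.

For \<open>q = 1\<close> the hypothesis forces \<open>p = \<infinity>\<close>. The datum is split into bounded pieces \<open>v\<^sub>k\<close>, the levels of \<open>\<bar>u\<^sub>0\<bar>\<close>.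
A bounded function has \<open>L\<^sup>s\<close> norm close to its \<open>L\<^sup>1\<close> norm for \<open>s\<close> near \<open>1\<close> (\<open>bounded_in_dual_ball\<close>), so each piece
is solved in some \<open>L\<^sup>s\<close> with \<open>s > 1\<close> and norm at most \<open>\<parallel>v\<^sub>k\<parallel>\<^sub>1 + 2\<^sup>-\<^sup>k\<close>, and the series of solutions converges
(\<open>existence_exponent_1\<close>).

Throughout, Lebesgue measurable data are first replaced by Borel functions that agree with them almost
everywhere, so that all slices are measurable.\<close>

section \<open>Smooth functions\<close>

lemma C_k_Suc_imp_C_k: "C_k (Suc n) f \<Longrightarrow> C_k n f"
proof (induction n arbitrary: f)
  case 0
  then have "isCont f z" for z
    by (simp add: differentiable_imp_continuous_within)
  then show ?case by (simp add: continuous_at_imp_continuous_on)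
next
  case (Suc n)
  have "f differentiable at z" "C_k (Suc n) (\<lambda>z. frechet_derivative f (at z) v)" for z v
    using Suc.prems unfolding C_k.simps(2)[of "Suc n"] by blast+
  then show ?case using Suc.IH unfolding C_k.simps(2)[of n f] by blast
qed

text \<open>Differentiability classes are defined through \<open>frechet_derivative\<close>; this rule and the next let every
closure property below be proved by induction from an explicit derivative.\<close>

lemma C_k_SucI:
  assumes "\<And>z. (f has_derivative D z) (at z)" and "\<And>v. C_k n (\<lambda>z. D z v)"
  shows "C_k (Suc n) f"
proof -
  have "frechet_derivative f (at z) = D z" for z
    using frechet_derivative_at[OF assms(1)] by simp
  moreover have "f differentiable at z" for z
    using assms(1) by (rule differentiableI)
  ultimately show ?thesis using assms(2) by simp
qed

lemma C_k_SucE: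
  assumes "C_k (Suc n) f"
  shows "(f has_derivative frechet_derivative f (at z)) (at z)" "C_k n (\<lambda>z. frechet_derivative f (at z) v)"
  using assms by (auto simp: frechet_derivative_works[symmetric])

lemma C_k_const: "C_k n (\<lambda>_. c)"
  by (induction n arbitrary: c) (auto intro: continuous_intros)

lemma C_k_bounded_linear: "bounded_linear f \<Longrightarrow> C_k n f"
proof (induction n)
  case 0
  then show ?case by (simp add: linear_continuous_on)
next
  case (Suc n)
  show ?case
    by (rule C_k_SucI[where D="\<lambda>_. f"])
      (use Suc in \<open>auto intro: bounded_linear_imp_has_derivative C_k_const\<close>)
qed

lemma C_k_add: "C_k n f \<Longrightarrow> C_k n g \<Longrightarrow> C_k n (\<lambda>z. f z + g z)"
proof (induction n arbitrary: f g)
  case 0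
  then show ?case by (auto intro: continuous_intros)
next
  case (Suc n)
  show ?case
    by (rule C_k_SucI)
      (auto intro!: has_derivative_add C_k_SucE(1)[OF Suc.prems(1)] C_k_SucE(1)[OF Suc.prems(2)]
        Suc.IH C_k_SucE(2)[OF Suc.prems(1)] C_k_SucE(2)[OF Suc.prems(2)])
qed

lemma C_k_mult:
  fixes f g :: "'a::real_normed_vector \<Rightarrow> real"
  shows "C_k n f \<Longrightarrow> C_k n g \<Longrightarrow> C_k n (\<lambda>z. f z * g z)"
proof (induction n arbitrary: f g)
  case 0
  then show ?case by (auto intro: continuous_intros)
next
  case (Suc n)
  show ?case
    by (rule C_k_SucI)
      (auto intro!: has_derivative_mult C_k_SucE(1)[OF Suc.prems(1)] C_k_SucE(1)[OF Suc.prems(2)]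
        C_k_add Suc.IH C_k_SucE(2)[OF Suc.prems(1)] C_k_SucE(2)[OF Suc.prems(2)]
        C_k_Suc_imp_C_k[OF Suc.prems(1)] C_k_Suc_imp_C_k[OF Suc.prems(2)])
qed

lemma C_k_compose_real:
  fixes h :: "real \<Rightarrow> real" and f :: "'a::real_normed_vector \<Rightarrow> real"
  shows "C_k n h \<Longrightarrow> C_k n f \<Longrightarrow> C_k n (\<lambda>z. h (f z))"
proof (induction n arbitrary: h f)
  case 0
  then show ?case by (auto intro: continuous_on_compose2[of UNIV h])
next
  case (Suc n)
  have lin: "frechet_derivative h (at s) v = v * frechet_derivative h (at s) 1" for s v
    using linear_cmul[OF linear_frechet_derivative[of h "at s"], of v 1] Suc.prems(1) by simp
  have D: "((\<lambda>z. h (f z)) has_derivative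
      (\<lambda>v. frechet_derivative h (at (f z)) (frechet_derivative f (at z) v))) (at z)" for z
    using diff_chain_at[OF C_k_SucE(1)[OF Suc.prems(2), of z] C_k_SucE(1)[OF Suc.prems(1), of "f z"]]
    by (simp add: o_def)
  show ?case
  proof (rule C_k_SucI[OF D])
    fix v
    have "C_k n (\<lambda>z. frechet_derivative f (at z) v * frechet_derivative h (at (f z)) 1)"
      by (intro C_k_mult C_k_SucE(2)[OF Suc.prems(2)] Suc.IH[OF C_k_SucE(2)[OF Suc.prems(1), of 1]]
          C_k_Suc_imp_C_k[OF Suc.prems(2)])
    then show "C_k n (\<lambda>z. frechet_derivative h (at (f z)) (frechet_derivative f (at z) v))"
      by (subst lin) simp
  qed
qed

lemma smooth_add: "smooth f \<Longrightarrow> smooth g \<Longrightarrow> smooth (\<lambda>z. f z + g z)"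
  and smooth_mult: "smooth f' \<Longrightarrow> smooth g' \<Longrightarrow> smooth (\<lambda>z. f' z * g' z :: real)"
  and smooth_compose_real: "smooth h \<Longrightarrow> smooth g' \<Longrightarrow> smooth (\<lambda>z. h (g' z) :: real)"
  and smooth_const: "smooth (\<lambda>_. c)"
  and smooth_bounded_linear: "bounded_linear l \<Longrightarrow> smooth l"
  by (auto simp: smooth_def C_k_add C_k_mult C_k_const C_k_compose_real C_k_bounded_linear)

lemma smooth_has_derivative: "smooth f \<Longrightarrow> (f has_derivative frechet_derivative f (at z)) (at z)"
  and smooth_frechet_derivative: "smooth f \<Longrightarrow> smooth (\<lambda>z. frechet_derivative f (at z) v)"
  and smooth_continuous_on: "smooth f \<Longrightarrow> continuous_on X f"
proof -
  assume "smooth f"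
  then have f: "C_k n f" for n by (simp add: smooth_def)
  show "(f has_derivative frechet_derivative f (at z)) (at z)"
    by (rule C_k_SucE(1)[OF f[of "Suc 0"]])
  show "smooth (\<lambda>z. frechet_derivative f (at z) v)"
    unfolding smooth_def using C_k_SucE(2)[OF f[of "Suc n" for n]] by blast
  show "continuous_on X f"
    using f[of 0] continuous_on_subset[of UNIV f X] by simp
qed

lemma smooth_sum_scaled:
  assumes "finite F" "\<And>f. f \<in> F \<Longrightarrow> smooth f"
  shows "smooth (\<lambda>z. \<Sum>f\<in>F. c f * f z :: real)"
  using assms
proof (induction F rule: finite_induct)
  case empty
  then show ?case by (simp add: smooth_const)
next
  case (insert g F)
  have "smooth (\<lambda>z. c g * g z)" "smooth (\<lambda>z. \<Sum>f\<in>F. c f * f z)"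
    using insert by (simp_all add: smooth_mult[OF smooth_const])
  then have "smooth (\<lambda>z. c g * g z + (\<Sum>f\<in>F. c f * f z))" by (rule smooth_add)
  then show ?case using insert.hyps by simp
qed

lemma C_k_one_dim:
  fixes f :: "real \<Rightarrow> real"
  assumes "\<And>x. (f has_real_derivative f' x) (at x)" and "C_k n f'"
  shows "C_k (Suc n) f"
proof (rule C_k_SucI)
  show "(f has_derivative (\<lambda>v. v * f' x)) (at x)" for x
    using assms(1)[of x] by (simp add: has_field_derivative_def mult.commute[of _ "f' x"])
qed (intro C_k_mult C_k_const assms)

text \<open>The classical flat functions, the building blocks of smooth cut-offs. The factor \<open>x\<^sup>-\<^sup>k\<close> is
carried along because the family is then closed under differentiation up to linear combinations, which
makes smoothness a plain induction.\<close>

definition flat_exp :: "nat \<Rightarrow> real \<Rightarrow> real" where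
  "flat_exp k x = (if x \<le> 0 then 0 else exp (- 1 / x) / x ^ k)"

lemma flat_exp_tendsto_0: "(flat_exp k \<longlongrightarrow> 0) (at_right 0)"
proof -
  have "((\<lambda>y::real. y ^ k / exp y) \<longlongrightarrow> 0) at_top"
    by (rule tendsto_power_div_exp_0)
  then have "((\<lambda>x::real. inverse x ^ k / exp (inverse x)) \<longlongrightarrow> 0) (at_right 0)"
    by (rule filterlim_compose[OF _ filterlim_inverse_at_top_right])
  moreover have "\<forall>\<^sub>F x in at_right 0. inverse x ^ k / exp (inverse x) = flat_exp k x"
    by (auto simp: eventually_at_filter flat_exp_def exp_minus field_simps)
  ultimately show ?thesis by (rule Lim_transform_eventually)
qed

lemma flat_exp_has_derivative:
  "(flat_exp k has_real_derivative (flat_exp (k + 2) x - k * flat_exp (k + 1) x)) (at x)"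
proof -
  consider "x < 0" | "x = 0" | "x > 0" by linarith
  then show ?thesis
  proof cases
    case 1
    have "((\<lambda>_. 0) has_real_derivative (flat_exp (k + 2) x - k * flat_exp (k + 1) x)) (at x)"
      using 1 by (simp add: flat_exp_def)
    then show ?thesis
      by (rule has_field_derivative_transform_within_open[of _ _ _ "{..<0}"])
        (use 1 in \<open>auto simp: flat_exp_def\<close>)
  next
    case 3
    have "((\<lambda>x. exp (- 1 / x) / x ^ k) has_real_derivative (flat_exp (k + 2) x - k * flat_exp (k + 1) x)) (at x)"
    proof -
      have "((\<lambda>x. exp (- 1 / x)) has_real_derivative exp (- 1 / x) * (1 / x\<^sup>2)) (at x)"
        using 3 by (auto intro!: derivative_eq_intros simp: power2_eq_square)
      from DERIV_divide[OF this DERIV_pow[of k x]]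
      have "((\<lambda>x. exp (- 1 / x) / x ^ k) has_real_derivative
        (exp (- 1 / x) * (1 / x\<^sup>2) * x ^ k - exp (- 1 / x) * (real k * x ^ (k - Suc 0))) / (x ^ k * x ^ k)) (at x)"
        using 3 by simp
      moreover have "(exp (- 1 / x) * (1 / x\<^sup>2) * x ^ k - exp (- 1 / x) * (real k * x ^ (k - Suc 0))) / (x ^ k * x ^ k)
        = flat_exp (k + 2) x - k * flat_exp (k + 1) x"
      proof -
        have "e * (1 / x\<^sup>2) * x ^ k / (x ^ k * x ^ k) = e / x ^ (k + 2)"
          "e * (real k * x ^ (k - Suc 0)) / (x ^ k * x ^ k) = k * (e / x ^ (k + 1))" for e
          using 3 by (simp_all add: power_add power2_eq_square) (cases k; simp)
        then show ?thesis using 3 by (simp only: diff_divide_distrib flat_exp_def) simp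
      qed
      ultimately show ?thesis by simp
    qed
    then show ?thesis
      by (rule has_field_derivative_transform_within_open[of _ _ _ "{0<..}"])
        (use 3 in \<open>auto simp: flat_exp_def\<close>)
  next
    case 2
    have "(\<lambda>h. (flat_exp k (0 + h) - flat_exp k 0) / h) = flat_exp (Suc k)"
      by (auto simp: flat_exp_def fun_eq_iff)
    moreover have "(flat_exp (Suc k) \<longlongrightarrow> 0) (at 0)"
    proof (rule filterlim_split_at)
      show "(flat_exp (Suc k) \<longlongrightarrow> 0) (at_left 0)"
        by (rule tendsto_eventually) (auto simp: eventually_at_filter flat_exp_def)
    qed (rule flat_exp_tendsto_0)
    ultimately show ?thesis using 2 by (simp add: DERIV_def flat_exp_def)
  qed
qed

lemma smooth_flat_exp: "smooth (flat_exp k)"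
proof -
  have "C_k n (flat_exp k)" for n
  proof (induction n arbitrary: k)
    case 0
    show ?case unfolding C_k.simps
      by (meson flat_exp_has_derivative DERIV_isCont continuous_at_imp_continuous_on)
  next
    case (Suc n)
    have "C_k n (\<lambda>x. flat_exp (k + 2) x + (- real k) * flat_exp (k + 1) x)"
      by (intro C_k_add C_k_mult C_k_const Suc)
    then show ?case
      by (intro C_k_one_dim[OF flat_exp_has_derivative]) simp
  qed
  then show ?thesis by (simp add: smooth_def)
qed

text \<open>A regularisation of \<open>\<bar>s\<bar> powr (2 * a)\<close>: adding \<open>e > 0\<close> removes the singularity at the
origin, so that compositions with test functions remain smooth.\<close>

lemma smooth_sq_plus_powr:
  assumes "e > (0::real)"
  shows "smooth (\<lambda>s::real. (s\<^sup>2 + e) powr a)"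
proof -
  have pos: "s\<^sup>2 + e > 0" for s using assms by (simp add: add_nonneg_pos)
  have D: "((\<lambda>s. (s\<^sup>2 + e) powr a) has_real_derivative (2 * a * s * (s\<^sup>2 + e) powr (a - 1))) (at s)" for s a
    using pos[of s] by (auto intro!: derivative_eq_intros simp: powr_diff)
  have "C_k n (\<lambda>s. (s\<^sup>2 + e) powr a)" for n
  proof (induction n arbitrary: a)
    case 0
    have "isCont (\<lambda>s. (s\<^sup>2 + e) powr a) s" for s
      using D DERIV_isCont by blast
    then show ?case by (simp add: continuous_at_imp_continuous_on)
  next
    case (Suc n)
    show ?case
      by (intro C_k_one_dim[OF D] C_k_mult C_k_const Suc C_k_bounded_linear bounded_linear_ident)
  qed
  then show ?thesis by (simp add: smooth_def)
qed

lemma frechet_derivative_scaleR: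
  fixes f :: "'a::real_normed_vector \<Rightarrow> real"
  assumes "smooth f"
  shows "frechet_derivative f (at z) (s *\<^sub>R v) = frechet_derivative f (at z) v * s"
  using linear_cmul[OF has_derivative_linear[OF smooth_has_derivative[OF assms]], of z s v]
  by (simp add: mult.commute)

lemma smooth_dt:
  assumes "smooth \<phi>"
  shows "((\<lambda>s. \<phi> (s, x)) has_real_derivative dt \<phi> (t, x)) (at t)"
    and "smooth (dt \<phi>)"
proof -
  have *: "((\<lambda>s. \<phi> (s, x)) has_real_derivative frechet_derivative \<phi> (at (t, x)) (1, 0)) (at t)" for t x
  proof -
    have "((\<lambda>s. (s, x)) has_derivative (\<lambda>s. (s, 0))) (at t)"
      by (auto intro!: derivative_eq_intros)
    from has_derivative_compose[OF this smooth_has_derivative[OF assms]]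
    have "((\<lambda>s. \<phi> (s, x)) has_derivative (\<lambda>s. frechet_derivative \<phi> (at (t, x)) (s, 0))) (at t)" .
    moreover have "(\<lambda>s. frechet_derivative \<phi> (at (t, x)) (s, 0)) = (*) (frechet_derivative \<phi> (at (t, x)) (1, 0))"
      using frechet_derivative_scaleR[OF assms, of "(t, x)" _ "(1, 0)"] by (intro ext) (metis mult.right_neutral real_scaleR_def scaleR_Pair scaleR_zero_right)
    ultimately show ?thesis unfolding has_field_derivative_def by simp
  qed
  have eq: "dt \<phi> = (\<lambda>z. frechet_derivative \<phi> (at z) (1, 0))"
    unfolding dt_def using DERIV_imp_deriv[OF *] by auto
  then show "((\<lambda>s. \<phi> (s, x)) has_real_derivative dt \<phi> (t, x)) (at t)" "smooth (dt \<phi>)"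
    using * smooth_frechet_derivative[OF assms] by auto
qed

lemma smooth_dx:
  assumes "smooth \<phi>"
  shows "((\<lambda>s. \<phi> (t, x + s *\<^sub>R axis i 1)) has_real_derivative dx i \<phi> (t, x + s0 *\<^sub>R axis i 1)) (at s0)"
    and "smooth (dx i \<phi>)"
proof -
  have *: "((\<lambda>s. \<phi> (t, x + s *\<^sub>R axis i 1)) has_real_derivative
      frechet_derivative \<phi> (at (t, x + s0 *\<^sub>R axis i 1)) (0, axis i 1)) (at s0)" for t x s0
  proof -
    have "((\<lambda>s. (t, x + s *\<^sub>R axis i 1)) has_derivative (\<lambda>s. (0, s *\<^sub>R axis i 1))) (at s0)"
      by (auto intro!: derivative_eq_intros)
    from has_derivative_compose[OF this smooth_has_derivative[OF assms]]
    have "((\<lambda>s. \<phi> (t, x + s *\<^sub>R axis i 1)) has_derivative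
      (\<lambda>s. frechet_derivative \<phi> (at (t, x + s0 *\<^sub>R axis i 1)) (0, s *\<^sub>R axis i 1))) (at s0)" .
    moreover have "(\<lambda>s. frechet_derivative \<phi> (at (t, x + s0 *\<^sub>R axis i 1)) (0, s *\<^sub>R axis i 1))
        = (*) (frechet_derivative \<phi> (at (t, x + s0 *\<^sub>R axis i 1)) (0, axis i 1))"
      using frechet_derivative_scaleR[OF assms, of _ _ "(0, axis i 1)"] by (auto simp: fun_eq_iff)
    ultimately show ?thesis unfolding has_field_derivative_def by simp
  qed
  have "dx i \<phi> = (\<lambda>z. frechet_derivative \<phi> (at z) (0, axis i 1))"
    unfolding dx_def using DERIV_imp_deriv[OF *, of _ _ 0] by auto
  then show "((\<lambda>s. \<phi> (t, x + s *\<^sub>R axis i 1)) has_real_derivative dx i \<phi> (t, x + s0 *\<^sub>R axis i 1)) (at s0)"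
    "smooth (dx i \<phi>)"
    using * smooth_frechet_derivative[OF assms] by auto
qed

lemma dtI: "((\<lambda>s. \<phi> (s, x)) has_real_derivative D) (at t) \<Longrightarrow> dt \<phi> (t, x) = D"
  by (simp add: dt_def DERIV_imp_deriv)

lemma dxI: "((\<lambda>s. \<phi> (t, x + s *\<^sub>R axis i 1)) has_real_derivative D) (at 0) \<Longrightarrow> dx i \<phi> (t, x) = D"
  by (simp add: dx_def DERIV_imp_deriv)

lemma smooth_laplacian: "smooth \<phi> \<Longrightarrow> smooth (laplacian \<phi>)"
proof -
  assume sm: "smooth \<phi>"
  have "smooth (\<lambda>z. \<Sum>i\<in>I. dx i (dx i \<phi>) z)" if "finite I" for I
    using that
  proof (induction I rule: finite_induct)
    case (insert i I)
    then show ?case using smooth_add[OF smooth_dx(2)[OF smooth_dx(2)[OF sm]]] by simp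
  qed (simp add: smooth_const)
  then show ?thesis by (simp add: laplacian_def[abs_def])
qed

lemma periodic_derivatives:
  assumes "\<And>t. periodic (\<lambda>x. \<phi> (t, x))"
  shows "periodic (\<lambda>x. dt \<phi> (t, x))" "periodic (\<lambda>x. dx i \<phi> (t, x))"
proof -
  have *: "\<phi> (s, x + k) = \<phi> (s, x)" if "\<forall>i. k $ i \<in> \<int>" for s x k
    using assms[of s] that by (auto simp: periodic_def)
  then have **: "\<phi> (s, x + k + y) = \<phi> (s, x + y)" if "\<forall>i. k $ i \<in> \<int>" for s x y k
    using that by (metis add.assoc add.commute)
  show "periodic (\<lambda>x. dt \<phi> (t, x))" "periodic (\<lambda>x. dx i \<phi> (t, x))"
    unfolding periodic_def dt_def dx_def using * ** by auto
qed

text \<open>Linearity of the differential operators, which makes the weak formulation linear in the test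
function.\<close>

lemma derivatives_sum:
  assumes "finite F" "\<And>f. f \<in> F \<Longrightarrow> smooth f"
  shows "dt (\<lambda>z. \<Sum>f\<in>F. c f * f z) = (\<lambda>z. \<Sum>f\<in>F. c f * dt f z)"
    and "dx i (\<lambda>z. \<Sum>f\<in>F. c f * f z) = (\<lambda>z. \<Sum>f\<in>F. c f * dx i f z)"
    and "grad (\<lambda>z. \<Sum>f\<in>F. c f * f z) = (\<lambda>z. \<Sum>f\<in>F. c f *\<^sub>R grad f z)"
    and "laplacian (\<lambda>z. \<Sum>f\<in>F. c f * f z) = (\<lambda>z. \<Sum>f\<in>F. c f * laplacian f z)"
proof -
  have "dt (\<lambda>z. \<Sum>f\<in>F. c f * f z) (t, x) = (\<Sum>f\<in>F. c f * dt f (t, x))" for t x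
    by (intro dtI DERIV_sum DERIV_cmult smooth_dt assms)
  then show "dt (\<lambda>z. \<Sum>f\<in>F. c f * f z) = (\<lambda>z. \<Sum>f\<in>F. c f * dt f z)" by auto
  have dxs: "dx i (\<lambda>z. \<Sum>f\<in>F. c f * g f z) = (\<lambda>z. \<Sum>f\<in>F. c f * dx i (g f) z)"
    if "\<And>f. f \<in> F \<Longrightarrow> smooth (g f)" for i g
  proof -
    have "dx i (\<lambda>z. \<Sum>f\<in>F. c f * g f z) (t, x) = (\<Sum>f\<in>F. c f * dx i (g f) (t, x))" for t x
    proof (intro dxI DERIV_sum DERIV_cmult)
      fix f assume "f \<in> F"
      from smooth_dx(1)[OF that[OF this], of t x i 0]
      show "((\<lambda>s. g f (t, x + s *\<^sub>R axis i 1)) has_real_derivative dx i (g f) (t, x)) (at 0)" by simp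
    qed
    then show ?thesis by auto
  qed
  show dx1: "dx i (\<lambda>z. \<Sum>f\<in>F. c f * f z) = (\<lambda>z. \<Sum>f\<in>F. c f * dx i f z)" for i
    using dxs[of "\<lambda>f. f"] assms by auto
  show "grad (\<lambda>z. \<Sum>f\<in>F. c f * f z) = (\<lambda>z. \<Sum>f\<in>F. c f *\<^sub>R grad f z)"
    by (auto simp: grad_def dx1 vec_eq_iff fun_eq_iff)
  have "dx i (\<lambda>z. \<Sum>f\<in>F. c f * dx i f z) = (\<lambda>z. \<Sum>f\<in>F. c f * dx i (dx i f) z)" for i
    using dxs[of "\<lambda>f. dx i f"] assms by (auto simp: smooth_dx)
  then show "laplacian (\<lambda>z. \<Sum>f\<in>F. c f * f z) = (\<lambda>z. \<Sum>f\<in>F. c f * laplacian f z)"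
    by (auto simp: laplacian_def dx1 sum_distrib_left fun_eq_iff intro: sum.swap)
qed

section \<open>Two minimisation arguments in convex sets\<close>

text \<open>If a bounded convex set stayed away from the origin, a near minimiser \<open>x\<close> of the Euclidean
norm would define a linear functional that is bounded below by a positive constant on the set; the
hypothesis on linear functionals excludes this. Arguing with near minimisers avoids taking closures, and indexing the coordinates
by an arbitrary finite set makes the dimension a variable.\<close>

lemma convex_set_near_zero:
  fixes S :: "('i \<Rightarrow> real) set" and B \<epsilon> :: real
  assumes fin: "finite F" and ne: "S \<noteq> {}"
    and conv: "\<And>x y s. x \<in> S \<Longrightarrow> y \<in> S \<Longrightarrow> 0 \<le> s \<Longrightarrow> s \<le> 1 \<Longrightarrow> (\<lambda>i. (1 - s) * x i + s * y i) \<in> S"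
    and bdd: "\<And>x i. x \<in> S \<Longrightarrow> i \<in> F \<Longrightarrow> \<bar>x i\<bar> \<le> B"
    and supp: "\<And>c \<eta>. \<eta> > 0 \<Longrightarrow> \<exists>x\<in>S. (\<Sum>i\<in>F. c i * x i) \<le> \<eta>"
    and "\<epsilon> > 0"
  shows "\<exists>x\<in>S. \<forall>i\<in>F. \<bar>x i\<bar> \<le> \<epsilon>"
proof (rule ccontr)
  assume far: "\<not> ?thesis"
  define G where "G x = (\<Sum>i\<in>F. (x i)\<^sup>2)" for x :: "'i \<Rightarrow> real"
  define m where "m = Inf (G ` S)"
  have far': "\<epsilon>\<^sup>2 \<le> G x" if "x \<in> S" for x
  proof -
    have "\<not> (\<forall>i\<in>F. \<bar>x i\<bar> \<le> \<epsilon>)" 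
    proof
      assume "\<forall>i\<in>F. \<bar>x i\<bar> \<le> \<epsilon>"
      then have "\<exists>x\<in>S. \<forall>i\<in>F. \<bar>x i\<bar> \<le> \<epsilon>" using that by (rule bexI)
      with far show False by (rule notE)
    qed
    then obtain i where i: "i \<in> F" "\<bar>x i\<bar> > \<epsilon>" by (auto simp: not_le)
    have "\<epsilon>\<^sup>2 \<le> (x i)\<^sup>2" using i \<open>\<epsilon> > 0\<close> by (metis abs_le_square_iff abs_of_pos less_imp_le)
    also have "\<dots> \<le> G x" unfolding G_def using fin i by (intro member_le_sum) auto
    finally show ?thesis .
  qed
  have bb: "bdd_below (G ` S)" using far' by (intro bdd_belowI2)
  have m_le: "m \<le> G x" if "x \<in> S" for x unfolding m_def using that bb by (intro cInf_lower) auto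
  have "\<epsilon>\<^sup>2 \<le> m" unfolding m_def using ne far' by (intro cInf_greatest) auto
  then have m0: "m > 0" using \<open>\<epsilon> > 0\<close> by (meson less_le_trans zero_less_power)
  define D where "D = real (card F) * (2 * B)\<^sup>2"
  have D0: "D \<ge> 0" by (simp add: D_def)
  have D: "(\<Sum>i\<in>F. (y i - x i)\<^sup>2) \<le> D" if "x \<in> S" "y \<in> S" for x y
  proof -
    have "(y i - x i)\<^sup>2 \<le> (2 * B)\<^sup>2" if "i \<in> F" for i
      using bdd[OF \<open>x \<in> S\<close> that] bdd[OF \<open>y \<in> S\<close> that] by (intro abs_le_square_iff[THEN iffD1]) linarith
    then show ?thesis unfolding D_def using sum_bounded_above[of F "\<lambda>i. (y i - x i)\<^sup>2"] by simp
  qed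
  \<comment> \<open>step towards \<open>y\<close>: the linear gain is of order \<open>s * m\<close>, and the bound on \<open>s\<close> keeps the quadratic loss
    \<open>s\<^sup>2 * D\<close> below a quarter of \<open>s * m\<close>\<close>
  define s where "s = min 1 (m / (4 * (D + 1)))"
  have s: "s > 0" "s \<le> 1" using m0 D0 by (auto simp: s_def)
  have sD: "s * D \<le> m / 4"
  proof -
    have "s * D \<le> m / (4 * (D + 1)) * (D + 1)" using D0 m0 by (intro mult_mono) (auto simp: s_def)
    also have "\<dots> = m / 4" using D0 by (simp add: field_simps)
    finally show ?thesis .
  qed
  have "m < m + s * m" using s m0 by simp
  then obtain x where x: "x \<in> S" "G x < m + s * m"
    using cInf_lessD[of "G ` S" "m + s * m"] ne unfolding m_def[symmetric] by auto
  obtain y where y: "y \<in> S" "(\<Sum>i\<in>F. x i * y i) \<le> m / 4"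
    using supp[of "m / 4" x] m0 by auto
  have "G (\<lambda>i. (1 - s) * x i + s * y i)
      = G x + 2 * s * ((\<Sum>i\<in>F. x i * y i) - G x) + s\<^sup>2 * (\<Sum>i\<in>F. (y i - x i)\<^sup>2)"
    unfolding G_def sum_distrib_left sum_subtractf[symmetric] sum.distrib[symmetric]
    by (intro sum.cong refl) (simp add: power2_eq_square algebra_simps)
  also have "\<dots> \<le> G x + 2 * s * (m / 4 - m) + s\<^sup>2 * D"
  proof -
    have "s * ((\<Sum>i\<in>F. x i * y i) - G x) \<le> s * (m / 4 - m)"
      using s y(2) m_le[OF x(1)] by (intro mult_left_mono) auto
    moreover have "s\<^sup>2 * (\<Sum>i\<in>F. (y i - x i)\<^sup>2) \<le> s\<^sup>2 * D"
      using D[OF x(1) y(1)] by (intro mult_left_mono) auto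
    ultimately show ?thesis by (simp only: mult.assoc)
  qed
  also have "s\<^sup>2 * D \<le> s * (m / 4)" using sD s by (simp add: power2_eq_square mult.assoc)
  also have "G x + 2 * s * (m / 4 - m) + s * (m / 4) < m"
  proof -
    have "G x + 2 * s * (m / 4 - m) + s * (m / 4) = G x - 5 / 4 * (s * m)" by (simp add: field_simps)
    then show ?thesis using x(2) mult_pos_pos[OF s(1) m0] by linarith
  qed
  finally have "G (\<lambda>i. (1 - s) * x i + s * y i) < m" by simp
  moreover have "m \<le> G (\<lambda>i. (1 - s) * x i + s * y i)"
    using conv[OF x(1) y(1)] s by (intro m_le) auto
  ultimately show False by simp
qed

text \<open>A strictly convex function of linear growth: its integral is finite on all of \<open>L\<^sup>1\<close>, whereas
powers would demand more integrability than is available for exponents close to one.\<close>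

definition bracket :: "real \<Rightarrow> real" where "bracket s = sqrt (1 + s\<^sup>2)"

lemma bracket_bounds: "0 \<le> bracket s" "1 \<le> bracket s" "\<bar>s\<bar> \<le> bracket s" "bracket s \<le> 1 + \<bar>s\<bar>"
  unfolding bracket_def by (auto intro!: real_le_rsqrt real_le_lsqrt simp: power2_eq_square algebra_simps)

lemma bracket_measurable[measurable]: "bracket \<in> borel_measurable borel"
  unfolding bracket_def[abs_def] by measurable

text \<open>Regard \<open>bracket a\<close> as the length of the plane vector \<open>(1, a)\<close>. The gap is then the defect in the
triangle inequality for \<open>(1, a)\<close> and \<open>(1, b)\<close>, and by Lagrange's identity that defect controls their
determinant \<open>b - a\<close>.\<close>

lemma bracket_convexity_gap:
  "(a - b)\<^sup>2 \<le> ((bracket a + bracket b) / 2 - bracket ((a + b) / 2)) * (bracket a + bracket b) ^ 3"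
proof -
  define p q m S where "p = bracket a" and "q = bracket b" and "m = bracket ((a + b) / 2)" and "S = p + q"
  have p2: "p\<^sup>2 = 1 + a\<^sup>2" and q2: "q\<^sup>2 = 1 + b\<^sup>2" and m2: "(2 * m)\<^sup>2 = 4 + (a + b)\<^sup>2"
    unfolding p_def q_def m_def bracket_def by (auto simp: power_mult_distrib power_divide)
  have p0: "p \<ge> 1" and q0: "q \<ge> 1" and m0: "m \<ge> 1" using bracket_bounds unfolding p_def q_def m_def by auto
  have "(p * q)\<^sup>2 - (1 + a * b)\<^sup>2 = (a - b)\<^sup>2"
    unfolding power_mult_distrib p2 q2 by (simp add: power2_eq_square algebra_simps)
  then have 1: "(a - b)\<^sup>2 = (p * q - (1 + a * b)) * (p * q + (1 + a * b))"
    by (simp add: power2_eq_square algebra_simps)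
  have "(1 + a * b)\<^sup>2 \<le> (p * q)\<^sup>2"
    using \<open>(p * q)\<^sup>2 - (1 + a * b)\<^sup>2 = (a - b)\<^sup>2\<close> zero_le_power2[of "a - b"] by linarith
  then have ab: "\<bar>1 + a * b\<bar> \<le> p * q"
    using p0 q0 by (simp add: abs_le_square_iff[symmetric])
  have pq: "2 * (p * q) \<le> S\<^sup>2 / 2"
    unfolding S_def using zero_le_power2[of "p - q"] by (simp add: power2_eq_square algebra_simps)
  have 2: "2 * (p * q - (1 + a * b)) = (S - 2 * m) * (S + 2 * m)"
  proof -
    have "(S - 2 * m) * (S + 2 * m) = S\<^sup>2 - (2 * m)\<^sup>2" by (simp add: power2_eq_square algebra_simps)
    also have "\<dots> = p\<^sup>2 + q\<^sup>2 + 2 * (p * q) - (4 + (a + b)\<^sup>2)"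
      unfolding m2 by (simp add: S_def power2_eq_square algebra_simps)
    also have "\<dots> = 2 * (p * q - (1 + a * b))"
      unfolding p2 q2 by (simp add: power2_eq_square algebra_simps)
    finally show ?thesis by simp
  qed
  have Sm: "2 * m \<le> S"
  proof -
    have "0 \<le> (S - 2 * m) * (S + 2 * m)" unfolding 2[symmetric] using ab by simp
    moreover have "S + 2 * m > 0" using p0 q0 m0 by (simp add: S_def)
    ultimately show ?thesis by (simp add: zero_le_mult_iff)
  qed
  have "(a - b)\<^sup>2 \<le> (p * q - (1 + a * b)) * (S\<^sup>2 / 2)"
    unfolding 1 using ab pq by (intro mult_left_mono) linarith+
  also have "\<dots> = (S - 2 * m) * (S + 2 * m) / 2 * (S\<^sup>2 / 2)" using 2 by simp
  also have "\<dots> \<le> (S - 2 * m) * (S + S) / 2 * (S\<^sup>2 / 2)"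
    using Sm by (intro mult_right_mono divide_right_mono mult_left_mono) auto
  also have "\<dots> = (S / 2 - m) * S ^ 3" by (simp add: power2_eq_square power3_eq_cube field_simps)
  finally show ?thesis unfolding S_def p_def q_def m_def .
qed

text \<open>Linearised form of the previous inequality. After integration a large \<open>K\<close> makes the last term small,
and for this \<open>K\<close> a small convexity gap then makes the first one small.\<close>

lemma sqrt_dist_le_gap:
  assumes "K > 0"
  shows "sqrt \<bar>a - b\<bar> \<le> K ^ 3 * ((bracket a + bracket b) / 2 - bracket ((a + b) / 2)) + (bracket a + bracket b) / K"
proof -
  define y \<delta> S where "y = sqrt \<bar>a - b\<bar>" and "\<delta> = (bracket a + bracket b) / 2 - bracket ((a + b) / 2)"
    and "S = bracket a + bracket b"
  have S0: "S > 0" using bracket_bounds(2)[of a] bracket_bounds(2)[of b] by (simp add: S_def)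
  have y4: "y ^ 4 = (a - b)\<^sup>2"
  proof -
    have "y ^ 4 = (y\<^sup>2)\<^sup>2" by simp
    also have "y\<^sup>2 = \<bar>a - b\<bar>" by (simp add: y_def)
    finally show ?thesis by simp
  qed
  have gap: "y ^ 4 \<le> \<delta> * S ^ 3" using bracket_convexity_gap[of a b] by (simp add: y4 \<delta>_def S_def)
  have "0 \<le> \<delta> * S ^ 3" using gap y4 by (metis order_trans zero_le_power2)
  then have \<delta>0: "\<delta> \<ge> 0" using S0 by (simp add: zero_le_mult_iff)
  have "y \<le> K ^ 3 * \<delta> + S / K"
  proof (cases "y \<le> S / K")
    case True
    then show ?thesis using \<delta>0 assms by (simp add: add_increasing)
  next
    case False
    then have yS: "S \<le> y * K" using assms by (simp add: field_simps)
    have y0: "y > 0" using False S0 assms by (smt (verit) divide_pos_pos)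
    have "y ^ 4 \<le> \<delta> * (y * K) ^ 3"
      using gap yS \<delta>0 S0 by (meson less_imp_le mult_left_mono order_trans power_mono)
    then have "y * y ^ 3 \<le> K ^ 3 * \<delta> * y ^ 3"
      by (simp add: power_mult_distrib eval_nat_numeral mult_ac)
    then have "y \<le> K ^ 3 * \<delta>" using y0 by simp
    then show ?thesis using S0 assms by (simp add: add_increasing2)
  qed
  then show ?thesis by (simp add: y_def \<delta>_def S_def)
qed

lemma AE_summable_of_sqrt_bound:
  fixes f :: "nat \<Rightarrow> 'a \<Rightarrow> real"
  assumes [measurable]: "\<And>n. f n \<in> borel_measurable M"
    and bd: "\<And>n. (\<integral>\<^sup>+x. ennreal (sqrt \<bar>f n x\<bar>) \<partial>M) \<le> ennreal ((1/2) ^ n)"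
  shows "AE x in M. summable (\<lambda>n. \<bar>f n x\<bar>)"
proof -
  have "(\<integral>\<^sup>+x. (\<Sum>n. ennreal (sqrt \<bar>f n x\<bar>)) \<partial>M) = (\<Sum>n. \<integral>\<^sup>+x. ennreal (sqrt \<bar>f n x\<bar>) \<partial>M)"
    by (rule nn_integral_suminf) measurable
  also have "\<dots> \<le> (\<Sum>n. ennreal ((1/2) ^ n))" by (intro suminf_le bd) auto
  also have "\<dots> = ennreal (\<Sum>n. (1/2) ^ n)" by (rule suminf_ennreal2) (auto intro: summable_geometric)
  also have "\<dots> < \<infinity>" by simp
  finally have "AE x in M. (\<Sum>n. ennreal (sqrt \<bar>f n x\<bar>)) \<noteq> \<infinity>"
    by (intro nn_integral_noteq_infinite) auto
  then show ?thesis
  proof eventually_elim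
    case (elim x)
    then have s: "summable (\<lambda>n. sqrt \<bar>f n x\<bar>)"
      by (intro summable_suminf_not_top) (auto simp: infinity_ennreal_def)
    then have "(\<lambda>n. sqrt \<bar>f n x\<bar>) \<longlonglongrightarrow> 0" by (rule summable_LIMSEQ_zero)
    then have "eventually (\<lambda>n. sqrt \<bar>f n x\<bar> < 1) sequentially" by (rule order_tendstoD) simp
    then have "eventually (\<lambda>n. norm \<bar>f n x\<bar> \<le> sqrt \<bar>f n x\<bar>) sequentially"
    proof eventually_elim
      case (elim n)
      have "\<bar>f n x\<bar> = sqrt \<bar>f n x\<bar> * sqrt \<bar>f n x\<bar>" by simp
      also have "\<dots> \<le> sqrt \<bar>f n x\<bar> * 1" using elim by (intro mult_left_mono) auto
      finally show ?case by simp
    qed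
    then show ?case by (rule summable_comparison_test_ev[OF _ s])
  qed
qed

text \<open>A substitute for weak compactness. Minimise \<open>\<integral> bracket u\<close> over each member of the family, and call \<open>ms\<close> the
supremum of the minima. Two near minimisers in a member whose minimum is close to \<open>ms\<close> have a midpoint that
cannot do much better, so their convexity gap is small and they are close. Along a decreasing sequence
of members this gives a sequence that converges almost everywhere. Intersecting these members with an
arbitrary \<open>K\<close> changes the minima by little, and this produces a sequence inside \<open>K\<close> with the same limit.\<close>

lemma (in finite_measure) convex_family_limit:
  fixes \<K> :: "('a \<Rightarrow> real) set set" and C :: real
  assumes ne: "\<K> \<noteq> {}" "{} \<notin> \<K>"
    and inter: "\<And>K L. K \<in> \<K> \<Longrightarrow> L \<in> \<K> \<Longrightarrow> K \<inter> L \<in> \<K>"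
    and int: "\<And>K u. K \<in> \<K> \<Longrightarrow> u \<in> K \<Longrightarrow> integrable M u"
    and bd: "\<And>K u. K \<in> \<K> \<Longrightarrow> u \<in> K \<Longrightarrow> (\<integral>x. \<bar>u x\<bar> \<partial>M) \<le> C"
    and mid: "\<And>K u v. K \<in> \<K> \<Longrightarrow> u \<in> K \<Longrightarrow> v \<in> K \<Longrightarrow> (\<lambda>x. (u x + v x) / 2) \<in> K"
  obtains U where "\<And>n. U n \<in> \<Union>\<K>" and "AE x in M. convergent (\<lambda>n. U n x)"
    and "\<And>K. K \<in> \<K> \<Longrightarrow> \<exists>V. (\<forall>n. V n \<in> K) \<and> (AE x in M. (\<lambda>n. V n x - U n x) \<longlonglongrightarrow> 0)"
proof -
  define J where "J u = (\<integral>x. bracket (u x) \<partial>M)" for u :: "'a \<Rightarrow> real"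
  define C1 where "C1 = measure M (space M) + C"
  have intb: "integrable M (\<lambda>x. bracket (u x))" if "integrable M u" for u
  proof -
    have [measurable]: "u \<in> borel_measurable M" using that by simp
    show ?thesis
      by (rule Bochner_Integration.integrable_bound[of M "\<lambda>x. 1 + \<bar>u x\<bar>"])
        (use that bracket_bounds(1,4)[of "u _"] in auto)
  qed
  have J0: "0 \<le> J u" for u unfolding J_def by (simp add: bracket_bounds)
  have JC: "J u \<le> C1" if "K \<in> \<K>" "u \<in> K" for u K
  proof -
    have "J u \<le> (\<integral>x. 1 + \<bar>u x\<bar> \<partial>M)"
      unfolding J_def using int[OF that] by (intro integral_mono intb bracket_bounds) auto
    also have "\<dots> = measure M (space M) + (\<integral>x. \<bar>u x\<bar> \<partial>M)" using int[OF that] by simp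
    finally show ?thesis using bd[OF that] by (simp add: C1_def)
  qed
  have C10: "C1 \<ge> 0" using ne JC J0 by (metis ex_in_conv order_trans)
  define mK where "mK K = Inf (J ` K)" for K
  have bb: "bdd_below (J ` K)" for K using J0 by (intro bdd_belowI2)
  have mK_le: "mK K \<le> J u" if "u \<in> K" for u K unfolding mK_def using that bb by (intro cInf_lower) auto
  have nempty: "K \<noteq> {}" if "K \<in> \<K>" for K using ne that by auto
  have mK_mono: "mK L \<le> mK K" if "K \<subseteq> L" "K \<in> \<K>" for K L
    unfolding mK_def using that bb nempty by (intro cInf_superset_mono) auto
  have mK_C: "mK K \<le> C1" if "K \<in> \<K>" for K
    using mK_le JC[OF that] nempty[OF that] by (metis ex_in_conv order_trans)
  define ms where "ms = Sup (mK ` \<K>)"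
  have ba: "bdd_above (mK ` \<K>)" using mK_C by (intro bdd_aboveI2)
  have mK_ms: "mK K \<le> ms" if "K \<in> \<K>" for K unfolding ms_def using that ba by (intro cSup_upper) auto
  \<comment> \<open>the parameter \<open>K\<close> of \<open>sqrt_dist_le_gap\<close> and the tolerance for near minimisers, chosen so that near
    minimisers are at distance at most \<open>(1/2) ^ n\<close>\<close>
  define k where "k n = 4 * (C1 + 1) * 2 ^ n" for n :: nat
  define w where "w n = (1/2) ^ n / (4 * k n ^ 3)" for n :: nat
  have k0: "k n > 0" for n using C10 by (simp add: k_def)
  have w0: "w n > 0" for n using k0 by (simp add: w_def)
  have w_dec: "w (Suc n) \<le> w n" for n
  proof -
    have "k n \<le> k (Suc n)" using C10 by (simp add: k_def)
    then show ?thesis unfolding w_def using k0[of n] k0[of "Suc n"]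
      by (intro frac_le mult_left_mono power_mono) auto
  qed
  have close: "(\<integral>\<^sup>+x. ennreal (sqrt \<bar>u x - v x\<bar>) \<partial>M) \<le> ennreal ((1/2) ^ n)"
    if uv: "K \<in> \<K>" "u \<in> K" "v \<in> K" and J: "J u \<le> ms + w n" "J v \<le> ms + w n" "ms - w n \<le> mK K" for u v n K
  proof -
    let ?g = "\<lambda>x. k n ^ 3 * ((bracket (u x) + bracket (v x)) / 2 - bracket ((u x + v x) / 2))
        + (bracket (u x) + bracket (v x)) / k n"
    have i: "integrable M u" "integrable M v" using int uv by auto
    then have bi: "integrable M (\<lambda>x. bracket (u x))" "integrable M (\<lambda>x. bracket (v x))"
      "integrable M (\<lambda>x. bracket ((u x + v x) / 2))" by (auto intro: intb)
    then have gi: "integrable M ?g" by simp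
    have "(\<integral>\<^sup>+x. ennreal (sqrt \<bar>u x - v x\<bar>) \<partial>M) \<le> (\<integral>\<^sup>+x. ennreal (?g x) \<partial>M)"
      by (intro nn_integral_mono ennreal_leI sqrt_dist_le_gap k0)
    also have "\<dots> = ennreal (\<integral>x. ?g x \<partial>M)"
    proof (rule nn_integral_eq_integral[OF gi])
      have "0 \<le> ?g x" for x by (rule order_trans[OF _ sqrt_dist_le_gap[OF k0, of "u x" "v x"]]) simp
      then show "AE x in M. 0 \<le> ?g x" by simp
    qed
    also have "(\<integral>x. ?g x \<partial>M) = k n ^ 3 * ((J u + J v) / 2 - J (\<lambda>x. (u x + v x) / 2)) + (J u + J v) / k n"
      unfolding J_def using bi by simp
    also have "\<dots> \<le> k n ^ 3 * (2 * w n) + 2 * C1 / k n"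
    proof (intro add_mono mult_left_mono divide_right_mono)
      show "(J u + J v) / 2 - J (\<lambda>x. (u x + v x) / 2) \<le> 2 * w n"
        using J mK_le[OF mid[OF uv]] by (simp add: field_simps)
      show "J u + J v \<le> 2 * C1" using JC[OF uv(1,2)] JC[OF uv(1,3)] by simp
    qed (use k0[of n] in auto)
    also have "\<dots> \<le> (1/2) ^ n / 2 + (1/2) ^ n / 2"
    proof (intro add_mono)
      show "k n ^ 3 * (2 * w n) \<le> (1/2) ^ n / 2" using k0[of n] by (simp add: w_def)
      have "2 * C1 / k n \<le> 2 * (C1 + 1) / k n" using k0[of n] by (intro divide_right_mono) auto
      also have "\<dots> = (1/2) ^ n / 2"
      proof -
        have "2 * c / (4 * c * 2 ^ n) = (1/2) ^ n / 2" if "c > 0" for c :: real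
          using that by (simp add: field_simps power_one_over)
        from this[of "C1 + 1"] show ?thesis using C10 by (simp add: k_def)
      qed
      finally show "2 * C1 / k n \<le> (1/2) ^ n / 2" .
    qed
    finally show ?thesis by (simp add: ennreal_leI)
  qed
  have "\<exists>K\<in>\<K>. ms - w n < mK K" for n
    using less_cSup_iff[of "mK ` \<K>" "ms - w n"] ba ne(1) w0[of n] by (auto simp: ms_def)
  then obtain G where G: "\<And>n. G n \<in> \<K>" "\<And>n. ms - w n < mK (G n)" by metis
  define H where "H n = (\<Inter>i\<le>n. G i)" for n
  have H: "H n \<in> \<K>" for n
  proof (induction n)
    case (Suc n)
    have "H (Suc n) = H n \<inter> G (Suc n)" by (auto simp: H_def atMost_Suc)
    then show ?case using inter Suc G by auto
  qed (simp add: H_def G)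
  have HG: "ms - w n \<le> mK (H n)" for n
  proof -
    have "H n \<subseteq> G n" by (auto simp: H_def)
    then show ?thesis using mK_mono[of "H n" "G n"] H G(2)[of n] by (smt (verit))
  qed
  have Hdec: "H (Suc n) \<subseteq> H n" for n by (auto simp: H_def)
  have near: "\<exists>u. u \<in> K \<and> J u \<le> ms + w n" if K: "K \<in> \<K>" for K n
  proof -
    have "mK K < mK K + w n" using w0 by simp
    then obtain u where "u \<in> K" "J u < mK K + w n"
      using cInf_lessD[of "J ` K" "mK K + w n"] nempty[OF K] unfolding mK_def[symmetric] by auto
    then show ?thesis using mK_ms[OF K] by (intro exI[of _ u]) auto
  qed
  have "\<forall>n. \<exists>u. u \<in> H n \<and> J u \<le> ms + w n" using near[OF H] by blast
  from choice[OF this] obtain U where U: "\<And>n. U n \<in> H n" "\<And>n. J (U n) \<le> ms + w n" by blast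
  have Um[measurable]: "U n \<in> borel_measurable M" for n using int[OF H U(1)] by simp
  have "AE x in M. summable (\<lambda>n. \<bar>U (Suc n) x - U n x\<bar>)"
  proof (rule AE_summable_of_sqrt_bound)
    fix n
    show "(\<integral>\<^sup>+x. ennreal (sqrt \<bar>U (Suc n) x - U n x\<bar>) \<partial>M) \<le> ennreal ((1/2) ^ n)"
      by (rule close[OF H _ U(1) _ U(2) HG]) (use U(1)[of "Suc n"] Hdec[of n] order_trans[OF U(2)[of "Suc n"] add_left_mono[OF w_dec[of n]]] in auto)
  qed measurable
  then have conv: "AE x in M. convergent (\<lambda>n. U n x)"
  proof eventually_elim
    case (elim x)
    then have "summable (\<lambda>n. U (Suc n) x - U n x)" by (rule summable_rabs_cancel)
    then have "(\<lambda>n. \<Sum>i<n. U (Suc i) x - U i x) \<longlonglongrightarrow> (\<Sum>i. U (Suc i) x - U i x)" by (rule summable_LIMSEQ)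
    moreover have "(\<Sum>i<n. U (Suc i) x - U i x) = U n x - U 0 x" for n by (rule sum_lessThan_telescope)
    ultimately have "(\<lambda>n. U n x - U 0 x) \<longlonglongrightarrow> (\<Sum>i. U (Suc i) x - U i x)" by simp
    from tendsto_add[OF this tendsto_const[of "U 0 x"]] show ?case by (auto simp: convergent_def)
  qed
  have near_K: "\<exists>V. (\<forall>n. V n \<in> K) \<and> (AE x in M. (\<lambda>n. V n x - U n x) \<longlonglongrightarrow> 0)" if K: "K \<in> \<K>" for K
  proof -
    have HK: "H n \<inter> K \<in> \<K>" for n using inter H K by auto
    have "\<forall>n. \<exists>u. u \<in> H n \<inter> K \<and> J u \<le> ms + w n" using near[OF HK] by blast
    from choice[OF this] obtain V where V: "\<And>n. V n \<in> H n \<inter> K" "\<And>n. J (V n) \<le> ms + w n" by blast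
    have [measurable]: "V n \<in> borel_measurable M" for n using int[OF HK V(1)] by simp
    have "AE x in M. summable (\<lambda>n. \<bar>V n x - U n x\<bar>)"
      by (rule AE_summable_of_sqrt_bound) (use V U HG in \<open>auto intro!: close[OF H]\<close>)
    then have "AE x in M. (\<lambda>n. V n x - U n x) \<longlonglongrightarrow> 0"
    proof eventually_elim
      case (elim x)
      then show ?case by (rule summable_LIMSEQ_zero[OF summable_rabs_cancel])
    qed
    then show ?thesis using V by auto
  qed
  show ?thesis
    by (rule that[of U]) (use U H conv near_K in auto)
qed

section \<open>Lebesgue measure on the period cell and on the time interval\<close>

text \<open>Integration over the torus, as a measure on the whole space: its measurable sets are the Borel
sets, which spares all considerations about measurability relative to the cube.\<close>

definition cell :: "(real ^ 'd) measure" where "cell = density lborel (indicator (cbox 0 1))"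
definition slab :: "real \<Rightarrow> real measure" where "slab T = density lborel (indicator {0..T})"

lemma sets_cell[simp, measurable_cong]: "sets cell = sets borel" by (simp add: cell_def)
lemma space_cell[simp]: "space cell = UNIV" by (simp add: cell_def)
lemma sets_slab[simp, measurable_cong]: "sets (slab T) = sets borel" by (simp add: slab_def)
lemma space_slab[simp]: "space (slab T) = UNIV" by (simp add: slab_def)

lemma emeasure_cell: "emeasure (cell :: (real ^ 'd) measure) UNIV = 1"
proof -
  have "(1 :: real ^ 'd) \<bullet> b = 1" if "b \<in> Basis" for b
    using that by (auto simp: Basis_vec_def inner_axis)
  then have "emeasure lborel (cbox 0 (1 :: real ^ 'd)) = 1"
    by (subst emeasure_lborel_cbox) (auto intro!: prod.neutral)
  then show ?thesis by (simp add: cell_def emeasure_density)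
qed

lemma emeasure_slab: "T \<ge> 0 \<Longrightarrow> emeasure (slab T) UNIV = ennreal T"
  by (simp add: slab_def emeasure_density)

lemma finite_measure_cell: "finite_measure cell"
  by (rule finite_measureI) (simp add: emeasure_cell)

lemma finite_measure_slab: "finite_measure (slab T)"
  by (rule finite_measureI) (cases "T \<ge> 0"; simp add: slab_def emeasure_density)

lemma sigma_finite_cell: "sigma_finite_measure cell"
  by (rule finite_measure.axioms(1)[OF finite_measure_cell])

lemma sigma_finite_slab: "sigma_finite_measure (slab T)"
  using finite_measure_slab by (simp add: finite_measure.axioms(1))

lemma pair_sigma_finite_slab_cell: "pair_sigma_finite (slab T) cell"
  by (intro pair_sigma_finite.intro sigma_finite_cell sigma_finite_slab)

lemma sets_slab_cell[measurable_cong]: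
  "sets (slab T \<Otimes>\<^sub>M (cell :: (real ^ 'd) measure)) = sets (borel :: (real \<times> (real ^ 'd)) measure)"
  by (simp add: borel_prod[symmetric] cong: sets_pair_measure_cong)

lemma finite_measure_slab_cell: "finite_measure (slab T \<Otimes>\<^sub>M cell)"
  by (intro finite_measure_pair_measure finite_measure_slab finite_measure_cell)

lemma AE_slab_cell_iff:
  assumes "{z. P z} \<in> sets borel"
  shows "(AE z in slab T \<Otimes>\<^sub>M (cell :: (real ^ 'd) measure). P z) \<longleftrightarrow> (AE t in slab T. AE x in cell. P (t, x))"
proof -
  interpret pair_sigma_finite "slab T" "cell :: (real ^ 'd) measure" by (rule pair_sigma_finite_slab_cell)
  have "space (slab T \<Otimes>\<^sub>M (cell :: (real ^ 'd) measure)) = UNIV" by (simp add: space_pair_measure)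
  then have "{z \<in> space (slab T \<Otimes>\<^sub>M (cell :: (real ^ 'd) measure)). P z} \<in> sets (slab T \<Otimes>\<^sub>M (cell :: (real ^ 'd) measure))"
    using assms by (simp only: sets_slab_cell UNIV_I simp_thms)
  from AE_pair_iff[of "\<lambda>t x. P (t, x)"] this show ?thesis by simp
qed

lemma nn_integral_slab_cell:
  assumes "f \<in> borel_measurable (borel :: (real \<times> (real ^ 'd)) measure)"
  shows "(\<integral>\<^sup>+z. f z \<partial>(slab T \<Otimes>\<^sub>M cell)) = (\<integral>\<^sup>+t. \<integral>\<^sup>+x. f (t, x) \<partial>cell \<partial>slab T)"
proof -
  interpret pair_sigma_finite "slab T" "cell :: (real ^ 'd) measure" by (rule pair_sigma_finite_slab_cell)
  have "f \<in> borel_measurable (slab T \<Otimes>\<^sub>M cell)" using assms by measurable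
  from M2.nn_integral_fst[OF this] show ?thesis by simp
qed

lemma borel_measurable_slice:
  assumes "f \<in> borel_measurable (borel :: ('a::euclidean_space \<times> 'b::euclidean_space) measure)"
  shows "(\<lambda>x. f (t, x)) \<in> borel_measurable borel"
  using assms by (simp add: borel_prod[symmetric])

lemma AE_cell_I: "(\<And>x. x \<in> cbox 0 1 \<Longrightarrow> P x) \<Longrightarrow> AE x in cell. P x"
  unfolding cell_def by (subst AE_density) (auto simp: indicator_def)

lemma AE_slab_I: "(\<And>t. 0 \<le> t \<Longrightarrow> t \<le> T \<Longrightarrow> P t) \<Longrightarrow> AE t in slab T. P t"
  unfolding slab_def by (subst AE_density) (auto simp: indicator_def)

lemma integral_density_indicator:
  fixes f :: "'a::euclidean_space \<Rightarrow> 'b::{banach, second_countable_topology}"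
  assumes [measurable]: "S \<in> sets borel" "f \<in> borel_measurable borel"
  shows "integral\<^sup>L (density lborel (indicator S)) f = (LINT x:S|lborel. f x)"
    and "integrable (density lborel (indicator S)) f \<longleftrightarrow> set_integrable lborel S f"
proof -
  have eq: "density lborel (indicator S) = density lborel (\<lambda>x. ennreal (indicator S x))"
    by (simp add: ennreal_indicator)
  show "integral\<^sup>L (density lborel (indicator S)) f = (LINT x:S|lborel. f x)"
    unfolding eq set_lebesgue_integral_def by (rule integral_density) auto
  show "integrable (density lborel (indicator S)) f \<longleftrightarrow> set_integrable lborel S f"
    unfolding eq set_integrable_def by (rule integrable_density) auto
qed

section \<open>Dual balls\<close>

text \<open>The ball of radius \<open>A\<close> in \<open>L\<^sup>q\<close> of the period cell, where \<open>q\<close> is conjugate to \<open>r\<close>, described by its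
action on \<open>L\<^sup>r\<close>. This form treats \<open>q = \<infinity>\<close> (for \<open>r = 1\<close>) together with finite \<open>q\<close>, and convexity, the Fatou
property and Hoelder's inequality are immediate from it. The number \<open>c\<close> stands for the norm of \<open>h\<close>.\<close>

definition dual_ball :: "real \<Rightarrow> real \<Rightarrow> (real ^ 'd \<Rightarrow> real) set" where
  "dual_ball r A = {f \<in> borel_measurable borel. \<forall>h \<in> borel_measurable borel. \<forall>c\<ge>0. (\<forall>x. 0 \<le> h x) \<longrightarrow>
     (\<integral>\<^sup>+x. ennreal (h x powr r) \<partial>cell) \<le> ennreal (c powr r) \<longrightarrow>
     (\<integral>\<^sup>+x. ennreal (\<bar>f x\<bar> * h x) \<partial>cell) \<le> ennreal (A * c)}"

lemma dual_ballD:
  assumes "f \<in> dual_ball r A" "h \<in> borel_measurable borel" "c \<ge> 0" "\<And>x. 0 \<le> h x"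
    "(\<integral>\<^sup>+x. ennreal (h x powr r) \<partial>cell) \<le> ennreal (c powr r)"
  shows "(\<integral>\<^sup>+x. ennreal (\<bar>f x\<bar> * h x) \<partial>cell) \<le> ennreal (A * c)"
  using assms by (auto simp: dual_ball_def)

lemma dual_ball_measurable: "f \<in> dual_ball r A \<Longrightarrow> f \<in> borel_measurable borel"
  by (auto simp: dual_ball_def)

lemma dual_ball_L1:
  assumes "f \<in> dual_ball r A"
  shows "(\<integral>\<^sup>+x. ennreal \<bar>f x\<bar> \<partial>cell) \<le> ennreal A"
  using dual_ballD[OF assms, of "\<lambda>_. 1" 1] by (simp add: emeasure_cell)

lemma dual_ball_convex:
  assumes "f \<in> dual_ball r A" "g \<in> dual_ball r A" "0 \<le> s" "s \<le> 1"
  shows "(\<lambda>x. (1 - s) * f x + s * g x) \<in> dual_ball r A"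
proof -
  have [measurable]: "f \<in> borel_measurable borel" "g \<in> borel_measurable borel"
    using assms dual_ball_measurable by auto
  show ?thesis unfolding dual_ball_def
  proof (safe, goal_cases)
    case 1
    show ?case by measurable
  next
    case (2 h c)
    note [measurable] = \<open>h \<in> borel_measurable borel\<close>
    have "(\<integral>\<^sup>+x. ennreal (\<bar>(1 - s) * f x + s * g x\<bar> * h x) \<partial>cell)
        \<le> (\<integral>\<^sup>+x. ennreal (1 - s) * ennreal (\<bar>f x\<bar> * h x) + ennreal s * ennreal (\<bar>g x\<bar> * h x) \<partial>cell)"
    proof (rule nn_integral_mono)
      fix x
      have "\<bar>(1 - s) * f x + s * g x\<bar> \<le> (1 - s) * \<bar>f x\<bar> + s * \<bar>g x\<bar>"
        using assms by (intro order_trans[OF abs_triangle_ineq]) (simp add: abs_mult)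
      then have "\<bar>(1 - s) * f x + s * g x\<bar> * h x \<le> ((1 - s) * \<bar>f x\<bar> + s * \<bar>g x\<bar>) * h x"
        using 2 by (intro mult_right_mono) auto
      then have "ennreal (\<bar>(1 - s) * f x + s * g x\<bar> * h x) \<le> ennreal ((1 - s) * (\<bar>f x\<bar> * h x) + s * (\<bar>g x\<bar> * h x))"
        by (intro ennreal_leI) (simp add: algebra_simps)
      also have "\<dots> = ennreal (1 - s) * ennreal (\<bar>f x\<bar> * h x) + ennreal s * ennreal (\<bar>g x\<bar> * h x)"
        using assms 2 by (simp add: ennreal_plus ennreal_mult)
      finally show "ennreal (\<bar>(1 - s) * f x + s * g x\<bar> * h x)
        \<le> ennreal (1 - s) * ennreal (\<bar>f x\<bar> * h x) + ennreal s * ennreal (\<bar>g x\<bar> * h x)" .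
    qed
    also have "\<dots> = ennreal (1 - s) * (\<integral>\<^sup>+x. ennreal (\<bar>f x\<bar> * h x) \<partial>cell)
        + ennreal s * (\<integral>\<^sup>+x. ennreal (\<bar>g x\<bar> * h x) \<partial>cell)"
      by (simp add: nn_integral_add nn_integral_cmult)
    also have "\<dots> \<le> ennreal (1 - s) * ennreal (A * c) + ennreal s * ennreal (A * c)"
      using 2 assms by (intro add_mono mult_left_mono dual_ballD[where r=r]) auto
    also have "\<dots> = (ennreal (1 - s) + ennreal s) * ennreal (A * c)" by (simp add: distrib_right)
    also have "ennreal (1 - s) + ennreal s = 1" using assms by (simp flip: ennreal_plus)
    finally show ?case by simp
  qed
qed

text \<open>Fatou's lemma. The limit may be redefined as \<open>0\<close> at the points of divergence.\<close>

lemma dual_ball_limit: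
  assumes "\<And>n. f n \<in> dual_ball r A" and g[measurable]: "g \<in> borel_measurable borel"
    and lim: "\<And>x. g x = 0 \<or> (\<lambda>n. f n x) \<longlonglongrightarrow> g x"
  shows "g \<in> dual_ball r A"
proof -
  have [measurable]: "f n \<in> borel_measurable borel" for n
    using assms(1) by (rule dual_ball_measurable)
  show ?thesis unfolding dual_ball_def
  proof (safe, goal_cases)
    case 1
    show ?case by measurable
  next
    case (2 h c)
    note [measurable] = \<open>h \<in> borel_measurable borel\<close>
    have "(\<integral>\<^sup>+x. ennreal (\<bar>g x\<bar> * h x) \<partial>cell) \<le> (\<integral>\<^sup>+x. liminf (\<lambda>n. ennreal (\<bar>f n x\<bar> * h x)) \<partial>cell)"
    proof (rule nn_integral_mono)
      fix x
      show "ennreal (\<bar>g x\<bar> * h x) \<le> liminf (\<lambda>n. ennreal (\<bar>f n x\<bar> * h x))"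
      proof (cases "g x = 0")
        case False
        then have "(\<lambda>n. ennreal (\<bar>f n x\<bar> * h x)) \<longlonglongrightarrow> ennreal (\<bar>g x\<bar> * h x)"
          using lim[of x] by (intro tendsto_ennrealI tendsto_mult tendsto_rabs tendsto_const) auto
        from lim_imp_Liminf[OF _ this] show ?thesis by simp
      qed simp
    qed
    also have "\<dots> \<le> liminf (\<lambda>n. \<integral>\<^sup>+x. ennreal (\<bar>f n x\<bar> * h x) \<partial>cell)"
      by (rule nn_integral_liminf) measurable
    also have "\<dots> \<le> liminf (\<lambda>n. ennreal (A * c))"
      using 2 assms by (intro Liminf_mono always_eventually allI dual_ballD[where r=r]) auto
    also have "\<dots> = ennreal (A * c)" by (simp add: Liminf_const)
    finally show ?case .
  qed
qed

lemma ennreal_finiteD: "x < (\<infinity> :: ennreal) \<Longrightarrow> \<exists>c\<ge>0. x = ennreal c"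
  by (cases x rule: ennreal_cases) auto

lemma tendsto_ennreal_0I:
  fixes X :: "nat \<Rightarrow> ennreal"
  assumes "\<And>e. e > 0 \<Longrightarrow> eventually (\<lambda>n. X n \<le> ennreal e) sequentially"
  shows "X \<longlonglongrightarrow> 0"
proof (rule order_tendstoI)
  fix a :: ennreal assume "a > 0"
  then obtain e where e: "e > 0" "ennreal e < a"
    by (metis dense ennreal_cases ennreal_less_zero_iff less_top_ennreal top.not_eq_extremum order_less_le_trans top_greatest)
  from assms[OF e(1)] show "eventually (\<lambda>n. X n < a) sequentially"
    by eventually_elim (use e in auto)
qed auto

text \<open>Split according to whether \<open>\<bar>f n - g\<bar>\<close> exceeds a small \<open>\<eta>\<close>. Where it does not, the integral is at most
\<open>\<eta> * \<integral> h\<close>. Where it does, the bound on the ball reduces matters to the \<open>L\<^sup>r\<close> norm of \<open>h\<close> over a shrinking set,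
which tends to \<open>0\<close> by dominated convergence since \<open>r\<close> is finite.\<close>

lemma dual_ball_vitali:
  fixes f :: "nat \<Rightarrow> real ^ 'd \<Rightarrow> real"
  assumes f: "\<And>n. f n \<in> dual_ball r A" and g: "g \<in> dual_ball r A" and "r \<ge> 1" "A \<ge> 0"
    and lim: "AE x in cell. (\<lambda>n. f n x) \<longlonglongrightarrow> g x"
    and h[measurable]: "h \<in> borel_measurable borel" and h0: "\<And>x. 0 \<le> h x"
    and fin: "(\<integral>\<^sup>+x. ennreal (h x powr r) \<partial>cell) < \<infinity>"
  shows "(\<lambda>n. \<integral>\<^sup>+x. ennreal (\<bar>f n x - g x\<bar> * h x) \<partial>cell) \<longlonglongrightarrow> 0"
proof (rule tendsto_ennreal_0I)
  fix e :: real assume "e > 0"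
  have [measurable]: "f n \<in> borel_measurable borel" "g \<in> borel_measurable borel" for n
    using f g dual_ball_measurable by auto
  have "(\<integral>\<^sup>+x. ennreal (h x) \<partial>cell) \<le> (\<integral>\<^sup>+x. ennreal 1 + ennreal (h x powr r) \<partial>(cell :: (real ^ 'd) measure))"
  proof (rule nn_integral_mono)
    fix x
    have "h x \<le> 1 + h x powr r"
    proof (cases "h x \<le> 1")
      case False
      then have "h x powr 1 \<le> h x powr r" using \<open>r \<ge> 1\<close> by (intro powr_mono) auto
      then show ?thesis using False by simp
    qed (simp add: add_increasing2)
    then have "ennreal (h x) \<le> ennreal (1 + h x powr r)" by (rule ennreal_leI)
    also have "\<dots> = ennreal 1 + ennreal (h x powr r)" by (rule ennreal_plus) auto
    finally show "ennreal (h x) \<le> ennreal 1 + ennreal (h x powr r)" .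
  qed
  also have "\<dots> = 1 + (\<integral>\<^sup>+x. ennreal (h x powr r) \<partial>cell)"
    by (subst nn_integral_add) (auto simp: emeasure_cell)
  also have "\<dots> < \<infinity>" using fin by simp
  finally have "(\<integral>\<^sup>+x. ennreal (h x) \<partial>cell) < \<infinity>" .
  then obtain B where B: "B \<ge> 0" "(\<integral>\<^sup>+x. ennreal (h x) \<partial>cell) = ennreal B"
    by (blast dest: ennreal_finiteD)
  \<comment> \<open>half of \<open>e\<close> is spent on the set where the functions are already \<open>\<eta>\<close>-close\<close>
  define \<eta> where "\<eta> = e / (2 * (B + 1))"
  have \<eta>: "\<eta> > 0" using \<open>e > 0\<close> B by (simp add: \<eta>_def)
  define h' where "h' n x = h x * indicator {x. \<bar>f n x - g x\<bar> > \<eta>} x" for n x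
  have h'm[measurable]: "h' n \<in> borel_measurable borel" for n unfolding h'_def by measurable
  have h'0: "0 \<le> h' n x" for n x using h0 by (simp add: h'_def)
  define a where "a n = (\<integral>\<^sup>+x. ennreal (h' n x powr r) \<partial>(cell :: (real ^ 'd) measure))" for n
  have "(\<lambda>n. \<integral>\<^sup>+x. ennreal (h' n x powr r) \<partial>(cell :: (real ^ 'd) measure)) \<longlonglongrightarrow> (\<integral>\<^sup>+x. 0 \<partial>(cell :: (real ^ 'd) measure))"
  proof (rule nn_integral_dominated_convergence[where w="\<lambda>x. ennreal (h x powr r)"])
    show "AE x in cell. (\<lambda>n. ennreal (h' n x powr r)) \<longlonglongrightarrow> 0"
      using lim
    proof eventually_elim
      case (elim x)
      have "eventually (\<lambda>n. dist (f n x) (g x) < \<eta>) sequentially" using tendstoD[OF elim \<eta>] .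
      then have "eventually (\<lambda>n. ennreal (h' n x powr r) = 0) sequentially"
        by eventually_elim (simp add: h'_def dist_real_def)
      then show ?case by (rule tendsto_eventually)
    qed
  qed (use fin h0 \<open>r \<ge> 1\<close> in \<open>auto intro!: ennreal_leI simp: h'_def indicator_def\<close>)
  then have a0: "a \<longlonglongrightarrow> 0" by (simp add: a_def[abs_def])
  have a_fin: "a n < \<infinity>" for n
  proof -
    have "a n \<le> (\<integral>\<^sup>+x. ennreal (h x powr r) \<partial>cell)"
      unfolding a_def by (intro nn_integral_mono) (auto simp: h'_def indicator_def)
    with fin show ?thesis by (rule le_less_trans[rotated])
  qed
  define c where "c n = enn2real (a n) powr (1 / r)" for n
  have c0: "c \<longlonglongrightarrow> 0"
  proof -
    have "(\<lambda>n. enn2real (a n)) \<longlonglongrightarrow> enn2real 0"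
      using a0 by (intro tendsto_enn2real) auto
    then have "(\<lambda>n. enn2real (a n) powr (1 / r)) \<longlonglongrightarrow> 0 powr (1 / r)"
      using \<open>r \<ge> 1\<close> by (intro tendsto_powr') auto
    then show ?thesis by (simp add: c_def[abs_def])
  qed
  have ac: "a n \<le> ennreal (c n powr r)" for n
    using a_fin[of n] \<open>r \<ge> 1\<close> by (simp add: c_def powr_powr ennreal_enn2real_if)
  have key: "(\<integral>\<^sup>+x. ennreal (\<bar>f n x - g x\<bar> * h x) \<partial>cell) \<le> ennreal (e / 2 + 2 * A * c n)" for n
  proof -
    have c_nn: "c n \<ge> 0" by (simp add: c_def)
    have "(\<integral>\<^sup>+x. ennreal (\<bar>f n x - g x\<bar> * h x) \<partial>cell)
      \<le> (\<integral>\<^sup>+x. ennreal \<eta> * ennreal (h x) + ennreal (\<bar>f n x\<bar> * h' n x) + ennreal (\<bar>g x\<bar> * h' n x) \<partial>cell)"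
    proof (rule nn_integral_mono)
      fix x
      have "\<bar>f n x - g x\<bar> * h x \<le> \<eta> * h x + \<bar>f n x\<bar> * h' n x + \<bar>g x\<bar> * h' n x"
      proof (cases "\<bar>f n x - g x\<bar> > \<eta>")
        case True
        have "\<bar>f n x - g x\<bar> * h x \<le> (\<bar>f n x\<bar> + \<bar>g x\<bar>) * h x" by (intro mult_right_mono h0) auto
        then show ?thesis using True \<eta> h0[of x] by (simp add: h'_def algebra_simps add_increasing)
      next
        case False
        then have "\<bar>f n x - g x\<bar> * h x \<le> \<eta> * h x" by (intro mult_right_mono h0) auto
        then show ?thesis using False by (simp add: h'_def)
      qed
      then show "ennreal (\<bar>f n x - g x\<bar> * h x)
          \<le> ennreal \<eta> * ennreal (h x) + ennreal (\<bar>f n x\<bar> * h' n x) + ennreal (\<bar>g x\<bar> * h' n x)"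
        using \<eta> h0 h'0 by (simp flip: ennreal_plus ennreal_mult)
    qed
    also have "\<dots> = ennreal \<eta> * ennreal B + (\<integral>\<^sup>+x. ennreal (\<bar>f n x\<bar> * h' n x) \<partial>cell)
        + (\<integral>\<^sup>+x. ennreal (\<bar>g x\<bar> * h' n x) \<partial>cell)"
      by (simp add: nn_integral_add nn_integral_cmult B)
    also have "\<dots> \<le> ennreal \<eta> * ennreal B + ennreal (A * c n) + ennreal (A * c n)"
      using f g c_nn ac h'0 by (intro add_mono order_refl dual_ballD[where r=r]) (auto simp: a_def)
    also have "\<dots> = ennreal (\<eta> * B + A * c n + A * c n)"
      using \<eta> B \<open>A \<ge> 0\<close> c_nn by (simp flip: ennreal_plus ennreal_mult)
    also have "\<eta> * B \<le> e / 2"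
    proof -
      have "\<eta> * B \<le> \<eta> * (B + 1)" using \<eta> by simp
      also have "\<dots> = e / 2" using B by (simp add: \<eta>_def field_simps)
      finally show ?thesis .
    qed
    finally show ?thesis by (simp add: ennreal_leI algebra_simps)
  qed
  have "(\<lambda>n. 2 * A * c n) \<longlonglongrightarrow> 2 * A * 0" by (intro tendsto_intros c0)
  then have "eventually (\<lambda>n. 2 * A * c n < e / 2) sequentially"
    using \<open>e > 0\<close> by (intro order_tendstoD(2)) auto
  then show "eventually (\<lambda>n. (\<integral>\<^sup>+x. ennreal (\<bar>f n x - g x\<bar> * h x) \<partial>cell) \<le> ennreal e) sequentially"
  proof eventually_elim
    case (elim n)
    show ?case by (rule order_trans[OF key]) (use elim in \<open>auto intro!: ennreal_leI\<close>)
  qed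
qed

text \<open>Hoelder's inequality in the form in which membership is checked: the function is compared with
\<open>a powr (r - 1)\<close> for some \<open>a\<close> in the unit ball of \<open>L\<^sup>r\<close>, and Young's inequality is integrated.\<close>

lemma dual_ballI:
  fixes f a :: "real ^ 'd \<Rightarrow> real"
  assumes "r \<ge> 1" "A \<ge> 0" and f[measurable]: "f \<in> borel_measurable borel" and a[measurable]: "a \<in> borel_measurable borel"
    and a0: "\<And>x. 0 \<le> a x" and int: "(\<integral>\<^sup>+x. ennreal (a x powr r) \<partial>cell) \<le> 1"
    and le: "AE x in cell. \<bar>f x\<bar> \<le> A * a x powr (r - 1)"
  shows "f \<in> dual_ball r A"
  unfolding dual_ball_def
proof (safe, goal_cases)
  case 1
  show ?case by measurable
next
  case (2 h c)
  note [measurable] = 2(1)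
  show ?case
  proof (cases "c = 0")
    case True
    then have "(\<integral>\<^sup>+x. ennreal (h x powr r) \<partial>cell) = 0" using 2 assms(1) by simp
    then have "AE x in cell. h x powr r = 0"
      by (subst (asm) nn_integral_0_iff_AE) (auto simp: ennreal_eq_0_iff powr_eq_0_iff)
    then have "AE x in cell. ennreal (\<bar>f x\<bar> * h x) = 0" by eventually_elim simp
    then have "(\<integral>\<^sup>+x. ennreal (\<bar>f x\<bar> * h x) \<partial>cell) = (\<integral>\<^sup>+x. 0 \<partial>(cell :: (real ^ 'd) measure))"
      by (rule nn_integral_cong_AE)
    then show ?thesis by simp
  next
    case False
    with 2 have c: "c > 0" by simp
    have young: "\<bar>f x\<bar> * h x \<le> A * c * ((r - 1) / r * a x powr r + 1 / (r * c powr r) * h x powr r)"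
      if "\<bar>f x\<bar> \<le> A * a x powr (r - 1)" for x
    proof (cases "a x = 0 \<or> h x = 0")
      case True
      then have "\<bar>f x\<bar> * h x = 0" using that by auto
      moreover have "0 \<le> A * c * ((r - 1) / r * a x powr r + 1 / (r * c powr r) * h x powr r)"
        using assms c by (intro mult_nonneg_nonneg add_nonneg_nonneg) auto
      ultimately show ?thesis by (simp only:)
    next
      case False
      then have p: "a x > 0" "h x > 0" using a0[of x] 2(3) by (metis less_le)+
      have "(a x powr r) powr ((r - 1) / r) * ((h x / c) powr r) powr (1 / r)
          \<le> (r - 1) / r * a x powr r + 1 / r * (h x / c) powr r"
        using assms(1) p c by (intro Youngs_inequality_0) (auto simp: field_simps)
      moreover have "(a x powr r) powr ((r - 1) / r) = a x powr (r - 1)"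
        using assms(1) by (simp add: powr_powr)
      moreover have "((h x / c) powr r) powr (1 / r) = h x / c"
        using assms(1) p c by (simp add: powr_powr)
      moreover have "(h x / c) powr r = h x powr r / c powr r"
        using p c by (simp add: powr_divide)
      ultimately have y: "a x powr (r - 1) * (h x / c) \<le> (r - 1) / r * a x powr r + 1 / (r * c powr r) * h x powr r"
        by simp
      have "\<bar>f x\<bar> * h x \<le> A * a x powr (r - 1) * h x" using that p by (intro mult_right_mono) auto
      also have "\<dots> = A * c * (a x powr (r - 1) * (h x / c))" using c by simp
      also have "\<dots> \<le> A * c * ((r - 1) / r * a x powr r + 1 / (r * c powr r) * h x powr r)"
        using y assms c by (intro mult_left_mono) auto
      finally show ?thesis .
    qed
    have "(\<integral>\<^sup>+x. ennreal (\<bar>f x\<bar> * h x) \<partial>cell) \<le> (\<integral>\<^sup>+x. ennreal (A * c) * (ennreal ((r - 1) / r) * ennreal (a x powr r)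
        + ennreal (1 / (r * c powr r)) * ennreal (h x powr r)) \<partial>cell)"
    proof (rule nn_integral_mono_AE, use le in eventually_elim)
      case (elim x)
      have "ennreal (A * c) * (ennreal ((r - 1) / r) * ennreal (a x powr r)
        + ennreal (1 / (r * c powr r)) * ennreal (h x powr r))
        = ennreal (A * c * ((r - 1) / r * a x powr r + 1 / (r * c powr r) * h x powr r))"
        using assms(1,2) c by (subst ennreal_mult[symmetric] ennreal_plus[symmetric], simp, simp)+ simp
      then show ?case using young[OF elim] by (simp only:) (rule ennreal_leI)
    qed
    also have "\<dots> = ennreal (A * c) * (ennreal ((r - 1) / r) * (\<integral>\<^sup>+x. ennreal (a x powr r) \<partial>cell)
        + ennreal (1 / (r * c powr r)) * (\<integral>\<^sup>+x. ennreal (h x powr r) \<partial>cell))"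
      by (simp add: nn_integral_cmult nn_integral_add)
    also have "\<dots> \<le> ennreal (A * c) * (ennreal ((r - 1) / r) * 1 + ennreal (1 / (r * c powr r)) * ennreal (c powr r))"
      using int 2 by (intro mult_left_mono add_mono) auto
    also have "ennreal ((r - 1) / r) * 1 + ennreal (1 / (r * c powr r)) * ennreal (c powr r) = 1"
    proof -
      have "ennreal (1 / (r * c powr r)) * ennreal (c powr r) = ennreal (1 / r)"
        using assms(1) c by (simp flip: ennreal_mult)
      then have "ennreal ((r - 1) / r) * 1 + ennreal (1 / (r * c powr r)) * ennreal (c powr r) = ennreal ((r - 1) / r + 1 / r)"
        using assms(1) by simp
      also have "(r - 1) / r + 1 / r = 1" using assms(1) by (simp add: field_simps)
      finally show ?thesis by simp
    qed
    finally show ?thesis by simp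
  qed
qed

section \<open>The weak formulation\<close>

text \<open>The candidates for solutions. The bound holds at every time, not only at almost every one; all
constructions below respect this.\<close>

definition admissible :: "real \<Rightarrow> real \<Rightarrow> (real \<times> (real ^ 'd) \<Rightarrow> real) set" where
  "admissible r A = {u \<in> borel_measurable borel.
     (\<forall>t. periodic (\<lambda>x. u (t, x))) \<and> (\<forall>t. (\<lambda>x. u (t, x)) \<in> dual_ball r A)}"

text \<open>The formal adjoint of the advection-diffusion operator, up to sign.\<close>

definition backward_op :: "(real \<times> (real ^ 'd) \<Rightarrow> real ^ 'd) \<Rightarrow> (real \<times> (real ^ 'd) \<Rightarrow> real) \<Rightarrow> real \<times> (real ^ 'd) \<Rightarrow> real" where
  "backward_op b \<phi> z = dt \<phi> z + b z \<bullet> grad \<phi> z + laplacian \<phi> z"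

text \<open>The functional \<open>E \<phi> u\<close> whose vanishing for all test functions \<open>\<phi>\<close> is the weak formulation, written as an
integral over space-time.\<close>

definition defect :: "real \<Rightarrow> (real \<times> (real ^ 'd) \<Rightarrow> real ^ 'd) \<Rightarrow> (real ^ 'd \<Rightarrow> real) \<Rightarrow>
    (real \<times> (real ^ 'd) \<Rightarrow> real) \<Rightarrow> (real \<times> (real ^ 'd) \<Rightarrow> real) \<Rightarrow> real" where
  "defect T b w \<phi> u = (\<integral>z. u z * backward_op b \<phi> z \<partial>(slab T \<Otimes>\<^sub>M cell)) + (\<integral>x. w x * \<phi> (0, x) \<partial>cell)"

lemma ennreal_le_sumI: "a \<le> b + c \<Longrightarrow> 0 \<le> b \<Longrightarrow> 0 \<le> c \<Longrightarrow> ennreal a \<le> ennreal b + ennreal c"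
  by (metis ennreal_leI ennreal_plus)

lemma borel_measurable_nn_integral_cell:
  assumes [measurable]: "f \<in> borel_measurable (borel :: (real \<times> (real ^ 'd)) measure)"
  shows "(\<lambda>t. \<integral>\<^sup>+x. f (t, x) \<partial>cell) \<in> borel_measurable borel"
proof -
  interpret sigma_finite_measure "cell :: (real ^ 'd) measure" by (rule sigma_finite_cell)
  have "f \<in> borel_measurable (borel \<Otimes>\<^sub>M (borel :: (real ^ 'd) measure))" using assms by (simp add: borel_prod)
  then have "f \<in> borel_measurable (borel \<Otimes>\<^sub>M cell)" by (simp cong: measurable_cong_sets sets_pair_measure_cong)
  then show ?thesis by (rule borel_measurable_nn_integral_fst)
qed

lemma admissibleD:
  assumes "u \<in> admissible r A"
  shows "u \<in> borel_measurable borel" "periodic (\<lambda>x. u (t, x))" "(\<lambda>x. u (t, x)) \<in> dual_ball r A"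
  using assms by (auto simp: admissible_def)

lemma admissible_convex:
  assumes "u \<in> admissible r A" "v \<in> admissible r A" "0 \<le> s" "s \<le> 1"
  shows "(\<lambda>z. (1 - s) * u z + s * v z) \<in> admissible r A"
proof -
  have [measurable]: "u \<in> borel_measurable borel" "v \<in> borel_measurable borel"
    using assms admissibleD by auto
  show ?thesis
    using admissibleD(2)[OF assms(1)] admissibleD(2)[OF assms(2)]
      dual_ball_convex[OF admissibleD(3)[OF assms(1)] admissibleD(3)[OF assms(2)] assms(3,4)]
    unfolding admissible_def by (auto simp: periodic_def)
qed

text \<open>With the default value \<open>0\<close> where the sequence diverges, limits of periodic Borel functions
are again periodic Borel functions.\<close>

definition pointwise_lim :: "(nat \<Rightarrow> 'a \<Rightarrow> real) \<Rightarrow> 'a \<Rightarrow> real" where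
  "pointwise_lim u z = (if convergent (\<lambda>n. u n z) then lim (\<lambda>n. u n z) else 0)"

lemma pointwise_lim_cases: "pointwise_lim u z = 0 \<or> (\<lambda>n. u n z) \<longlonglongrightarrow> pointwise_lim u z"
  by (auto simp: pointwise_lim_def convergent_LIMSEQ_iff)

lemma pointwise_lim_tendsto: "convergent (\<lambda>n. u n z) \<Longrightarrow> (\<lambda>n. u n z) \<longlonglongrightarrow> pointwise_lim u z"
  by (auto simp: pointwise_lim_def convergent_LIMSEQ_iff)

lemma borel_measurable_pointwise_lim:
  assumes [measurable]: "\<And>n. u n \<in> borel_measurable M"
  shows "pointwise_lim u \<in> borel_measurable M"
  unfolding pointwise_lim_def[abs_def] Cauchy_convergent_iff[symmetric] by measurable

lemma admissible_pointwise_lim: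
  assumes "\<And>n. u n \<in> admissible r A"
  shows "pointwise_lim u \<in> admissible r A"
  unfolding admissible_def
proof (intro CollectI conjI allI)
  show m: "pointwise_lim u \<in> borel_measurable borel" using assms admissibleD by (intro borel_measurable_pointwise_lim) blast
  fix t
  show "periodic (\<lambda>x. pointwise_lim u (t, x))"
    using admissibleD(2)[OF assms, of _ t] by (auto simp: periodic_def pointwise_lim_def)
  show "(\<lambda>x. pointwise_lim u (t, x)) \<in> dual_ball r A"
    by (rule dual_ball_limit[where f="\<lambda>n x. u n (t, x)"])
      (use pointwise_lim_cases[of u] in \<open>auto intro: admissibleD(3) assms borel_measurable_slice m\<close>)
qed

lemma smooth_borel_measurable: "smooth f \<Longrightarrow> f \<in> borel_measurable borel"
  by (rule borel_measurable_continuous_onI) (rule smooth_continuous_on)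

lemma borel_measurable_grad:
  fixes \<phi> :: "real \<times> (real ^ 'd) \<Rightarrow> real"
  assumes "smooth \<phi>" shows "grad \<phi> \<in> borel_measurable borel"
proof -
  have "continuous_on UNIV (grad \<phi>)"
    unfolding grad_def[abs_def] using assms by (intro continuous_on_vec_lambda smooth_continuous_on smooth_dx)
  then show ?thesis by (rule borel_measurable_continuous_onI)
qed

lemma AE_in_slab_cell:
  "AE z in slab T \<Otimes>\<^sub>M (cell :: (real ^ 'd) measure). z \<in> {0..T} \<times> cbox 0 1"
proof -
  have "{z :: real \<times> (real ^ 'd). z \<in> {0..T} \<times> cbox 0 1} \<in> sets borel"
    unfolding Collect_mem_eq by (intro borel_closed closed_Times closed_atLeastAtMost closed_cbox)
  from AE_slab_cell_iff[OF this] show ?thesis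
    by (simp only:) (intro AE_slab_I AE_cell_I; simp)
qed

lemma test_function_bounded_on_cell:
  fixes \<phi> :: "real \<times> (real ^ 'd) \<Rightarrow> real"
  assumes "smooth \<phi>"
  shows "\<exists>B\<ge>0. \<forall>x\<in>cbox 0 1. \<bar>\<phi> (t, x)\<bar> \<le> B"
proof -
  have "compact ((\<lambda>x. \<phi> (t, x)) ` cbox 0 1)"
    by (intro compact_continuous_image compact_cbox continuous_on_compose2[OF smooth_continuous_on[OF assms, of UNIV]])
      (auto intro: continuous_intros)
  then obtain B where "\<forall>y\<in>(\<lambda>x. \<phi> (t, x)) ` cbox 0 1. norm y \<le> B"
    by (meson bounded_iff compact_imp_bounded)
  then show ?thesis by (intro exI[of _ "max 0 B"]) (auto simp: max_def)
qed

text \<open>On the space-time cylinder the derivatives of a smooth function are bounded, so the backward operator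
is dominated by a multiple of \<open>1 + norm b\<close>, a majorant that does not depend on the admissible function it
is integrated against.\<close>

lemma backward_op_bound:
  fixes \<phi> :: "real \<times> (real ^ 'd) \<Rightarrow> real"
  assumes "smooth \<phi>"
  obtains C where "C \<ge> 0" "AE z in slab T \<Otimes>\<^sub>M (cell :: (real ^ 'd) measure). \<bar>backward_op b \<phi> z\<bar> \<le> C * (1 + norm (b z))"
proof -
  let ?S = "{0..T} \<times> cbox 0 (1 :: real ^ 'd)"
  have S: "compact ?S" by (intro compact_Times compact_Icc compact_cbox)
  have bdd: "\<exists>B\<ge>0. \<forall>z\<in>?S. norm (f z) \<le> B" if "continuous_on UNIV f" for f :: "_ \<Rightarrow> 'x::real_normed_vector"
  proof -
    have "bounded (f ` ?S)"
      using S that by (intro compact_imp_bounded compact_continuous_image) (auto intro: continuous_on_subset)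
    then obtain B where "\<forall>y\<in>f ` ?S. norm y \<le> B" by (auto simp: bounded_iff)
    then show ?thesis by (intro exI[of _ "max 0 B"]) (auto simp: le_max_iff_disj)
  qed
  have cg: "continuous_on UNIV (grad \<phi>)"
    unfolding grad_def[abs_def] using assms by (intro continuous_on_vec_lambda smooth_continuous_on smooth_dx)
  obtain B1 where B1: "B1 \<ge> 0" "\<forall>z\<in>?S. norm (dt \<phi> z + laplacian \<phi> z) \<le> B1"
    using bdd[of "\<lambda>z. dt \<phi> z + laplacian \<phi> z", OF continuous_on_add[OF smooth_continuous_on smooth_continuous_on],
        OF smooth_dt(2) smooth_laplacian, OF assms assms] by blast
  obtain B2 where B2: "B2 \<ge> 0" "\<forall>z\<in>?S. norm (grad \<phi> z) \<le> B2" using bdd[OF cg] by blast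
  have le: "\<bar>backward_op b \<phi> z\<bar> \<le> (B1 + B2) * (1 + norm (b z))" if "z \<in> ?S" for z
  proof -
    have "\<bar>backward_op b \<phi> z\<bar> \<le> \<bar>dt \<phi> z + laplacian \<phi> z\<bar> + \<bar>b z \<bullet> grad \<phi> z\<bar>" unfolding backward_op_def by linarith
    also have "\<dots> \<le> B1 + norm (b z) * B2"
    proof (rule add_mono)
      show "\<bar>b z \<bullet> grad \<phi> z\<bar> \<le> norm (b z) * B2"
        using B2 that by (intro order_trans[OF Cauchy_Schwarz_ineq2] mult_left_mono) auto
    qed (use B1 that in auto)
    also have "\<dots> \<le> (B1 + B2) * (1 + norm (b z))" using B1 B2 by (simp add: algebra_simps)
    finally show ?thesis .
  qed
  show ?thesis
    by (rule that[of "B1 + B2"]) (use B1 B2 AE_in_slab_cell[of T] in \<open>auto intro: le elim!: eventually_mono\<close>)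
qed

lemma borel_measurable_backward_op:
  assumes "smooth \<phi>" and [measurable]: "b \<in> borel_measurable borel"
  shows "backward_op b \<phi> \<in> borel_measurable borel"
proof -
  have [measurable]: "grad \<phi> \<in> borel_measurable borel" "dt \<phi> \<in> borel_measurable borel" "laplacian \<phi> \<in> borel_measurable borel"
    using assms by (auto intro: borel_measurable_grad smooth_borel_measurable smooth_dt smooth_laplacian)
  show ?thesis unfolding backward_op_def[abs_def] by measurable
qed

text \<open>The function \<open>H\<close> is an integrable majorant of the spatial \<open>L\<^sup>r\<close> norm of the drift. Together with the
bound on admissible functions it makes \<open>u * b\<close> integrable over space-time.\<close>

locale drift =
  fixes T r :: real and b :: "real \<times> (real ^ 'd::finite) \<Rightarrow> real ^ 'd" and H :: "real \<Rightarrow> real"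
  assumes T0: "T > 0" and r1: "r \<ge> 1"
    and b_meas[measurable]: "b \<in> borel_measurable borel"
    and H_meas[measurable]: "H \<in> borel_measurable borel" and H0: "\<And>t. 0 \<le> H t"
    and H_fin: "(\<integral>\<^sup>+t. ennreal (H t) \<partial>slab T) < \<infinity>"
    and b_H: "AE t in slab T. (\<integral>\<^sup>+x. ennreal (norm (b (t, x)) powr r) \<partial>cell) \<le> ennreal (H t powr r)"
begin

abbreviation P :: "(real \<times> (real ^ 'd)) measure" where "P \<equiv> slab T \<Otimes>\<^sub>M cell"

lemma b_slice[measurable]: "(\<lambda>x. b (t, x)) \<in> borel_measurable borel"
  by (rule borel_measurable_slice) measurable

lemma admissible_weight_slice:
  assumes "u \<in> admissible r A" "A \<ge> 0"
  shows "AE t in slab T. (\<integral>\<^sup>+x. ennreal (\<bar>u (t, x)\<bar> * (1 + norm (b (t, x)))) \<partial>cell)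
     \<le> ennreal (A * (1 + H t))"
  using b_H
proof eventually_elim
  case (elim t)
  have [measurable]: "(\<lambda>x. u (t, x)) \<in> borel_measurable borel"
    using dual_ball_measurable[OF admissibleD(3)[OF assms(1)]] .
  have "(\<integral>\<^sup>+x. ennreal (\<bar>u (t, x)\<bar> * (1 + norm (b (t, x)))) \<partial>cell)
    = (\<integral>\<^sup>+x. ennreal \<bar>u (t, x)\<bar> + ennreal (\<bar>u (t, x)\<bar> * norm (b (t, x))) \<partial>cell)"
    by (intro nn_integral_cong) (simp add: algebra_simps flip: ennreal_plus)
  also have "\<dots> = (\<integral>\<^sup>+x. ennreal \<bar>u (t, x)\<bar> \<partial>cell) + (\<integral>\<^sup>+x. ennreal (\<bar>u (t, x)\<bar> * norm (b (t, x))) \<partial>cell)"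
    by (rule nn_integral_add) measurable
  also have "\<dots> \<le> ennreal A + ennreal (A * H t)"
    using elim H0 by (intro add_mono dual_ball_L1[OF admissibleD(3)[OF assms(1)]] dual_ballD[OF admissibleD(3)[OF assms(1)]]) auto
  also have "\<dots> = ennreal (A * (1 + H t))"
    using assms H0[of t] by (simp add: algebra_simps flip: ennreal_plus)
  finally show ?case .
qed

lemma nn_integral_majorant:
  assumes "A \<ge> 0"
  shows "(\<integral>\<^sup>+t. ennreal (A * (1 + H t)) \<partial>slab T) = ennreal A * (ennreal T + (\<integral>\<^sup>+t. ennreal (H t) \<partial>slab T))"
proof -
  have "(\<integral>\<^sup>+t. ennreal (A * (1 + H t)) \<partial>slab T) = (\<integral>\<^sup>+t. ennreal A * (1 + ennreal (H t)) \<partial>slab T)"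
    using assms H0 by (intro nn_integral_cong) (simp add: ennreal_mult flip: ennreal_plus ennreal_1)
  also have "\<dots> = ennreal A * (ennreal T + (\<integral>\<^sup>+t. ennreal (H t) \<partial>slab T))"
    using T0 by (simp add: nn_integral_cmult nn_integral_add emeasure_slab)
  finally show ?thesis .
qed

lemma admissible_weight:
  assumes "u \<in> admissible r A" "A \<ge> 0"
  shows "(\<integral>\<^sup>+z. ennreal (\<bar>u z\<bar> * (1 + norm (b z))) \<partial>P) \<le> ennreal A * (ennreal T + (\<integral>\<^sup>+t. ennreal (H t) \<partial>slab T))"
proof -
  have [measurable]: "u \<in> borel_measurable borel" using assms admissibleD by auto
  have "(\<integral>\<^sup>+z. ennreal (\<bar>u z\<bar> * (1 + norm (b z))) \<partial>P)
     = (\<integral>\<^sup>+t. \<integral>\<^sup>+x. ennreal (\<bar>u (t, x)\<bar> * (1 + norm (b (t, x)))) \<partial>cell \<partial>slab T)"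
    by (rule nn_integral_slab_cell) measurable
  also have "\<dots> \<le> (\<integral>\<^sup>+t. ennreal (A * (1 + H t)) \<partial>slab T)"
    by (intro nn_integral_mono_AE admissible_weight_slice assms)
  also have "\<dots> = ennreal A * (ennreal T + (\<integral>\<^sup>+t. ennreal (H t) \<partial>slab T))" by (rule nn_integral_majorant[OF assms(2)])
  finally show ?thesis .
qed

lemma admissible_weight_finite:
  assumes "u \<in> admissible r A" "A \<ge> 0"
  shows "(\<integral>\<^sup>+z. ennreal (\<bar>u z\<bar> * (1 + norm (b z))) \<partial>P) < \<infinity>"
  by (rule le_less_trans[OF admissible_weight[OF assms]]) (use H_fin in \<open>simp add: ennreal_mult_less_top\<close>)

lemma nn_integral_backward_op_le:
  assumes "u \<in> borel_measurable borel" "C \<ge> 0" "AE z in P. \<bar>backward_op b \<phi> z\<bar> \<le> C * (1 + norm (b z))"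
  shows "(\<integral>\<^sup>+z. ennreal (norm (u z * backward_op b \<phi> z)) \<partial>P) \<le> ennreal C * (\<integral>\<^sup>+z. ennreal (\<bar>u z\<bar> * (1 + norm (b z))) \<partial>P)"
proof -
  note [measurable] = assms(1)
  have "(\<integral>\<^sup>+z. ennreal (norm (u z * backward_op b \<phi> z)) \<partial>P) \<le> (\<integral>\<^sup>+z. ennreal C * ennreal (\<bar>u z\<bar> * (1 + norm (b z))) \<partial>P)"
  proof (rule nn_integral_mono_AE, use assms(3) in eventually_elim)
    case (elim z)
    have "norm (u z * backward_op b \<phi> z) \<le> \<bar>u z\<bar> * (C * (1 + norm (b z)))"
      using elim by (simp add: abs_mult mult_left_mono)
    also have "\<dots> = C * (\<bar>u z\<bar> * (1 + norm (b z)))" by simp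
    finally show ?case using assms(2) by (simp add: ennreal_leI flip: ennreal_mult)
  qed
  also have "\<dots> = ennreal C * (\<integral>\<^sup>+z. ennreal (\<bar>u z\<bar> * (1 + norm (b z))) \<partial>P)"
    by (rule nn_integral_cmult) measurable
  finally show ?thesis .
qed

lemma integrable_admissible_backward_op:
  assumes "u \<in> admissible r A" "A \<ge> 0" "smooth \<phi>"
  shows "integrable P (\<lambda>z. u z * backward_op b \<phi> z)"
proof -
  have [measurable]: "u \<in> borel_measurable borel" "backward_op b \<phi> \<in> borel_measurable borel"
    using assms admissibleD borel_measurable_backward_op[OF assms(3) b_meas] by auto
  obtain C where C: "C \<ge> 0" "AE z in P. \<bar>backward_op b \<phi> z\<bar> \<le> C * (1 + norm (b z))"
    by (rule backward_op_bound[OF assms(3)])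
  show ?thesis
  proof (rule integrableI_bounded)
    show "(\<integral>\<^sup>+z. ennreal (norm (u z * backward_op b \<phi> z)) \<partial>P) < \<infinity>"
      using nn_integral_backward_op_le[OF _ C, of u] admissible_weight_finite[OF assms(1,2)]
      by (auto intro: le_less_trans simp: ennreal_mult_less_top less_top)
  qed measurable
qed

lemma integrable_admissible: "u \<in> admissible r A \<Longrightarrow> integrable P u"
  and integral_abs_admissible_le: "u \<in> admissible r A \<Longrightarrow> A \<ge> 0 \<Longrightarrow> (\<integral>z. \<bar>u z\<bar> \<partial>P) \<le> A * T"
proof -
  assume u: "u \<in> admissible r A"
  then have [measurable]: "u \<in> borel_measurable borel" using admissibleD by auto
  have "(\<integral>\<^sup>+z. ennreal \<bar>u z\<bar> \<partial>P) = (\<integral>\<^sup>+t. \<integral>\<^sup>+x. ennreal \<bar>u (t, x)\<bar> \<partial>cell \<partial>slab T)"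
    by (rule nn_integral_slab_cell) measurable
  also have "\<dots> \<le> (\<integral>\<^sup>+t. ennreal A \<partial>slab T)"
    by (intro nn_integral_mono dual_ball_L1[OF admissibleD(3)[OF u]])
  also have "\<dots> = ennreal A * ennreal T" using T0 by (simp add: emeasure_slab)
  finally have le: "(\<integral>\<^sup>+z. ennreal \<bar>u z\<bar> \<partial>P) \<le> ennreal A * ennreal T" .
  then show i: "integrable P u"
    by (intro integrableI_bounded) (auto intro!: le_less_trans[OF le] simp: ennreal_mult_less_top)
  assume "A \<ge> 0"
  then show "(\<integral>z. \<bar>u z\<bar> \<partial>P) \<le> A * T"
    using le T0 i nn_integral_eq_integral[of P "\<lambda>z. \<bar>u z\<bar>"] by (simp flip: ennreal_mult)
qed

lemma defect_convex:
  assumes "u \<in> admissible r A" "v \<in> admissible r A" "A \<ge> 0" "smooth \<phi>"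
  shows "defect T b w \<phi> (\<lambda>z. (1 - s) * u z + s * v z) = (1 - s) * defect T b w \<phi> u + s * defect T b w \<phi> v"
proof -
  have "(\<integral>z. ((1 - s) * u z + s * v z) * backward_op b \<phi> z \<partial>P)
      = (\<integral>z. (1 - s) * (u z * backward_op b \<phi> z) + s * (v z * backward_op b \<phi> z) \<partial>P)"
    by (intro Bochner_Integration.integral_cong) (auto simp: algebra_simps)
  also have "\<dots> = (1 - s) * (\<integral>z. u z * backward_op b \<phi> z \<partial>P) + s * (\<integral>z. v z * backward_op b \<phi> z \<partial>P)"
    using integrable_admissible_backward_op[OF assms(1,3,4)] integrable_admissible_backward_op[OF assms(2,3,4)] by simp
  finally show ?thesis by (simp add: defect_def algebra_simps)
qed

lemma defect_sum:
  assumes "u \<in> admissible r A" "A \<ge> 0" "finite F" "\<And>\<phi>. \<phi> \<in> F \<Longrightarrow> smooth \<phi>" "integrable cell w"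
  shows "defect T b w (\<lambda>z. \<Sum>\<phi>\<in>F. c \<phi> * \<phi> z) u = (\<Sum>\<phi>\<in>F. c \<phi> * defect T b w \<phi> u)"
proof -
  have "backward_op b (\<lambda>z. \<Sum>\<phi>\<in>F. c \<phi> * \<phi> z) z = (\<Sum>\<phi>\<in>F. c \<phi> * backward_op b \<phi> z)" for z
  proof -
    have "dt (\<lambda>z. \<Sum>\<phi>\<in>F. c \<phi> * \<phi> z) = (\<lambda>z. \<Sum>\<phi>\<in>F. c \<phi> * dt \<phi> z)"
      by (rule derivatives_sum(1)[OF assms(3,4)])
    moreover have "grad (\<lambda>z. \<Sum>\<phi>\<in>F. c \<phi> * \<phi> z) = (\<lambda>z. \<Sum>\<phi>\<in>F. c \<phi> *\<^sub>R grad \<phi> z)"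
      by (rule derivatives_sum(3)[OF assms(3,4)])
    moreover have "laplacian (\<lambda>z. \<Sum>\<phi>\<in>F. c \<phi> * \<phi> z) = (\<lambda>z. \<Sum>\<phi>\<in>F. c \<phi> * laplacian \<phi> z)"
      by (rule derivatives_sum(4)[OF assms(3,4)])
    ultimately show ?thesis
      by (simp add: backward_op_def inner_sum_right sum.distrib distrib_left)
  qed
  then have "(\<integral>z. u z * backward_op b (\<lambda>z. \<Sum>\<phi>\<in>F. c \<phi> * \<phi> z) z \<partial>P) = (\<integral>z. (\<Sum>\<phi>\<in>F. c \<phi> * (u z * backward_op b \<phi> z)) \<partial>P)"
    by (simp add: sum_distrib_left algebra_simps)
  also have "\<dots> = (\<Sum>\<phi>\<in>F. c \<phi> * (\<integral>z. u z * backward_op b \<phi> z \<partial>P))"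
    by (subst Bochner_Integration.integral_sum) (auto intro!: integrable_admissible_backward_op[OF assms(1,2)] assms(4))
  finally have 1: "(\<integral>z. u z * backward_op b (\<lambda>z. \<Sum>\<phi>\<in>F. c \<phi> * \<phi> z) z \<partial>P) = \<dots>" .
  have int: "integrable cell (\<lambda>x. w x * \<phi> (0, x))" if "\<phi> \<in> F" for \<phi>
  proof -
    obtain B where B: "B \<ge> 0" "\<And>x. x \<in> cbox 0 1 \<Longrightarrow> \<bar>\<phi> (0, x)\<bar> \<le> B"
      using test_function_bounded_on_cell[OF assms(4)[OF \<open>\<phi> \<in> F\<close>], of 0] by blast
    have [measurable]: "\<phi> \<in> borel_measurable borel" by (rule smooth_borel_measurable[OF assms(4)[OF \<open>\<phi> \<in> F\<close>]])
    have [measurable]: "w \<in> borel_measurable borel" using assms(5) by simp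
    have [measurable]: "(\<lambda>x. \<phi> (0, x)) \<in> borel_measurable borel" by (rule borel_measurable_slice) measurable
    show ?thesis
    proof (rule Bochner_Integration.integrable_bound)
      show "integrable cell (\<lambda>x. B * w x)" using assms(5) by simp
      show "AE x in cell. norm (w x * \<phi> (0, x)) \<le> norm (B * w x)"
        using B by (intro AE_cell_I) (simp add: abs_mult mult.commute[of "\<bar>w _\<bar>"] mult_right_mono)
    qed measurable
  qed
  have "(\<integral>x. w x * (\<Sum>\<phi>\<in>F. c \<phi> * \<phi> (0, x)) \<partial>cell) = (\<integral>x. (\<Sum>\<phi>\<in>F. c \<phi> * (w x * \<phi> (0, x))) \<partial>cell)"
    by (simp add: sum_distrib_left algebra_simps)
  also have "\<dots> = (\<Sum>\<phi>\<in>F. c \<phi> * (\<integral>x. w x * \<phi> (0, x) \<partial>cell))"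
    using int by (subst Bochner_Integration.integral_sum) auto
  finally show ?thesis unfolding defect_def 1 by (simp add: sum.distrib algebra_simps)
qed

text \<open>At almost every time the slices converge by \<open>dual_ball_vitali\<close>, applied with the weights \<open>1\<close> and
\<open>norm b\<close>, and the slice integrals are dominated by a multiple of \<open>1 + H\<close>.\<close>

lemma defect_tendsto:
  assumes u: "\<And>n. u n \<in> admissible r A" and v: "v \<in> admissible r A" and "A \<ge> 0" "smooth \<phi>"
    and lim: "AE z in P. (\<lambda>n. u n z) \<longlonglongrightarrow> v z"
  shows "(\<lambda>n. defect T b w \<phi> (u n)) \<longlonglongrightarrow> defect T b w \<phi> v"
proof -
  have [measurable]: "u n \<in> borel_measurable borel" "v \<in> borel_measurable borel" "backward_op b \<phi> \<in> borel_measurable borel" for n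
    using admissibleD(1)[OF u] admissibleD(1)[OF v] borel_measurable_backward_op[OF assms(4) b_meas] by auto
  let ?k = "\<lambda>n z. ennreal (\<bar>u n z - v z\<bar> * (1 + norm (b z)))"
  have slice: "AE t in slab T. AE x in cell. (\<lambda>n. u n (t, x)) \<longlonglongrightarrow> v (t, x)"
    using lim by (subst (asm) AE_slab_cell_iff) measurable
  have "(\<lambda>n. \<integral>\<^sup>+t. \<integral>\<^sup>+x. ?k n (t, x) \<partial>cell \<partial>slab T) \<longlonglongrightarrow> (\<integral>\<^sup>+t. 0 \<partial>slab T)"
  proof (rule nn_integral_dominated_convergence[where w="\<lambda>t. ennreal (A * (1 + H t)) + ennreal (A * (1 + H t))"])
    show "(\<integral>\<^sup>+t. ennreal (A * (1 + H t)) + ennreal (A * (1 + H t)) \<partial>slab T) < \<infinity>"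
    proof -
      have "(\<integral>\<^sup>+t. ennreal (A * (1 + H t)) \<partial>slab T) < \<infinity>"
        unfolding nn_integral_majorant[OF \<open>A \<ge> 0\<close>] using H_fin by (auto simp: ennreal_mult_less_top less_top)
      then show ?thesis by (subst nn_integral_add) auto
    qed
    show "AE t in slab T. (\<integral>\<^sup>+x. ?k n (t, x) \<partial>cell) \<le> ennreal (A * (1 + H t)) + ennreal (A * (1 + H t))" for n
      using admissible_weight_slice[OF u[of n] \<open>A \<ge> 0\<close>] admissible_weight_slice[OF v \<open>A \<ge> 0\<close>]
    proof eventually_elim
      case (elim t)
      have [measurable]: "(\<lambda>x. u n (t, x)) \<in> borel_measurable borel" "(\<lambda>x. v (t, x)) \<in> borel_measurable borel"
        by (rule borel_measurable_slice, measurable)+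
      have "(\<integral>\<^sup>+x. ?k n (t, x) \<partial>cell) \<le> (\<integral>\<^sup>+x. ennreal (\<bar>u n (t, x)\<bar> * (1 + norm (b (t, x))))
          + ennreal (\<bar>v (t, x)\<bar> * (1 + norm (b (t, x)))) \<partial>cell)"
      proof (rule nn_integral_mono)
        fix x
        have "\<bar>u n (t, x) - v (t, x)\<bar> * (1 + norm (b (t, x)))
            \<le> (\<bar>u n (t, x)\<bar> + \<bar>v (t, x)\<bar>) * (1 + norm (b (t, x)))" by (intro mult_right_mono) auto
        then show "?k n (t, x) \<le> ennreal (\<bar>u n (t, x)\<bar> * (1 + norm (b (t, x)))) + ennreal (\<bar>v (t, x)\<bar> * (1 + norm (b (t, x))))"
          by (intro ennreal_le_sumI) (simp_all add: distrib_right)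
      qed
      also have "\<dots> = (\<integral>\<^sup>+x. ennreal (\<bar>u n (t, x)\<bar> * (1 + norm (b (t, x)))) \<partial>cell)
          + (\<integral>\<^sup>+x. ennreal (\<bar>v (t, x)\<bar> * (1 + norm (b (t, x)))) \<partial>cell)"
        by (rule nn_integral_add) measurable
      also have "\<dots> \<le> ennreal (A * (1 + H t)) + ennreal (A * (1 + H t))" using elim by (intro add_mono)
      finally show ?case .
    qed
    show "AE t in slab T. (\<lambda>n. \<integral>\<^sup>+x. ?k n (t, x) \<partial>cell) \<longlonglongrightarrow> 0"
      using slice b_H
    proof eventually_elim
      case (elim t)
      have m[measurable]: "(\<lambda>x. u n (t, x)) \<in> borel_measurable borel" "(\<lambda>x. v (t, x)) \<in> borel_measurable borel" for n
        by (rule borel_measurable_slice, measurable)+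
      have V: "(\<lambda>n. \<integral>\<^sup>+x. ennreal (\<bar>u n (t, x) - v (t, x)\<bar> * h x) \<partial>cell) \<longlonglongrightarrow> 0"
        if "h \<in> borel_measurable borel" "\<And>x. 0 \<le> h x" "(\<integral>\<^sup>+x. ennreal (h x powr r) \<partial>cell) < \<infinity>" for h
        by (rule dual_ball_vitali[OF admissibleD(3)[OF u] admissibleD(3)[OF v] r1 \<open>A \<ge> 0\<close> elim(1)]) (use that in auto)
      have "(\<integral>\<^sup>+x. ?k n (t, x) \<partial>cell) = (\<integral>\<^sup>+x. ennreal (\<bar>u n (t, x) - v (t, x)\<bar> * 1) \<partial>cell)
          + (\<integral>\<^sup>+x. ennreal (\<bar>u n (t, x) - v (t, x)\<bar> * norm (b (t, x))) \<partial>cell)" for n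
        by (subst nn_integral_add[symmetric]) (auto intro!: nn_integral_cong simp: algebra_simps simp flip: ennreal_plus)
      moreover have "(\<lambda>n. (\<integral>\<^sup>+x. ennreal (\<bar>u n (t, x) - v (t, x)\<bar> * 1) \<partial>cell)
          + (\<integral>\<^sup>+x. ennreal (\<bar>u n (t, x) - v (t, x)\<bar> * norm (b (t, x))) \<partial>cell)) \<longlonglongrightarrow> 0 + 0"
        using elim(2) by (intro tendsto_add V) (auto simp: emeasure_cell intro: le_less_trans)
      ultimately show ?case by simp
    qed
    have "(\<lambda>t. \<integral>\<^sup>+x. ?k n (t, x) \<partial>cell) \<in> borel_measurable borel" for n
      by (rule borel_measurable_nn_integral_cell) measurable
    then show "(\<lambda>t. \<integral>\<^sup>+x. ?k n (t, x) \<partial>cell) \<in> borel_measurable (slab T)" for n by measurable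
  qed measurable
  moreover have "(\<integral>\<^sup>+z. ?k n z \<partial>P) = (\<integral>\<^sup>+t. \<integral>\<^sup>+x. ?k n (t, x) \<partial>cell \<partial>slab T)" for n
    by (rule nn_integral_slab_cell) measurable
  ultimately have Z: "(\<lambda>n. \<integral>\<^sup>+z. ?k n z \<partial>P) \<longlonglongrightarrow> 0" by simp
  obtain C where C: "C \<ge> 0" "AE z in P. \<bar>backward_op b \<phi> z\<bar> \<le> C * (1 + norm (b z))"
    by (rule backward_op_bound[OF assms(4)])
  have le: "(\<integral>\<^sup>+z. ennreal (norm (u n z * backward_op b \<phi> z - v z * backward_op b \<phi> z)) \<partial>P) \<le> ennreal C * (\<integral>\<^sup>+z. ?k n z \<partial>P)" for n
    using nn_integral_backward_op_le[OF _ C, of "\<lambda>z. u n z - v z"] by (simp add: algebra_simps)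
  have "(\<lambda>n. ennreal C * (\<integral>\<^sup>+z. ?k n z \<partial>P)) \<longlonglongrightarrow> ennreal C * 0"
    by (rule ennreal_tendsto_cmult[OF _ Z]) simp
  then have L: "(\<lambda>n. ennreal C * (\<integral>\<^sup>+z. ?k n z \<partial>P)) \<longlonglongrightarrow> 0" by simp
  have "(\<lambda>n. \<integral>\<^sup>+z. ennreal (norm (u n z * backward_op b \<phi> z - v z * backward_op b \<phi> z)) \<partial>P) \<longlonglongrightarrow> 0"
    by (rule tendsto_sandwich[OF always_eventually always_eventually tendsto_const L]) (use le in auto)
  then have "(\<lambda>n. \<integral>z. u n z * backward_op b \<phi> z \<partial>P) \<longlonglongrightarrow> (\<integral>z. v z * backward_op b \<phi> z \<partial>P)"
    using integrable_admissible_backward_op[OF u \<open>A \<ge> 0\<close> assms(4)] integrable_admissible_backward_op[OF v \<open>A \<ge> 0\<close> assms(4)]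
    by (intro tendsto_L1_int) auto
  then show ?thesis unfolding defect_def by (intro tendsto_intros)
qed

end

section \<open>Integration of periodic functions\<close>

lemma continuous_on_cell:
  fixes f :: "real ^ 'd \<Rightarrow> real"
  assumes "continuous_on UNIV f"
  shows "integrable cell f" and "(\<integral>x. f x \<partial>cell) = integral (cbox 0 1) f"
proof -
  have m: "f \<in> borel_measurable borel" by (rule borel_measurable_continuous_onI[OF assms])
  have "continuous_on (cbox 0 1) f" using assms by (rule continuous_on_subset) simp
  then have s: "set_integrable lborel (cbox 0 1) f"
    unfolding set_integrable_def by (intro borel_integrable_compact) auto
  then show "integrable cell f" unfolding cell_def by (subst integral_density_indicator) (use m in auto)
  show "(\<integral>x. f x \<partial>cell) = integral (cbox 0 1) f"
    unfolding cell_def using set_borel_integral_eq_integral(2)[OF s]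
    by (subst integral_density_indicator) (use m in auto)
qed

text \<open>Translating the unit cube by \<open>s\<close> in direction \<open>i\<close> moves a slab of width \<open>s\<close> across the opposite face;
periodicity brings it back.\<close>

lemma integral_periodic_shift_aux:
  fixes f :: "real ^ 'd \<Rightarrow> real"
  assumes cont: "continuous_on UNIV f" and per: "periodic f" and s: "0 \<le> s" "s \<le> 1"
  shows "integral (cbox 0 1) (\<lambda>x. f (x + s *\<^sub>R axis i 1)) = integral (cbox 0 1) f"
proof -
  let ?e = "axis i 1 :: real ^ 'd"
  have ib: "f integrable_on cbox a b" for a b
    using cont by (intro integrable_continuous continuous_on_subset[OF cont]) auto
  have e: "?e \<in> Basis" by (simp add: axis_in_Basis_iff)
  have ei: "x \<bullet> ?e = x $ i" for x by (simp add: inner_axis)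
  have comp: "(s *\<^sub>R ?e) $ j = (if j = i then s else 0)" for j s by (simp add: axis_def)
  define k :: "real ^ 'd" where "k = (\<chi> j. if j = i then s else 1)"
  have box: "x \<in> cbox a b \<longleftrightarrow> \<alpha> \<le> x $ i \<and> x $ i \<le> \<beta> \<and> (\<forall>j. j \<noteq> i \<longrightarrow> 0 \<le> x $ j \<and> x $ j \<le> 1)"
    if "\<And>j. a $ j = (if j = i then \<alpha> else 0)" "\<And>j. b $ j = (if j = i then \<beta> else 1)"
    for a b x :: "real ^ 'd" and \<alpha> \<beta>
    unfolding mem_box_cart that by (rule iffI) (auto split: if_splits)
  have b01: "x \<in> cbox 0 1 \<longleftrightarrow> 0 \<le> x $ i \<and> x $ i \<le> 1 \<and> (\<forall>j. j \<noteq> i \<longrightarrow> 0 \<le> x $ j \<and> x $ j \<le> 1)"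
    and b0k: "x \<in> cbox 0 k \<longleftrightarrow> 0 \<le> x $ i \<and> x $ i \<le> s \<and> (\<forall>j. j \<noteq> i \<longrightarrow> 0 \<le> x $ j \<and> x $ j \<le> 1)"
    and b0ke: "x \<in> cbox (0 + ?e) (k + ?e) \<longleftrightarrow> 1 \<le> x $ i \<and> x $ i \<le> s + 1 \<and> (\<forall>j. j \<noteq> i \<longrightarrow> 0 \<le> x $ j \<and> x $ j \<le> 1)"
    and bs: "x \<in> cbox (s *\<^sub>R ?e) (1 + s *\<^sub>R ?e) \<longleftrightarrow> s \<le> x $ i \<and> x $ i \<le> 1 + s \<and> (\<forall>j. j \<noteq> i \<longrightarrow> 0 \<le> x $ j \<and> x $ j \<le> 1)"
    for x :: "real ^ 'd"
    by (rule box; simp add: k_def axis_def)+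
  have B1: "cbox 0 1 \<inter> {x :: real ^ 'd. x \<bullet> ?e \<le> s} = cbox 0 k"
    unfolding set_eq_iff Int_iff mem_Collect_eq ei b01 b0k using s by auto
  have A1: "cbox (s *\<^sub>R ?e) (1 + s *\<^sub>R ?e) \<inter> {x. x \<bullet> ?e \<le> 1} = cbox 0 1 \<inter> {x. x \<bullet> ?e \<ge> s}"
    unfolding set_eq_iff Int_iff mem_Collect_eq ei b01 bs using s by auto
  have A2: "cbox (s *\<^sub>R ?e) (1 + s *\<^sub>R ?e) \<inter> {x. x \<bullet> ?e \<ge> 1} = cbox (0 + ?e) (k + ?e)"
    unfolding set_eq_iff Int_iff mem_Collect_eq ei b0ke bs using s by auto
  have "integral (cbox 0 1) (\<lambda>x. f (x + s *\<^sub>R ?e)) = integral (cbox (s *\<^sub>R ?e) (1 + s *\<^sub>R ?e)) f"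
    using integral_shift_cbox_plus[of 0 1 f "s *\<^sub>R ?e"] by (simp add: o_def add.commute)
  also have "\<dots> = integral (cbox 0 1 \<inter> {x. x \<bullet> ?e \<ge> s}) f + integral (cbox (0 + ?e) (k + ?e)) f"
    using integral_split[OF ib[of "s *\<^sub>R ?e" "1 + s *\<^sub>R ?e"] e, of 1] unfolding A1 A2 .
  also have "integral (cbox (0 + ?e) (k + ?e)) f = integral (cbox 0 k) (f \<circ> (+) ?e)"
    by (rule integral_shift_cbox_plus[symmetric])
  also have "f \<circ> (+) ?e = f"
  proof
    fix x
    have "\<forall>j. ?e $ j \<in> \<int>" by (simp add: axis_def)
    then show "(f \<circ> (+) ?e) x = f x" using per by (simp add: periodic_def add.commute)
  qed
  also have "integral (cbox 0 1 \<inter> {x. x \<bullet> ?e \<ge> s}) f + integral (cbox 0 k) f = integral (cbox 0 1) f"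
    using integral_split[OF ib[of 0 1] e, of s] unfolding B1 by simp
  finally show ?thesis .
qed

lemma integral_periodic_shift:
  fixes f :: "real ^ 'd \<Rightarrow> real"
  assumes cont: "continuous_on UNIV f" and per: "periodic f" and s: "\<bar>s\<bar> \<le> 1"
  shows "integral (cbox 0 1) (\<lambda>x. f (x + s *\<^sub>R axis i 1)) = integral (cbox 0 1) f"
proof (cases "s \<ge> 0")
  case True
  then show ?thesis using integral_periodic_shift_aux[OF cont per] s by simp
next
  case False
  let ?g = "\<lambda>x. f (x + s *\<^sub>R axis i 1)"
  have "continuous_on UNIV ?g"
    by (intro continuous_on_compose2[OF cont] continuous_intros) auto
  moreover have "periodic ?g"
    using per unfolding periodic_def by (metis add.assoc add.commute)
  ultimately have "integral (cbox 0 1) (\<lambda>x. ?g (x + (- s) *\<^sub>R axis i 1)) = integral (cbox 0 1) ?g"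
    using False s by (intro integral_periodic_shift_aux) auto
  then show ?thesis by simp
qed

text \<open>The integral over a period does not change under translation; differentiate this in the translation
parameter.\<close>

lemma integral_dx_periodic:
  fixes F :: "real \<times> (real ^ 'd) \<Rightarrow> real"
  assumes sm: "smooth F" and per: "periodic (\<lambda>x. F (t, x))"
  shows "(\<integral>x. dx i F (t, x) \<partial>cell) = 0"
proof -
  let ?e = "axis i 1 :: real ^ 'd"
  have c: "continuous_on X (\<lambda>x. G (t, f x))" if "smooth G" "continuous_on X f" for G :: "real \<times> (real ^ 'd) \<Rightarrow> real" and X :: "'z::topological_space set" and f
    by (rule continuous_on_compose2[OF smooth_continuous_on[OF that(1), of UNIV]])
      (auto intro!: continuous_intros that(2))
  have "((\<lambda>s. integral (cbox 0 1) (\<lambda>x. F (t, x + s *\<^sub>R ?e))) has_field_derivative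
      integral (cbox 0 1) (\<lambda>x. dx i F (t, x + 0 *\<^sub>R ?e))) (at 0 within {-1..1})"
  proof (rule leibniz_rule_field_derivative)
    fix s x show "((\<lambda>s. F (t, x + s *\<^sub>R ?e)) has_field_derivative dx i F (t, x + s *\<^sub>R ?e)) (at s within {-1..1})"
      by (rule has_field_derivative_at_within[OF smooth_dx(1)[OF sm]])
  next
    fix s :: real show "(\<lambda>x. F (t, x + s *\<^sub>R ?e)) integrable_on cbox 0 1"
      by (intro integrable_continuous c sm continuous_intros)
  next
    show "continuous_on ({- 1..1} \<times> cbox 0 1) (\<lambda>(s, x). dx i F (t, x + s *\<^sub>R ?e))"
      unfolding split_beta by (intro c smooth_dx sm continuous_intros)
  qed auto
  moreover have "integral (cbox 0 1) (\<lambda>x. F (t, x + s *\<^sub>R ?e)) = integral (cbox 0 1) (\<lambda>x. F (t, x))" if "s \<in> {-1..1}" for s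
    using that by (intro integral_periodic_shift per c sm continuous_intros) auto
  ultimately have "((\<lambda>s. integral (cbox 0 1) (\<lambda>x. F (t, x))) has_field_derivative
      integral (cbox 0 1) (\<lambda>x. dx i F (t, x))) (at (0::real) within {-1..1})"
    by (subst (asm) has_field_derivative_cong_eventually) (auto simp: eventually_at_filter)
  moreover have "((\<lambda>s. integral (cbox 0 1) (\<lambda>x. F (t, x))) has_field_derivative 0) (at (0::real) within {-1..1})"
    by simp
  moreover have "at (0::real) within {-1..1} = at 0" by (rule at_within_interior) simp
  ultimately have "integral (cbox 0 1) (\<lambda>x. dx i F (t, x)) = 0"
    using DERIV_unique by metis
  then show ?thesis
    using continuous_on_cell(2)[OF c[OF smooth_dx(2)[OF sm, of i] continuous_on_id]] by simp
qed

lemma dx_compose: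
  assumes "smooth \<phi>" "\<And>s. (h has_real_derivative h' s) (at s)"
  shows "dx i (\<lambda>z. h (\<phi> z)) z = h' (\<phi> z) * dx i \<phi> z"
proof (cases z)
  case (Pair t x)
  have "((\<lambda>s. \<phi> (t, x + s *\<^sub>R axis i 1)) has_real_derivative dx i \<phi> (t, x)) (at 0)"
    using smooth_dx(1)[OF assms(1), of t x i 0] by simp
  moreover have "(h has_real_derivative h' (\<phi> (t, x))) (at (\<phi> (t, x + 0 *\<^sub>R axis i 1)))"
    using assms(2)[of "\<phi> (t, x)"] by simp
  ultimately show ?thesis unfolding Pair by (intro dxI DERIV_chain2)
qed

lemma grad_compose:
  assumes "smooth \<phi>" "\<And>s. (h has_real_derivative h' s) (at s)"
  shows "grad (\<lambda>z. h (\<phi> z)) z = h' (\<phi> z) *\<^sub>R grad \<phi> z"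
  by (simp add: grad_def vec_eq_iff dx_compose[OF assms])

lemma grad_time_mult:
  assumes "smooth \<beta>"
  shows "grad (\<lambda>z. bump (fst z) * \<beta> z) z = bump (fst z) *\<^sub>R grad \<beta> z"
proof -
  have "dx i (\<lambda>z. bump (fst z) * \<beta> z) (t, x) = bump t * dx i \<beta> (t, x)" for i t x
    using DERIV_cmult[OF smooth_dx(1)[OF assms, of t x i 0], of "bump t"] by (intro dxI) simp
  then show ?thesis by (cases z) (simp add: grad_def vec_eq_iff)
qed

lemma continuous_on_slice:
  fixes f :: "real \<times> (real ^ 'd) \<Rightarrow> 'b::topological_space"
  assumes "continuous_on UNIV f"
  shows "continuous_on UNIV (\<lambda>x. f (t, x))"
  by (rule continuous_on_compose2[OF assms]) (auto intro!: continuous_intros)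

text \<open>Integration by parts turns the integral into \<open>- \<integral> h' \<phi> * norm (grad \<phi>)\<^sup>2\<close>. This is the
dissipative effect of the diffusion.\<close>

lemma integral_mult_laplacian_le_0:
  fixes \<phi> :: "real \<times> (real ^ 'd) \<Rightarrow> real"
  assumes sm: "smooth \<phi>" and per: "\<And>t. periodic (\<lambda>x. \<phi> (t, x))" and h: "smooth h"
    and h': "\<And>s. (h has_real_derivative h' s) (at s)" and mono: "\<And>s. h' s \<ge> 0"
  shows "(\<integral>x. h (\<phi> (t, x)) * laplacian \<phi> (t, x) \<partial>cell) \<le> 0"
proof -
  have hs: "smooth (\<lambda>z. h (\<phi> z))" using h sm by (rule smooth_compose_real)
  have int: "integrable cell (\<lambda>x. f (t, x))" if "smooth f" for f :: "real \<times> (real ^ 'd) \<Rightarrow> real"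
    by (intro continuous_on_cell continuous_on_slice smooth_continuous_on that)
  have i1: "integrable cell (\<lambda>x. h (\<phi> (t, x)) * dx i (dx i \<phi>) (t, x))" for i
    using int[OF smooth_mult[OF hs smooth_dx(2)[OF smooth_dx(2)[OF sm]]]] by simp
  have le: "(\<integral>x. h (\<phi> (t, x)) * dx i (dx i \<phi>) (t, x) \<partial>cell) \<le> 0" for i
  proof -
    let ?F = "\<lambda>z. h (\<phi> z) * dx i \<phi> z"
    have sF: "smooth ?F" by (intro smooth_mult hs smooth_dx sm)
    have dF: "dx i ?F (t, x) = h' (\<phi> (t, x)) * (dx i \<phi> (t, x))\<^sup>2 + h (\<phi> (t, x)) * dx i (dx i \<phi>) (t, x)" for x
    proof (rule dxI)
      have "((\<lambda>s. h (\<phi> (t, x + s *\<^sub>R axis i 1))) has_real_derivative dx i (\<lambda>z. h (\<phi> z)) (t, x)) (at 0)"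
        using smooth_dx(1)[OF hs, of t x i 0] by simp
      moreover have "((\<lambda>s. dx i \<phi> (t, x + s *\<^sub>R axis i 1)) has_real_derivative dx i (dx i \<phi>) (t, x)) (at 0)"
        using smooth_dx(1)[OF smooth_dx(2)[OF sm, of i], of t x i 0] by simp
      ultimately show "((\<lambda>s. h (\<phi> (t, x + s *\<^sub>R axis i 1)) * dx i \<phi> (t, x + s *\<^sub>R axis i 1))
         has_real_derivative h' (\<phi> (t, x)) * (dx i \<phi> (t, x))\<^sup>2 + h (\<phi> (t, x)) * dx i (dx i \<phi>) (t, x)) (at 0)"
        by (rule DERIV_cong[OF DERIV_mult]) (simp add: dx_compose[OF sm h'] power2_eq_square)
    qed
    have per_F: "periodic (\<lambda>x. ?F (t, x))"
      using per[of t] periodic_derivatives(2)[OF per, where t=t and i=i] by (simp add: periodic_def)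
    have "(\<integral>x. dx i ?F (t, x) \<partial>cell) = 0" by (rule integral_dx_periodic[OF sF per_F])
    moreover have "(\<integral>x. h (\<phi> (t, x)) * dx i (dx i \<phi>) (t, x) \<partial>cell) \<le> (\<integral>x. dx i ?F (t, x) \<partial>cell)"
      by (rule integral_mono[OF i1 int[OF smooth_dx(2)[OF sF]]]) (simp add: dF mono)
    ultimately show ?thesis by simp
  qed
  have "(\<integral>x. h (\<phi> (t, x)) * laplacian \<phi> (t, x) \<partial>cell) = (\<Sum>i\<in>UNIV. \<integral>x. h (\<phi> (t, x)) * dx i (dx i \<phi>) (t, x) \<partial>cell)"
    unfolding laplacian_def sum_distrib_left by (rule Bochner_Integration.integral_sum) (rule i1)
  also have "\<dots> \<le> 0" using le by (intro sum_nonpos) auto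
  finally show ?thesis .
qed

section \<open>Slicing the divergence constraint in time\<close>

text \<open>The positive and the negative part of \<open>G\<close> are densities of finite measures that agree on all half
lines, hence are equal.\<close>

lemma AE_zero_of_tail_integrals:
  fixes G :: "real \<Rightarrow> real"
  assumes sets: "sets M = sets borel" and int: "integrable M G"
    and zero: "\<And>a. (\<integral>t. indicator {a<..} t * G t \<partial>M) = 0" and sf: "sigma_finite_measure M"
  shows "AE t in M. G t = 0"
proof -
  interpret sigma_finite_measure M by fact
  have [measurable]: "G \<in> borel_measurable M" using int by auto
  have [measurable]: "{a<..} \<in> sets M" for a by (simp add: sets)
  let ?f = "\<lambda>s t. ennreal (max 0 (s * G t))"
  have em: "emeasure (density M (?f s)) {a<..} = ennreal (\<integral>t. indicator {a<..} t * max 0 (s * G t) \<partial>M)"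
    and ii: "integrable M (\<lambda>t. indicator {a<..} t * max 0 (s * G t))" if "\<bar>s\<bar> = 1" for s a
  proof -
    show ii: "integrable M (\<lambda>t. indicator {a<..} t * max 0 (s * G t))"
      by (rule Bochner_Integration.integrable_bound[OF int])
        (use that in \<open>auto simp: indicator_def max_def abs_if split: if_splits\<close>)
    have "emeasure (density M (?f s)) {a<..} = (\<integral>\<^sup>+t. ennreal (indicator {a<..} t * max 0 (s * G t)) \<partial>M)"
      by (subst emeasure_density) (auto intro!: nn_integral_cong simp: indicator_def)
    also have "\<dots> = ennreal (\<integral>t. indicator {a<..} t * max 0 (s * G t) \<partial>M)"
      by (rule nn_integral_eq_integral[OF ii]) auto
    finally show "emeasure (density M (?f s)) {a<..} = \<dots>" .
  qed
  have "density M (?f 1) = density M (?f (-1))"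
  proof (rule measure_eqI_lessThan)
    fix a
    have "(\<integral>t. indicator {a<..} t * max 0 (1 * G t) \<partial>M) - (\<integral>t. indicator {a<..} t * max 0 (-1 * G t) \<partial>M)
       = (\<integral>t. indicator {a<..} t * max 0 (1 * G t) - indicator {a<..} t * max 0 (-1 * G t) \<partial>M)"
      by (rule Bochner_Integration.integral_diff[symmetric]; rule ii; simp)
    also have "\<dots> = (\<integral>t. indicator {a<..} t * G t \<partial>M)"
      by (rule Bochner_Integration.integral_cong) (auto simp: indicator_def max_def)
    finally show "emeasure (density M (?f 1)) {a<..} = emeasure (density M (?f (-1))) {a<..}"
      using zero[of a] em[of 1 a] em[of "-1" a] by simp
    show "emeasure (density M (?f 1)) {a<..} < \<infinity>" using em[of 1 a] by simp
  qed (simp_all add: sets)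
  then have "AE t in M. ?f 1 t = ?f (-1) t" by (subst (asm) density_unique_iff) auto
  then show ?thesis by eventually_elim (auto simp: max_def split: if_splits)
qed

lemma flat_exp_0_le_1: "flat_exp 0 s \<le> 1" "0 \<le> flat_exp 0 s"
  by (auto simp: flat_exp_def)

lemma flat_exp_0_tendsto:
  assumes "a > 0"
  shows "(\<lambda>n. flat_exp 0 (real (Suc n) * a - 1)) \<longlonglongrightarrow> 1"
proof -
  have top: "filterlim (\<lambda>n. real (Suc n) * a - 1) at_top sequentially"
    using assms by real_asymp
  have "((\<lambda>x::real. exp (- 1 / x)) \<longlongrightarrow> 1) at_top" by real_asymp
  from filterlim_compose[OF this top]
  have "(\<lambda>n. exp (- 1 / (real (Suc n) * a - 1))) \<longlonglongrightarrow> 1" .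
  moreover have "eventually (\<lambda>n. exp (- 1 / (real (Suc n) * a - 1)) = flat_exp 0 (real (Suc n) * a - 1)) sequentially"
    using eventually_compose_filterlim[OF eventually_gt_at_top[of 0] top]
    by eventually_elim (simp add: flat_exp_def)
  ultimately show ?thesis by (rule Lim_transform_eventually)
qed

lemma AE_slab_neq: "AE t in slab T. t \<noteq> a"
  unfolding slab_def by (subst AE_density) (auto intro: AE_mp[OF AE_lborel_singleton[of a]])

lemma const_admissible: "r \<ge> 1 \<Longrightarrow> (\<lambda>_. 1) \<in> admissible r 1"
  unfolding admissible_def using dual_ballI[of r 1 "\<lambda>_. 1" "\<lambda>_. 1"]
  by (auto simp: periodic_def emeasure_cell)

context drift begin

lemma integrable_b_grad:
  assumes "smooth \<psi>"
  shows "integrable P (\<lambda>z. b z \<bullet> grad \<psi> z)"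
proof -
  have [measurable]: "backward_op (\<lambda>_. 0) \<psi> \<in> borel_measurable borel" by (rule borel_measurable_backward_op[OF assms]) simp
  obtain C where "AE z in P. \<bar>backward_op (\<lambda>_. 0) \<psi> z\<bar> \<le> C * (1 + norm ((\<lambda>_. 0 :: real ^ 'd) z))"
    using backward_op_bound[OF assms, where T=T and b="\<lambda>_. 0"] by blast
  then have "integrable P (backward_op (\<lambda>_. 0) \<psi>)"
    by (intro finite_measure.integrable_const_bound[OF finite_measure_slab_cell, where B=C]) auto
  moreover have "integrable P (\<lambda>z. 1 * backward_op b \<psi> z)"
    by (rule integrable_admissible_backward_op[OF const_admissible[OF r1] _ assms]) simp
  ultimately have "integrable P (\<lambda>z. backward_op b \<psi> z - backward_op (\<lambda>_. 0) \<psi> z)" by simp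
  then show ?thesis by (simp add: backward_op_def)
qed

end

locale incompressible_drift = drift T r b H
  for T r and b :: "real \<times> (real ^ 'd::finite) \<Rightarrow> real ^ 'd" and H +
  assumes div_free: "\<And>\<psi>. \<psi> \<in> test_functions {0<..<T} \<Longrightarrow> (\<integral>z. b z \<bullet> grad \<psi> z \<partial>(slab T \<Otimes>\<^sub>M cell)) = 0"
begin

sublocale PS: pair_sigma_finite "slab T" "cell :: (real ^ 'd) measure"
  by (rule pair_sigma_finite_slab_cell)

text \<open>The divergence constraint is only given against functions supported away from the times \<open>0\<close> and \<open>T\<close>.
Multiplying \<open>\<beta>\<close> by cut-offs in time that increase to the indicator of a tail interval isolates the spatial
integral at almost every time. The constraint can then be used with weights in time that are neither smooth
nor compactly supported.\<close>

lemma weak_divergence_slice: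
  assumes sm: "smooth \<beta>" and per: "\<And>t. periodic (\<lambda>x. \<beta> (t, x))"
  shows "AE t in slab T. (\<integral>x. b (t, x) \<bullet> grad \<beta> (t, x) \<partial>cell) = 0"
proof (rule AE_zero_of_tail_integrals)
  let ?g = "\<lambda>z. b z \<bullet> grad \<beta> z"
  let ?G = "\<lambda>t. \<integral>x. ?g (t, x) \<partial>cell"
  have ig: "integrable P ?g" by (rule integrable_b_grad[OF sm])
  then show iG: "integrable (slab T) ?G" by (rule PS.integrable_fst')
  show "sets (slab T) = sets borel" by simp
  show "sigma_finite_measure (slab T)" by (rule sigma_finite_slab)
  fix a :: real
  define a' where "a' = max a 0"
  \<comment> \<open>smooth, with values in \<open>[0, 1]\<close>, supported in \<open>{a' + \<delta> n..T - \<delta> n}\<close> and converging to \<open>1\<close> on the interval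
    between \<open>a'\<close> and \<open>T\<close>\<close>
  define bump where "bump n t = flat_exp 0 (real (Suc n) * (t - a') - 1) * flat_exp 0 (real (Suc n) * (T - t) - 1)" for n t
  define \<delta> where "\<delta> n = 1 / real (Suc n)" for n
  have \<delta>: "\<delta> n > 0" for n by (simp add: \<delta>_def)
  have a'0: "a' \<ge> 0" "a \<le> a'" by (auto simp: a'_def)
  have sm_lin: "smooth (\<lambda>t. c * t + d)" for c d :: real
    by (intro smooth_add smooth_const smooth_bounded_linear bounded_linear_mult_right)
  have smbump: "smooth (bump n)" for n
  proof -
    have "smooth (\<lambda>t. flat_exp 0 (real (Suc n) * t + (- real (Suc n) * a' - 1)) * flat_exp 0 (- real (Suc n) * t + (real (Suc n) * T - 1)))"
      by (intro smooth_mult smooth_compose_real[OF smooth_flat_exp] sm_lin)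
    moreover have "(\<lambda>t. flat_exp 0 (real (Suc n) * t + (- real (Suc n) * a' - 1)) * flat_exp 0 (- real (Suc n) * t + (real (Suc n) * T - 1))) = bump n"
      unfolding bump_def by (auto simp: fun_eq_iff algebra_simps)
    ultimately show ?thesis by simp
  qed
  have bump_zero: "bump n t = 0" if "t \<notin> {a' + \<delta> n..T - \<delta> n}" for n t
  proof -
    have "real (Suc n) * (t - a') - 1 \<le> 0 \<or> real (Suc n) * (T - t) - 1 \<le> 0"
      using that by (auto simp: not_le \<delta>_def field_simps)
    then show ?thesis by (auto simp: bump_def flat_exp_def)
  qed
  have bump_bound: "\<bar>bump n t\<bar> \<le> 1" for n t
    unfolding bump_def abs_mult using flat_exp_0_le_1 by (intro mult_le_one) auto
  have [measurable]: "bump n \<in> borel_measurable borel" for n by (rule smooth_borel_measurable[OF smbump])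
  have zero: "(\<integral>t. bump n t * ?G t \<partial>slab T) = 0" for n
  proof -
    let ?\<psi> = "\<lambda>z. bump n (fst z) * \<beta> z"
    have "?\<psi> \<in> test_functions {0<..<T}"
      unfolding test_functions_def
    proof (intro CollectI conjI exI)
      show "smooth ?\<psi>"
        by (intro smooth_mult sm smooth_compose_real[OF smbump] smooth_bounded_linear bounded_linear_fst)
      show "\<forall>t. periodic (\<lambda>x. ?\<psi> (t, x))" using per by (simp add: periodic_def)
      show "compact {a' + \<delta> n..T - \<delta> n}" by simp
      show "{a' + \<delta> n..T - \<delta> n} \<subseteq> {0<..<T}"
      proof
        fix t assume t: "t \<in> {a' + \<delta> n..T - \<delta> n}"
        then show "t \<in> {0<..<T}" using \<delta>[of n] a'0 by auto
      qed
      show "\<forall>t x. t \<notin> {a' + \<delta> n..T - \<delta> n} \<longrightarrow> ?\<psi> (t, x) = 0" using bump_zero by simp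
    qed
    from div_free[OF this] have z: "(\<integral>z. bump n (fst z) * ?g z \<partial>P) = 0"
      by (simp add: grad_time_mult[OF sm])
    have "integrable P (\<lambda>z. bump n (fst z) * ?g z)"
    proof (rule Bochner_Integration.integrable_bound[OF ig])
      show "(\<lambda>z. bump n (fst z) * ?g z) \<in> borel_measurable P"
      proof (rule borel_measurable_times)
        have "(\<lambda>z::real \<times> (real ^ 'd). bump n (fst z)) \<in> borel_measurable borel"
          by (rule borel_measurable_continuous_onI)
            (intro continuous_on_compose2[OF smooth_continuous_on[OF smbump, of UNIV]] continuous_on_fst continuous_on_id subset_UNIV)
        then show "(\<lambda>z. bump n (fst z)) \<in> borel_measurable P" by measurable
      qed (rule borel_measurable_integrable[OF ig])
      show "AE z in P. norm (bump n (fst z) * ?g z) \<le> norm (?g z)"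
        using bump_bound by (auto simp: abs_mult intro!: mult_left_le_one_le)
    qed
    from PS.integral_fst'[OF this] show ?thesis using z by simp
  qed
  have "(\<lambda>n. \<integral>t. bump n t * ?G t \<partial>slab T) \<longlonglongrightarrow> (\<integral>t. indicator {a<..} t * ?G t \<partial>slab T)"
  proof (rule integral_dominated_convergence[where w="\<lambda>t. \<bar>?G t\<bar>"])
    have AEt: "AE t in slab T. 0 \<le> t \<and> t \<le> T" by (rule AE_slab_I) simp
    show "AE t in slab T. (\<lambda>n. bump n t * ?G t) \<longlonglongrightarrow> indicator {a<..} t * ?G t"
      using AEt AE_slab_neq[where T=T and a=T] AE_slab_neq[where T=T and a=0]
    proof (eventually_elim)
      case (elim t)
      have "(\<lambda>n. bump n t) \<longlonglongrightarrow> indicator {a<..} t"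
      proof (cases "t > a")
        case True
        then have "t - a' > 0" "T - t > 0" using elim by (auto simp: a'_def)
        from tendsto_mult[OF flat_exp_0_tendsto[OF this(1)] flat_exp_0_tendsto[OF this(2)]]
        show ?thesis using True by (simp add: bump_def)
      next
        case False
        have "bump n t = 0" for n
        proof (rule bump_zero)
          have "t \<le> a'" using False a'0 by auto
          with \<delta>[of n] show "t \<notin> {a' + \<delta> n..T - \<delta> n}" by auto
        qed
        then show ?thesis using False by simp
      qed
      then show ?case by (intro tendsto_intros)
    qed
    show "AE t in slab T. norm (bump n t * ?G t) \<le> \<bar>?G t\<bar>" for n
      using bump_bound by (auto simp: abs_mult intro!: mult_left_le_one_le)
  qed (use iG borel_measurable_integrable[OF iG] in auto)
  with zero show "(\<integral>t. indicator {a<..} t * ?G t \<partial>slab T) = 0"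
    by (simp add: LIMSEQ_const_iff)
qed

end

section \<open>The a priori estimate\<close>

lemma dt_compose:
  assumes "smooth \<phi>" "\<And>s. (h has_real_derivative h' s) (at s)"
  shows "((\<lambda>s. h (\<phi> (s, x))) has_real_derivative h' (\<phi> (t, x)) * dt \<phi> (t, x)) (at t)"
  by (rule DERIV_chain2[OF assms(2) smooth_dt(1)[OF assms(1)]])

lemma has_derivative_sq_plus_powr:
  assumes "e > (0::real)"
  shows "((\<lambda>s. (s\<^sup>2 + e) powr a) has_real_derivative (2 * a * (s * (s\<^sup>2 + e) powr (a - 1)))) (at s)"
proof -
  have "s\<^sup>2 + e > 0" using assms by (simp add: add_nonneg_pos)
  then show ?thesis by (auto intro!: derivative_eq_intros simp: powr_diff)
qed

context incompressible_drift begin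

text \<open>The a priori estimate that carries the existence proof, for a single test function. For the derivative
\<open>v\<close> of the regularised norm \<open>N\<close> at \<open>\<phi>(t)\<close> one has \<open>\<integral> v * dt \<phi> = N'\<close>, the drift term vanishes and the diffusion
term is not positive; hence the integral of \<open>v\<close> against the backward operator is at most \<open>N T - N 0\<close>, where
\<open>N T = sqrt e\<close> because \<open>\<phi>\<close> vanishes at time \<open>T\<close>.\<close>

lemma a_priori_test:
  assumes \<phi>: "\<phi> \<in> test_functions {..<T}" and w: "w \<in> dual_ball r A" and A0: "A \<ge> 0" and e0: "e > 0"
  shows "\<exists>u\<in>admissible r A. defect T b w \<phi> u \<ge> - A * sqrt e"
proof -
  have sm: "smooth \<phi>" and per: "\<And>t. periodic (\<lambda>x. \<phi> (t, x))" and \<phi>T: "\<And>x. \<phi> (T, x) = 0"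
    using \<phi> unfolding test_functions_def by fastforce+
  have pos: "s\<^sup>2 + e > 0" for s using e0 by (simp add: add_nonneg_pos)
  \<comment> \<open>\<open>r * h\<close> is the derivative of \<open>g\<close>, and \<open>h\<close> is increasing because \<open>r \<ge> 1\<close>\<close>
  define h where "h s = s * (s\<^sup>2 + e) powr (r / 2 - 1)" for s
  define h' where "h' s = (s\<^sup>2 + e) powr (r / 2 - 2) * ((r - 1) * s\<^sup>2 + e)" for s
  define g where "g s = (s\<^sup>2 + e) powr (r / 2)" for s
  have hs: "smooth h" unfolding h_def[abs_def]
    by (intro smooth_mult smooth_sq_plus_powr e0 smooth_bounded_linear bounded_linear_ident)
  have gs: "smooth g" unfolding g_def[abs_def] by (rule smooth_sq_plus_powr[OF e0])
  have dg: "(g has_real_derivative r * h s) (at s)" for s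
    using has_derivative_sq_plus_powr[OF e0, of "r / 2" s] by (simp add: g_def[abs_def] h_def)
  have dh: "(h has_real_derivative h' s) (at s)" for s
  proof -
    have d: "(h has_real_derivative (1 * (s\<^sup>2 + e) powr (r / 2 - 1)
        + 2 * (r / 2 - 1) * (s * (s\<^sup>2 + e) powr (r / 2 - 1 - 1)) * s)) (at s)"
      unfolding h_def[abs_def] by (rule DERIV_mult[OF DERIV_ident has_derivative_sq_plus_powr[OF e0]])
    have "(s\<^sup>2 + e) powr (r / 2 - 1) = (s\<^sup>2 + e) powr (r / 2 - 2) * (s\<^sup>2 + e)"
      using powr_add[of "s\<^sup>2 + e" "r / 2 - 2" 1] pos[of s] by simp
    then show ?thesis
      by (intro DERIV_cong[OF d]) (simp add: h'_def power2_eq_square algebra_simps)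
  qed
  have h'0: "h' s \<ge> 0" for s unfolding h'_def using r1 e0 by (intro mult_nonneg_nonneg add_nonneg_nonneg) auto
  let ?\<beta> = "\<lambda>z. g (\<phi> z)" and ?\<rho> = "\<lambda>z. h (\<phi> z)"
  have \<beta>s: "smooth ?\<beta>" and \<rho>s: "smooth ?\<rho>" using gs hs sm by (auto intro: smooth_compose_real)
  have int: "integrable cell (\<lambda>x. f (t, x))" if "smooth f" for f :: "real \<times> (real ^ 'd) \<Rightarrow> real" and t
    by (intro continuous_on_cell continuous_on_slice smooth_continuous_on that)
  have cell_eq: "(\<integral>x. f (t, x) \<partial>cell) = integral (cbox 0 1) (\<lambda>x. f (t, x))" if "smooth f" for f :: "real \<times> (real ^ 'd) \<Rightarrow> real" and t
    by (intro continuous_on_cell continuous_on_slice smooth_continuous_on that)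
  define S where "S t = (\<integral>x. ?\<beta> (t, x) \<partial>cell)" for t
  define D where "D t = (\<integral>x. ?\<rho> (t, x) * dt \<phi> (t, x) \<partial>cell)" for t
  have Dsm: "smooth (\<lambda>z. ?\<rho> z * dt \<phi> z)" by (intro smooth_mult \<rho>s smooth_dt sm)
  have g_ge: "e powr (r / 2) \<le> g s" for s unfolding g_def using e0 r1 by (intro powr_mono2) auto
  have S_ge: "e powr (r / 2) \<le> S t" for t
  proof -
    have "(\<integral>x. e powr (r / 2) \<partial>(cell :: (real ^ 'd) measure)) \<le> S t"
      unfolding S_def using g_ge
      by (intro integral_mono int[OF \<beta>s] finite_measure.integrable_const[OF finite_measure_cell]) auto
    then show ?thesis by (simp add: measure_def emeasure_cell)
  qed
  have S0: "S t > 0" for t using S_ge[of t] e0 by (smt (verit) powr_gt_zero)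
  have dS: "(S has_real_derivative r * D t) (at t)" for t
  proof -
    have "((\<lambda>t. integral (cbox 0 1) (\<lambda>x. ?\<beta> (t, x))) has_field_derivative
        integral (cbox 0 1) (\<lambda>x. r * ?\<rho> (t, x) * dt \<phi> (t, x))) (at t within UNIV)"
    proof (rule leibniz_rule_field_derivative)
      fix s x show "((\<lambda>s. ?\<beta> (s, x)) has_field_derivative r * ?\<rho> (s, x) * dt \<phi> (s, x)) (at s within UNIV)"
        using dt_compose[OF sm dg, of x s] by simp
      show "(\<lambda>x. ?\<beta> (s, x)) integrable_on cbox 0 1"
        by (intro integrable_continuous continuous_on_subset[OF continuous_on_slice[OF smooth_continuous_on[OF \<beta>s]]]) auto
      have "smooth (\<lambda>z. r * (?\<rho> z * dt \<phi> z))" by (intro smooth_mult[OF smooth_const] Dsm)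
      then show "continuous_on (UNIV \<times> cbox 0 1) (\<lambda>(s, x). r * ?\<rho> (s, x) * dt \<phi> (s, x))"
        using smooth_continuous_on by (simp add: split_beta mult.assoc)
    qed auto
    moreover have "(\<lambda>t. integral (cbox 0 1) (\<lambda>x. ?\<beta> (t, x))) = S" unfolding S_def using cell_eq[OF \<beta>s] by auto
    moreover have "integral (cbox 0 1) (\<lambda>x. r * ?\<rho> (t, x) * dt \<phi> (t, x)) = r * D t"
      unfolding D_def cell_eq[OF Dsm] by (simp add: mult.assoc)
    ultimately show ?thesis by simp
  qed
  have contD: "continuous_on UNIV D"
  proof -
    have "continuous_on UNIV (\<lambda>t. integral (cbox 0 1) (\<lambda>x. ?\<rho> (t, x) * dt \<phi> (t, x)))"
      by (rule integral_continuous_on_param)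
        (use smooth_continuous_on[OF Dsm] in \<open>simp add: split_beta\<close>)
    then show ?thesis unfolding D_def cell_eq[OF Dsm] .
  qed
  have contS: "continuous_on UNIV S" using dS DERIV_isCont continuous_at_imp_continuous_on by blast
  \<comment> \<open>the regularised norm of \<open>\<phi>(t)\<close> and the factor that its derivative carries\<close>
  define N where "N t = S t powr (1 / r)" for t
  define m where "m t = S t powr (1 / r - 1)" for t
  have contm: "continuous_on UNIV m" unfolding m_def[abs_def]
    by (intro continuous_on_powr contS continuous_on_const) (use S0 in \<open>auto simp: less_imp_neq[symmetric]\<close>)
  have m0: "m t \<ge> 0" for t by (simp add: m_def)
  have dN: "(N has_real_derivative m t * D t) (at t)" for t
  proof -
    have "(N has_real_derivative (1 / r * S t powr (1 / r - 1)) * (r * D t)) (at t)"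
      unfolding N_def[abs_def] by (rule DERIV_chain2[OF has_real_derivative_powr dS]) (rule S0)
    then show ?thesis by (rule DERIV_cong) (use r1 in \<open>simp add: m_def\<close>)
  qed
  define u where "u z = - A * m (fst z) * ?\<rho> z" for z
  have u_dual: "(\<lambda>x. u (t, x)) \<in> dual_ball r A" for t
  proof (rule dual_ballI[where a="\<lambda>x. (?\<beta> (t, x) / S t) powr (1 / r)"])
    show "(\<lambda>x. u (t, x)) \<in> borel_measurable borel"
      unfolding u_def fst_conv
      by (intro borel_measurable_continuous_onI continuous_on_mult continuous_on_const
          continuous_on_slice[OF smooth_continuous_on[OF \<rho>s]])
    have bm: "(\<lambda>x. ?\<beta> (t, x)) \<in> borel_measurable borel"
      by (intro borel_measurable_continuous_onI continuous_on_slice[OF smooth_continuous_on[OF \<beta>s]])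
    then show "(\<lambda>x. (?\<beta> (t, x) / S t) powr (1 / r)) \<in> borel_measurable borel" by measurable
    have \<beta>0: "?\<beta> z > 0" for z using pos by (simp add: g_def) (metis less_irrefl)
    have "(\<integral>\<^sup>+x. ennreal (((?\<beta> (t, x) / S t) powr (1 / r)) powr r) \<partial>cell) = (\<integral>\<^sup>+x. ennreal (?\<beta> (t, x) / S t) \<partial>cell)"
      using r1 \<beta>0 S0[of t] by (intro nn_integral_cong) (simp add: powr_powr less_imp_le)
    also have "\<dots> = ennreal (\<integral>x. ?\<beta> (t, x) / S t \<partial>cell)"
      by (rule nn_integral_eq_integral) (use int[OF \<beta>s] \<beta>0 S0[of t] in \<open>auto simp: less_imp_le\<close>)
    also have "(\<integral>x. ?\<beta> (t, x) / S t \<partial>cell) = 1" using S0[of t] by (simp add: S_def)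
    finally show "(\<integral>\<^sup>+x. ennreal (((?\<beta> (t, x) / S t) powr (1 / r)) powr r) \<partial>cell) \<le> 1" by simp
    show "AE x in cell. \<bar>u (t, x)\<bar> \<le> A * ((?\<beta> (t, x) / S t) powr (1 / r)) powr (r - 1)"
    proof (rule AE_I2)
      fix x
      let ?s = "\<phi> (t, x)"
      have "\<bar>h ?s\<bar> = \<bar>?s\<bar> * (?s\<^sup>2 + e) powr (r / 2 - 1)" by (simp add: h_def abs_mult)
      also have "\<bar>?s\<bar> \<le> (?s\<^sup>2 + e) powr (1 / 2)"
        using e0 by (subst powr_half_sqrt) (auto intro!: real_le_rsqrt)
      also have "(?s\<^sup>2 + e) powr (1 / 2) * (?s\<^sup>2 + e) powr (r / 2 - 1) = (?s\<^sup>2 + e) powr (r / 2 - 1 / 2)"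
        by (simp add: powr_add[symmetric])
      finally have h_le: "\<bar>h ?s\<bar> \<le> (?s\<^sup>2 + e) powr (r / 2 - 1 / 2)" by (simp add: mult_right_mono)
      have e1: "1 / r * (r - 1) = (r - 1) / r" "r / 2 * ((r - 1) / r) = r / 2 - 1 / 2" "1 / r - 1 = - ((r - 1) / r)"
        using r1 by (simp_all add: field_simps)
      have "((?\<beta> (t, x) / S t) powr (1 / r)) powr (r - 1) = (?s\<^sup>2 + e) powr (r / 2 - 1 / 2) * m t"
      proof -
        have "((?\<beta> (t, x) / S t) powr (1 / r)) powr (r - 1) = ((?s\<^sup>2 + e) powr (r / 2) / S t) powr ((r - 1) / r)"
          by (simp only: powr_powr e1(1) g_def)
        also have "\<dots> = ((?s\<^sup>2 + e) powr (r / 2)) powr ((r - 1) / r) / S t powr ((r - 1) / r)"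
          by (rule powr_divide)
        also have "\<dots> = (?s\<^sup>2 + e) powr (r / 2 - 1 / 2) * m t"
          unfolding powr_powr e1(2) m_def e1(3) powr_minus_divide by simp
        finally show ?thesis .
      qed
      moreover have "\<bar>u (t, x)\<bar> = A * (\<bar>h ?s\<bar> * m t)"
        using A0 m0[of t] by (simp add: u_def abs_mult)
      moreover have "A * (\<bar>h ?s\<bar> * m t) \<le> A * ((?s\<^sup>2 + e) powr (r / 2 - 1 / 2) * m t)"
        by (intro mult_left_mono mult_right_mono h_le A0 m0)
      ultimately show "\<bar>u (t, x)\<bar> \<le> A * ((?\<beta> (t, x) / S t) powr (1 / r)) powr (r - 1)" by simp
    qed
  qed (use r1 A0 in auto)
  have u_field: "u \<in> admissible r A"
    unfolding admissible_def
  proof (intro CollectI conjI allI)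
    show "u \<in> borel_measurable borel"
      unfolding u_def[abs_def]
      by (intro borel_measurable_continuous_onI continuous_on_mult continuous_on_const smooth_continuous_on[OF \<rho>s]
          continuous_on_compose2[OF contm continuous_on_fst[OF continuous_on_id]] subset_UNIV)
    show "periodic (\<lambda>x. u (t, x))" for t using per[of t] by (simp add: u_def periodic_def)
  qed (rule u_dual)
  have iu: "integrable P (\<lambda>z. u z * backward_op b \<phi> z)" by (rule integrable_admissible_backward_op[OF u_field A0 sm])
  have per\<beta>: "periodic (\<lambda>x. ?\<beta> (t, x))" for t using per[of t] by (simp add: periodic_def)
  \<comment> \<open>the energy identity at a fixed time: only the time derivative survives, up to a term of good sign\<close>
  have slice: "AE t in slab T. (\<integral>x. u (t, x) * backward_op b \<phi> (t, x) \<partial>cell) \<ge> - A * (m t * D t)"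
    using weak_divergence_slice[OF \<beta>s per\<beta>] PS.AE_integrable_fst'[OF integrable_b_grad[OF \<beta>s]]
  proof eventually_elim
    case (elim t)
    have gr: "grad ?\<beta> z = (r * ?\<rho> z) *\<^sub>R grad \<phi> z" for z by (rule grad_compose[OF sm dg])
    have i2: "integrable cell (\<lambda>x. ?\<rho> (t, x) * (b (t, x) \<bullet> grad \<phi> (t, x)))"
    proof -
      have "integrable cell (\<lambda>x. (1 / r) * (b (t, x) \<bullet> grad ?\<beta> (t, x)))" using elim(2) by simp
      then show ?thesis using r1 by (simp add: gr)
    qed
    have z2: "(\<integral>x. ?\<rho> (t, x) * (b (t, x) \<bullet> grad \<phi> (t, x)) \<partial>cell) = 0"
    proof -
      have "(\<integral>x. (1 / r) * (b (t, x) \<bullet> grad ?\<beta> (t, x)) \<partial>cell) = 0" using elim(1) by simp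
      then show ?thesis using r1 by (simp add: gr)
    qed
    have i1: "integrable cell (\<lambda>x. ?\<rho> (t, x) * dt \<phi> (t, x))" by (rule int[OF Dsm])
    have i3: "integrable cell (\<lambda>x. ?\<rho> (t, x) * laplacian \<phi> (t, x))"
      by (rule int[OF smooth_mult[OF \<rho>s smooth_laplacian[OF sm]]])
    have "(\<integral>x. u (t, x) * backward_op b \<phi> (t, x) \<partial>cell)
       = (\<integral>x. - A * m t * (?\<rho> (t, x) * dt \<phi> (t, x) + ?\<rho> (t, x) * (b (t, x) \<bullet> grad \<phi> (t, x))
            + ?\<rho> (t, x) * laplacian \<phi> (t, x)) \<partial>cell)"
      by (intro Bochner_Integration.integral_cong) (auto simp: u_def backward_op_def algebra_simps)
    also have "\<dots> = - A * m t * (D t + 0 + (\<integral>x. ?\<rho> (t, x) * laplacian \<phi> (t, x) \<partial>cell))"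
      unfolding D_def z2[symmetric] using i1 i2 i3 by simp
    also have "\<dots> \<ge> - A * m t * D t"
      using integral_mult_laplacian_le_0[OF sm per hs dh h'0, of t] A0 m0[of t]
      by (simp add: distrib_left mult_nonneg_nonpos)
    finally show ?case by (simp add: mult.assoc)
  qed
  have FTC: "(\<integral>t. m t * D t \<partial>slab T) = N T - N 0" and iD: "integrable (slab T) (\<lambda>t. m t * D t)"
  proof -
    have c: "continuous_on UNIV (\<lambda>t. m t * D t)" by (intro continuous_on_mult contm contD)
    then have bm: "(\<lambda>t. m t * D t) \<in> borel_measurable borel" by (rule borel_measurable_continuous_onI)
    have "(LINT t:{0..T}|lborel. m t * D t) = N T - N 0"
      unfolding set_lebesgue_integral_def
      by (rule integral_FTC_atLeastAtMost)
        (use T0 in \<open>auto intro: continuous_on_subset[OF c] has_field_derivative_at_within[OF dN]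
          simp: has_real_derivative_iff_has_vector_derivative[symmetric]\<close>)
    then show "(\<integral>t. m t * D t \<partial>slab T) = N T - N 0"
      unfolding slab_def using bm by (subst integral_density_indicator) auto
    have "set_integrable lborel {0..T} (\<lambda>t. m t * D t)"
      by (rule borel_integrable_atLeastAtMost') (rule continuous_on_subset[OF c], simp)
    then show "integrable (slab T) (\<lambda>t. m t * D t)"
      unfolding slab_def using bm by (subst integral_density_indicator) auto
  qed
  have "(\<integral>t. - A * (m t * D t) \<partial>slab T) \<le> (\<integral>t. (\<integral>x. u (t, x) * backward_op b \<phi> (t, x) \<partial>cell) \<partial>slab T)"
    by (rule integral_mono_AE[OF _ PS.integrable_fst'[OF iu] slice]) (use iD in simp)
  also have "\<dots> = (\<integral>z. u z * backward_op b \<phi> z \<partial>P)" by (rule PS.integral_fst'[OF iu])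
  finally have 1: "- A * (N T - N 0) \<le> (\<integral>z. u z * backward_op b \<phi> z \<partial>P)" using FTC iD by simp
  have NT: "N T = sqrt e"
  proof -
    have "S T = (\<integral>x. e powr (r / 2) \<partial>(cell :: (real ^ 'd) measure))" by (simp add: S_def \<phi>T g_def)
    also have "\<dots> = e powr (r / 2)" by (simp add: measure_def emeasure_cell)
    finally show ?thesis using r1 e0 by (simp add: N_def powr_powr powr_half_sqrt)
  qed
  have 2: "\<bar>\<integral>x. w x * \<phi> (0, x) \<partial>cell\<bar> \<le> A * N 0"
  proof -
    have cm: "(\<lambda>x. \<phi> (0, x)) \<in> borel_measurable borel"
      by (intro borel_measurable_continuous_onI continuous_on_slice[OF smooth_continuous_on[OF sm]])
    have "(\<integral>\<^sup>+x. ennreal (\<bar>\<phi> (0, x)\<bar> powr r) \<partial>cell) \<le> (\<integral>\<^sup>+x. ennreal (?\<beta> (0, x)) \<partial>cell)"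
    proof (intro nn_integral_mono ennreal_leI)
      fix x
      have "\<bar>\<phi> (0, x)\<bar> powr r = ((\<phi> (0, x))\<^sup>2) powr (r / 2)"
      proof (cases "\<phi> (0, x) = 0")
        case False
        then have "(\<phi> (0, x))\<^sup>2 = \<bar>\<phi> (0, x)\<bar> powr 2" by (subst powr_numeral) auto
        then show ?thesis by (simp only: powr_powr) simp
      qed simp
      also have "\<dots> \<le> ?\<beta> (0, x)" unfolding g_def using r1 e0 by (intro powr_mono2) auto
      finally show "\<bar>\<phi> (0, x)\<bar> powr r \<le> ?\<beta> (0, x)" .
    qed
    also have "\<dots> = ennreal (S 0)"
      unfolding S_def by (rule nn_integral_eq_integral) (use int[OF \<beta>s] in \<open>auto simp: g_def\<close>)
    also have "S 0 = N 0 powr r" using r1 S0[of 0] by (simp add: N_def powr_powr)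
    finally have "(\<integral>\<^sup>+x. ennreal (\<bar>w x\<bar> * \<bar>\<phi> (0, x)\<bar>) \<partial>cell) \<le> ennreal (A * N 0)"
      using cm by (intro dual_ballD[OF w]) (auto simp: N_def)
    then have "(\<integral>\<^sup>+x. ennreal (norm (w x * \<phi> (0, x))) \<partial>cell) \<le> ennreal (A * N 0)" by (simp add: abs_mult)
    moreover have "integrable cell (\<lambda>x. w x * \<phi> (0, x))"
      using calculation dual_ball_measurable[OF w] cm
      by (intro integrableI_bounded) (auto intro: le_less_trans)
    ultimately have "ennreal (norm (\<integral>x. w x * \<phi> (0, x) \<partial>cell)) \<le> ennreal (A * N 0)"
      by (intro order_trans[OF integral_norm_bound_ennreal])
    then show ?thesis using A0 by (subst (asm) ennreal_le_iff) (auto simp: N_def)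
  qed
  have "defect T b w \<phi> u \<ge> - A * sqrt e" using 1 2 unfolding defect_def NT by (simp add: algebra_simps)
  then show ?thesis using u_field by blast
qed

end

section \<open>Existence for Borel data\<close>

lemma test_functions_sum_scaled:
  fixes F :: "(real \<times> (real ^ 'd) \<Rightarrow> real) set"
  assumes "finite F" "F \<subseteq> test_functions I"
  shows "(\<lambda>z. \<Sum>\<phi>\<in>F. c \<phi> * \<phi> z) \<in> test_functions I"
  unfolding test_functions_def
proof (intro CollectI conjI)
  show "smooth (\<lambda>z. \<Sum>\<phi>\<in>F. c \<phi> * \<phi> z)"
    using assms by (intro smooth_sum_scaled) (auto simp: test_functions_def)
  show "\<forall>t. periodic (\<lambda>x. \<Sum>\<phi>\<in>F. c \<phi> * \<phi> (t, x))"
    unfolding periodic_def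
  proof (intro allI impI sum.cong refl)
    fix t and x k :: "real ^ 'd" and \<phi> assume "\<forall>i. k $ i \<in> \<int>" "\<phi> \<in> F"
    then show "c \<phi> * \<phi> (t, x + k) = c \<phi> * \<phi> (t, x)"
      using assms(2) unfolding test_functions_def periodic_def by (auto dest!: subsetD)
  qed
  have "\<forall>\<phi>\<in>F. \<exists>K. compact K \<and> K \<subseteq> I \<and> (\<forall>t x. t \<notin> K \<longrightarrow> \<phi> (t, x) = 0)"
    using assms(2) by (auto simp: test_functions_def)
  then obtain K where K: "\<And>\<phi>. \<phi> \<in> F \<Longrightarrow> compact (K \<phi>) \<and> K \<phi> \<subseteq> I \<and> (\<forall>t x. t \<notin> K \<phi> \<longrightarrow> \<phi> (t, x) = 0)"
    by metis
  show "\<exists>K. compact K \<and> K \<subseteq> I \<and> (\<forall>t x. t \<notin> K \<longrightarrow> (\<Sum>\<phi>\<in>F. c \<phi> * \<phi> (t, x)) = 0)"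
  proof (intro exI conjI allI impI)
    show "compact (\<Union>\<phi>\<in>F. K \<phi>)" using assms(1) K by (intro compact_UN) auto
    show "(\<Union>\<phi>\<in>F. K \<phi>) \<subseteq> I" using K by blast
    fix t x assume t: "t \<notin> (\<Union>\<phi>\<in>F. K \<phi>)"
    show "(\<Sum>\<phi>\<in>F. c \<phi> * \<phi> (t, x)) = 0"
    proof (rule sum.neutral, rule ballI)
      fix \<phi> assume "\<phi> \<in> F"
      then show "c \<phi> * \<phi> (t, x) = 0" using K[of \<phi>] t by simp
    qed
  qed
qed

context incompressible_drift begin

lemma defect_bounded:
  assumes "smooth \<phi>" "A \<ge> 0"
  shows "\<exists>B. \<forall>u\<in>admissible r A. \<bar>defect T b w \<phi> u\<bar> \<le> B"
proof -
  obtain C where C: "C \<ge> 0" "AE z in P. \<bar>backward_op b \<phi> z\<bar> \<le> C * (1 + norm (b z))"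
    by (rule backward_op_bound[OF assms(1)])
  let ?W = "ennreal C * (ennreal A * (ennreal T + (\<integral>\<^sup>+t. ennreal (H t) \<partial>slab T)))"
  have W: "?W < \<infinity>" using H_fin by (simp add: ennreal_mult_less_top)
  have "\<bar>defect T b w \<phi> u\<bar> \<le> enn2real ?W + \<bar>\<integral>x. w x * \<phi> (0, x) \<partial>cell\<bar>" if u: "u \<in> admissible r A" for u
  proof -
    have "ennreal (norm (\<integral>z. u z * backward_op b \<phi> z \<partial>P)) \<le> (\<integral>\<^sup>+z. ennreal (norm (u z * backward_op b \<phi> z)) \<partial>P)"
      by (rule integral_norm_bound_ennreal[OF integrable_admissible_backward_op[OF u assms(2,1)]])
    also have "\<dots> \<le> ennreal C * (\<integral>\<^sup>+z. ennreal (\<bar>u z\<bar> * (1 + norm (b z))) \<partial>P)"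
      by (rule nn_integral_backward_op_le[OF admissibleD(1)[OF u] C])
    also have "\<dots> \<le> ?W" by (intro mult_left_mono admissible_weight u assms) auto
    finally have "enn2real (ennreal (norm (\<integral>z. u z * backward_op b \<phi> z \<partial>P))) \<le> enn2real ?W"
      using W by (intro enn2real_mono) auto
    then show ?thesis unfolding defect_def by simp
  qed
  then show ?thesis by blast
qed

text \<open>The vectors of defects form a bounded convex set. A linear combination of defects is the defect of
the combined test function, to which the a priori estimate applies; so \<open>convex_set_near_zero\<close> applies.\<close>

lemma approximate_solution:
  assumes w: "w \<in> dual_ball r A" and A0: "A \<ge> 0"
    and F: "finite F" "F \<subseteq> test_functions {..<T}" and \<epsilon>: "\<epsilon> > 0"
  shows "\<exists>u\<in>admissible r A. \<forall>\<phi>\<in>F. \<bar>defect T b w \<phi> u\<bar> \<le> \<epsilon>"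
proof -
  have sm: "smooth \<phi>" if "\<phi> \<in> F" for \<phi> using that F(2) by (auto simp: test_functions_def)
  have wi: "integrable cell w"
    using dual_ball_measurable[OF w] dual_ball_L1[OF w]
    by (intro integrableI_bounded) (auto intro: le_less_trans)
  have ne: "(admissible r A :: (real \<times> (real ^ 'd) \<Rightarrow> real) set) \<noteq> {}"
    using a_priori_test[OF test_functions_sum_scaled[of "{}"] w A0, of 1] by auto
  have "\<forall>\<phi>\<in>F. \<exists>B. \<forall>u\<in>admissible r A. \<bar>defect T b w \<phi> u\<bar> \<le> B"
    using defect_bounded[OF sm A0] by blast
  from bchoice[OF this] obtain Bf where Bf: "\<And>\<phi> u. \<phi> \<in> F \<Longrightarrow> u \<in> admissible r A \<Longrightarrow> \<bar>defect T b w \<phi> u\<bar> \<le> Bf \<phi>"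
    by blast
  let ?S = "{x. \<exists>u\<in>admissible r A. \<forall>\<phi>\<in>F. x \<phi> = defect T b w \<phi> u}"
  have "\<exists>x\<in>?S. \<forall>\<phi>\<in>F. \<bar>x \<phi>\<bar> \<le> \<epsilon>"
  proof (rule convex_set_near_zero[where B="\<Sum>\<phi>\<in>F. \<bar>Bf \<phi>\<bar>"])
    obtain u0 where "u0 \<in> (admissible r A :: (real \<times> (real ^ 'd) \<Rightarrow> real) set)" using ne by auto
    then have "(\<lambda>\<phi>. defect T b w \<phi> u0) \<in> ?S"
      by (intro CollectI bexI[of _ u0] ballI refl)
    then show "?S \<noteq> {}" by (metis emptyE)
  next
    fix x y s assume xy: "x \<in> ?S"
      "y \<in> ?S" and s: "0 \<le> s" "s \<le> (1::real)"
    obtain u where u: "u \<in> admissible r A" "\<forall>\<phi>\<in>F. x \<phi> = defect T b w \<phi> u"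
      using CollectD[OF xy(1)] by (rule bexE)
    obtain v where v: "v \<in> admissible r A" "\<forall>\<phi>\<in>F. y \<phi> = defect T b w \<phi> v"
      using CollectD[OF xy(2)] by (rule bexE)
    show "(\<lambda>\<phi>. (1 - s) * x \<phi> + s * y \<phi>) \<in> ?S"
      using defect_convex[OF u(1) v(1) A0 sm, of _ w s] u(2) v(2)
      by (intro CollectI bexI[OF _ admissible_convex[OF u(1) v(1) s]]) auto
  next
    fix x \<phi> assume x: "x \<in> ?S" and \<phi>: "\<phi> \<in> F"
    obtain u where u: "u \<in> admissible r A" "\<forall>\<phi>\<in>F. x \<phi> = defect T b w \<phi> u"
      using CollectD[OF x] by (rule bexE)
    have "\<bar>x \<phi>\<bar> \<le> \<bar>Bf \<phi>\<bar>" using Bf[OF \<phi> u(1)] u(2) \<phi> by simp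
    also have "\<dots> \<le> (\<Sum>\<phi>\<in>F. \<bar>Bf \<phi>\<bar>)" using F(1) \<phi> by (intro member_le_sum) auto
    finally show "\<bar>x \<phi>\<bar> \<le> (\<Sum>\<phi>\<in>F. \<bar>Bf \<phi>\<bar>)" .
  next
    fix c and \<eta> :: real assume \<eta>: "\<eta> > 0"
    let ?\<psi> = "\<lambda>z. \<Sum>\<phi>\<in>F. (- c \<phi>) * \<phi> z"
    \<comment> \<open>the regularisation parameter whose square root, multiplied by \<open>A\<close>, stays below \<open>\<eta>\<close>\<close>
    have "(\<eta> / (A + 1))\<^sup>2 > 0" using \<eta> A0 by simp
    from a_priori_test[OF test_functions_sum_scaled[OF F, of "\<lambda>\<phi>. - c \<phi>"] w A0 this]
    obtain u where u: "u \<in> admissible r A" "defect T b w ?\<psi> u \<ge> - A * sqrt ((\<eta> / (A + 1))\<^sup>2)" by blast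
    have "A * (\<eta> / (A + 1)) \<le> \<eta>" using A0 \<eta> by (simp add: field_simps)
    then have "defect T b w ?\<psi> u \<ge> - \<eta>" using u(2) A0 \<eta> by simp
    moreover have "defect T b w ?\<psi> u = (\<Sum>\<phi>\<in>F. (- c \<phi>) * defect T b w \<phi> u)"
      by (rule defect_sum[OF u(1) A0 F(1) sm wi])
    ultimately have "(\<Sum>\<phi>\<in>F. c \<phi> * defect T b w \<phi> u) \<le> \<eta>" by (simp add: sum_negf)
    then show "\<exists>x\<in>?S. (\<Sum>\<phi>\<in>F. c \<phi> * x \<phi>) \<le> \<eta>"
      using u(1) by (intro bexI[of _ "\<lambda>\<phi>. defect T b w \<phi> u"]) auto
  qed (use F \<epsilon> in auto)
  then show ?thesis by fastforce
qed

text \<open>The sets of functions that solve finitely many equations approximately form the family to which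
\<open>convex_family_limit\<close> is applied. For each test function and each tolerance \<open>\<delta>\<close> the limit is also the limit of
functions that solve this equation up to \<open>\<delta>\<close>, so its defect is at most \<open>\<delta>\<close>.\<close>

theorem exists_admissible_solution:
  assumes w: "w \<in> dual_ball r A" and A0: "A \<ge> 0"
  shows "\<exists>u\<in>admissible r A. \<forall>\<phi>\<in>test_functions {..<T}. defect T b w \<phi> u = 0"
proof -
  define K :: "((real \<times> (real ^ 'd) \<Rightarrow> real) \<times> real) set \<Rightarrow> (real \<times> (real ^ 'd) \<Rightarrow> real) set" where "K C = {u \<in> admissible r A. \<forall>(\<phi>, \<delta>)\<in>C. \<bar>defect T b w \<phi> u\<bar> \<le> \<delta>}" for C
  define \<C> :: "((real \<times> (real ^ 'd) \<Rightarrow> real) \<times> real) set set" where "\<C> = {C. finite C \<and> C \<subseteq> test_functions {..<T} \<times> {0::real<..}}"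
  interpret FP: finite_measure P by (rule finite_measure_slab_cell)
  have ne: "K C \<noteq> {}" if C: "C \<in> \<C>" for C
  proof -
    have "\<exists>\<epsilon>>0. \<forall>c\<in>C. \<epsilon> \<le> snd c"
    proof (intro exI[of _ "Min (insert 1 (snd ` C))"] conjI ballI)
      show "0 < Min (insert 1 (snd ` C))" using C by (subst Min_gr_iff) (auto simp: \<C>_def)
      show "Min (insert 1 (snd ` C)) \<le> snd c" if "c \<in> C" for c using C that by (intro Min_le) (auto simp: \<C>_def)
    qed
    then obtain \<epsilon> where \<epsilon>: "\<epsilon> > 0" "\<And>c. c \<in> C \<Longrightarrow> \<epsilon> \<le> snd c" by blast
    have "\<exists>u\<in>admissible r A. \<forall>\<phi>\<in>fst ` C. \<bar>defect T b w \<phi> u\<bar> \<le> \<epsilon>"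
      using C by (intro approximate_solution[OF w A0 _ _ \<epsilon>(1)]) (auto simp: \<C>_def)
    then obtain u where u: "u \<in> admissible r A" "\<And>c. c \<in> C \<Longrightarrow> \<bar>defect T b w (fst c) u\<bar> \<le> \<epsilon>" by blast
    have "u \<in> K C" unfolding K_def using u \<epsilon>(2) by (fastforce intro: order_trans)
    then show ?thesis by blast
  qed
  have sm: "smooth \<phi>" if "C \<in> \<C>" "(\<phi>, \<delta>) \<in> C" for \<phi> \<delta> C using that by (auto simp: \<C>_def test_functions_def)
  obtain U where U: "\<And>n. U n \<in> \<Union>(K ` \<C>)" "AE z in P. convergent (\<lambda>n. U n z)"
    "\<And>L. L \<in> K ` \<C> \<Longrightarrow> \<exists>V. (\<forall>n. V n \<in> L) \<and> (AE z in P. (\<lambda>n. V n z - U n z) \<longlonglongrightarrow> 0)"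
  proof (rule FP.convex_family_limit[of "K ` \<C>" "A * T"])
    have "{} \<in> \<C>" by (simp add: \<C>_def)
    then show "K ` \<C> \<noteq> {}" by blast
    show "{} \<notin> K ` \<C>" using ne by auto
    fix L M assume "L \<in> K ` \<C>" "M \<in> K ` \<C>"
    then obtain C C' where C: "L = K C" "M = K C'" "C \<in> \<C>" "C' \<in> \<C>" by blast
    then have "C \<union> C' \<in> \<C>" by (auto simp: \<C>_def)
    moreover have "L \<inter> M = K (C \<union> C')" unfolding C K_def by blast
    ultimately show "L \<inter> M \<in> K ` \<C>" by blast
  next
    fix L u assume "L \<in> K ` \<C>" "u \<in> L"
    then have u: "u \<in> admissible r A" by (auto simp: K_def)
    show "integrable P u" by (rule integrable_admissible[OF u])
    show "(\<integral>z. \<bar>u z\<bar> \<partial>P) \<le> A * T" by (rule integral_abs_admissible_le[OF u A0])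
  next
    fix L u v assume "L \<in> K ` \<C>" and uv: "u \<in> L" "v \<in> L"
    then obtain C where C: "L = K C" "C \<in> \<C>" by blast
    have f: "u \<in> admissible r A" "v \<in> admissible r A" using uv C by (auto simp: K_def)
    have eq: "(\<lambda>z. (u z + v z) / 2) = (\<lambda>z. (1 - 1/2) * u z + 1/2 * v z)" by (auto simp: field_simps)
    have "(\<lambda>z. (u z + v z) / 2) \<in> admissible r A" unfolding eq by (rule admissible_convex[OF f]) auto
    moreover have "\<bar>defect T b w \<phi> (\<lambda>z. (u z + v z) / 2)\<bar> \<le> \<delta>" if "(\<phi>, \<delta>) \<in> C" for \<phi> \<delta>
    proof -
      have "\<bar>defect T b w \<phi> u\<bar> \<le> \<delta>" "\<bar>defect T b w \<phi> v\<bar> \<le> \<delta>" using uv C that by (auto simp: K_def)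
      then show ?thesis unfolding eq defect_convex[OF f A0 sm[OF C(2) that]] by (simp add: abs_le_iff)
    qed
    ultimately show "(\<lambda>z. (u z + v z) / 2) \<in> L" unfolding C(1) K_def by auto
  next
    fix U assume "\<And>n. U n \<in> \<Union>(K ` \<C>)" "AE z in P. convergent (\<lambda>n. U n z)"
      "\<And>L. L \<in> K ` \<C> \<Longrightarrow> \<exists>V. (\<forall>n. V n \<in> L) \<and> (AE z in P. (\<lambda>n. V n z - U n z) \<longlonglongrightarrow> 0)"
    then show thesis by (rule that)
  qed
  have Uf: "U n \<in> admissible r A" for n using U(1)[of n] by (auto simp: K_def)
  then have uf: "pointwise_lim U \<in> admissible r A" by (rule admissible_pointwise_lim)
  have "defect T b w \<phi> (pointwise_lim U) = 0" if \<phi>: "\<phi> \<in> test_functions {..<T}" for \<phi>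
  proof -
    have "\<bar>defect T b w \<phi> (pointwise_lim U)\<bar> \<le> \<delta>" if \<delta>: "\<delta> > 0" for \<delta>
    proof -
      have "K {(\<phi>, \<delta>)} \<in> K ` \<C>" using \<phi> \<delta> by (auto simp: \<C>_def)
      from U(3)[OF this] obtain V where V: "\<And>n. V n \<in> K {(\<phi>, \<delta>)}" "AE z in P. (\<lambda>n. V n z - U n z) \<longlonglongrightarrow> 0" by blast
      have Vf: "V n \<in> admissible r A" and Vd: "\<bar>defect T b w \<phi> (V n)\<bar> \<le> \<delta>" for n using V(1)[of n] by (auto simp: K_def)
      have "AE z in P. (\<lambda>n. V n z) \<longlonglongrightarrow> pointwise_lim U z"
        using U(2) V(2)
      proof eventually_elim
        case (elim z)
        from tendsto_add[OF elim(2) pointwise_lim_tendsto[of U z, OF elim(1)]] show ?case by simp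
      qed
      moreover have "smooth \<phi>" using \<phi> by (simp add: test_functions_def)
      ultimately have "(\<lambda>n. defect T b w \<phi> (V n)) \<longlonglongrightarrow> defect T b w \<phi> (pointwise_lim U)"
        by (intro defect_tendsto[OF Vf uf A0])
      then have "(\<lambda>n. \<bar>defect T b w \<phi> (V n)\<bar>) \<longlonglongrightarrow> \<bar>defect T b w \<phi> (pointwise_lim U)\<bar>" by (rule tendsto_rabs)
      then show ?thesis by (rule LIMSEQ_le_const2) (use Vd in auto)
    qed
    then have "\<bar>defect T b w \<phi> (pointwise_lim U)\<bar> \<le> 0" by (rule field_le_epsilon) simp
    then show ?thesis by simp
  qed
  with uf show ?thesis by blast
qed

end

section \<open>From Lebesgue measurable to Borel data\<close>

lemma AE_lebesgue_on_iff:
  assumes "S \<in> sets borel"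
  shows "(AE x in lebesgue_on S. Q x) \<longleftrightarrow> (AE x in density lborel (indicator S). Q x)"
proof -
  have "(AE x in lebesgue_on S. Q x) \<longleftrightarrow> (AE x in lborel. x \<in> S \<longrightarrow> Q x)"
    using assms by (subst AE_restrict_space_iff) (auto simp: AE_completion_iff)
  also have "\<dots> \<longleftrightarrow> (AE x in density lborel (indicator S). Q x)"
    using assms by (subst AE_density) (auto intro!: AE_cong simp: indicator_def)
  finally show ?thesis .
qed

lemma AE_torus_iff: "(AE x in torus. Q x) \<longleftrightarrow> (AE x in cell. Q x)"
  unfolding torus_def cell_def by (rule AE_lebesgue_on_iff) simp

lemma AE_time_iff: "(AE t in lebesgue_on {0..T}. Q t) \<longleftrightarrow> (AE t in slab T. Q t)"
  unfolding slab_def by (rule AE_lebesgue_on_iff) simp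

lemma measurable_lebesgue_on_of_borel:
  assumes "g \<in> borel_measurable (borel :: 'a::euclidean_space measure)"
  shows "g \<in> borel_measurable (lebesgue_on S)"
proof -
  have "g \<in> borel_measurable lebesgue" using assms by (intro measurable_completion) simp
  then show ?thesis by (rule measurable_restrict_space1)
qed

text \<open>Bochner integrals of functions that are not measurable are \<open>0\<close> by convention, so equality almost
everywhere transfers integrals only together with measurability; completeness of Lebesgue measure
supplies the latter.\<close>

lemma measurable_lebesgue_on_AE_borel:
  fixes f g :: "'a::euclidean_space \<Rightarrow> 'b::euclidean_space"
  assumes S: "S \<in> sets borel" and g: "g \<in> borel_measurable borel"
    and ae: "AE x in density lborel (indicator S). f x = g x"
  shows "f \<in> borel_measurable (lebesgue_on S)"
proof -
  have [measurable]: "g \<in> borel_measurable lebesgue" using g by (intro measurable_completion) simp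
  have [measurable]: "S \<in> sets lebesgue" using S by auto
  have m: "(\<lambda>x. indicator S x *\<^sub>R g x) \<in> borel_measurable lebesgue" by measurable
  have "AE x in lebesgue_on S. f x = g x" using ae by (simp add: AE_lebesgue_on_iff[OF S])
  then have "AE x in lebesgue. x \<in> S \<longrightarrow> f x = g x"
    using S by (subst (asm) AE_restrict_space_iff) auto
  then have "AE x in lebesgue. indicator S x *\<^sub>R g x = indicator S x *\<^sub>R f x"
    by eventually_elim (auto simp: indicator_def)
  from borel_measurable_AE[OF m this] show ?thesis
    using S by (subst borel_measurable_restrict_space_iff) auto
qed

lemma nn_integral_lebesgue_on_eq:
  assumes S[measurable]: "S \<in> sets borel" and g[measurable]: "g \<in> borel_measurable borel"
    and ae: "AE x in density lborel (indicator S). f x = g x"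
  shows "(\<integral>\<^sup>+x. f x \<partial>lebesgue_on S) = (\<integral>\<^sup>+x. g x \<partial>density lborel (indicator S))"
proof -
  have "(\<integral>\<^sup>+x. f x \<partial>lebesgue_on S) = (\<integral>\<^sup>+x. g x \<partial>lebesgue_on S)"
    using ae by (intro nn_integral_cong_AE) (simp add: AE_lebesgue_on_iff[OF S])
  also have "\<dots> = (\<integral>\<^sup>+x. g x * indicator S x \<partial>lebesgue)"
    using S by (subst nn_integral_restrict_space) auto
  also have "\<dots> = (\<integral>\<^sup>+x. g x * indicator S x \<partial>lborel)" by (rule nn_integral_completion)
  also have "\<dots> = (\<integral>\<^sup>+x. g x \<partial>density lborel (indicator S))"
    by (subst nn_integral_density) (auto simp: mult.commute)
  finally show ?thesis .
qed

lemma integral_lebesgue_on_eq: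
  fixes f g :: "'a::euclidean_space \<Rightarrow> real"
  assumes S[measurable]: "S \<in> sets borel" and g[measurable]: "g \<in> borel_measurable borel"
    and ae: "AE x in density lborel (indicator S). f x = g x"
  shows "(LINT x|lebesgue_on S. f x) = (\<integral>x. g x \<partial>density lborel (indicator S))"
proof -
  have "(LINT x|lebesgue_on S. f x) = (LINT x|lebesgue_on S. g x)"
    using ae measurable_lebesgue_on_AE_borel[OF S g ae] measurable_lebesgue_on_of_borel[OF g]
    by (intro integral_cong_AE) (auto simp: AE_lebesgue_on_iff[OF S])
  also have "\<dots> = (LINT x|lebesgue. indicator S x *\<^sub>R g x)"
    using S by (subst integral_restrict_space) auto
  also have "\<dots> = (LINT x|lborel. indicator S x *\<^sub>R g x)"
    by (rule integral_completion) measurable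
  also have "\<dots> = (\<integral>x. g x \<partial>density lborel (indicator S))"
    by (subst integral_density_indicator) (auto simp: set_lebesgue_integral_def)
  finally show ?thesis .
qed

lemma integral_torus_eq:
  fixes f g :: "real ^ 'd \<Rightarrow> real"
  assumes "g \<in> borel_measurable borel" "AE x in cell. f x = g x"
  shows "(LINT x|torus. f x) = (\<integral>x. g x \<partial>cell)"
  using assms unfolding torus_def cell_def by (intro integral_lebesgue_on_eq) auto

lemma iterated_integral_eq:
  fixes f g :: "real \<times> (real ^ 'd) \<Rightarrow> real"
  assumes g: "g \<in> borel_measurable borel" "integrable (slab T \<Otimes>\<^sub>M cell) g"
    and ae: "AE t in slab T. AE x in cell. f (t, x) = g (t, x)"
  shows "(LINT t|lebesgue_on {0..T}. LINT x|torus. f (t, x)) = (\<integral>z. g z \<partial>(slab T \<Otimes>\<^sub>M cell))"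
proof -
  interpret PS: pair_sigma_finite "slab T" "cell :: (real ^ 'd) measure" by (rule pair_sigma_finite_slab_cell)
  have "(LINT t|lebesgue_on {0..T}. LINT x|torus. f (t, x)) = (\<integral>t. (\<integral>x. g (t, x) \<partial>cell) \<partial>slab T)"
    unfolding slab_def
  proof (rule integral_lebesgue_on_eq)
    have "(\<lambda>t. \<integral>x. g (t, x) \<partial>cell) \<in> borel_measurable (slab T)"
      using PS.integrable_fst'[OF g(2)] by (rule borel_measurable_integrable)
    then show "(\<lambda>t. \<integral>x. g (t, x) \<partial>cell) \<in> borel_measurable borel" by simp
    show "AE t in density lborel (indicator {0..T}). (LINT x|torus. f (t, x)) = (\<integral>x. g (t, x) \<partial>cell)"
      using ae unfolding slab_def
      by eventually_elim (intro integral_torus_eq borel_measurable_slice g)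
  qed simp
  also have "\<dots> = (\<integral>z. g z \<partial>(slab T \<Otimes>\<^sub>M cell))" by (rule PS.integral_fst'[OF g(2)])
  finally show ?thesis .
qed

text \<open>Each coordinate has a Borel representative since Lebesgue measure is a completion.\<close>

lemma ex_borel_representative:
  fixes f :: "'a::euclidean_space \<Rightarrow> 'b::euclidean_space"
  assumes f: "f \<in> borel_measurable (lebesgue_on S)" and S: "S \<in> sets borel"
  obtains g where "g \<in> borel_measurable borel" "AE x in lborel. x \<in> S \<longrightarrow> f x = g x"
proof -
  have F: "(\<lambda>x. indicator S x *\<^sub>R f x) \<in> borel_measurable lebesgue"
    using f S by (subst (asm) borel_measurable_restrict_space_iff) auto
  have "\<exists>g\<in>borel_measurable lborel. AE x in lborel. (indicator S x *\<^sub>R f x) \<bullet> i = g x" for i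
    by (rule completion_ex_borel_measurable_real) (intro borel_measurable_inner F borel_measurable_const)
  then have "\<forall>i. \<exists>g. g \<in> borel_measurable borel \<and> (AE x in lborel. (indicator S x *\<^sub>R f x) \<bullet> i = g x)"
    by (simp only: measurable_lborel1 Bex_def) simp
  from choice[OF this] obtain G
    where G: "\<And>i. G i \<in> borel_measurable borel" "\<And>i. AE x in lborel. (indicator S x *\<^sub>R f x) \<bullet> i = G i x"
    by blast
  show ?thesis
  proof (rule that)
    show "(\<lambda>x. \<Sum>i\<in>Basis. G i x *\<^sub>R i) \<in> borel_measurable borel"
      using G(1) by (intro borel_measurable_sum borel_measurable_scaleR) auto
    have "AE x in lborel. \<forall>i\<in>Basis. (indicator S x *\<^sub>R f x) \<bullet> i = G i x"
      using G(2) by (intro AE_finite_allI) auto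
    then show "AE x in lborel. x \<in> S \<longrightarrow> f x = (\<Sum>i\<in>Basis. G i x *\<^sub>R i)"
    proof eventually_elim
      case (elim x)
      show ?case
      proof
        assume "x \<in> S"
        then have "\<forall>i\<in>Basis. f x \<bullet> i = G i x" using elim by simp
        then show "f x = (\<Sum>i\<in>Basis. G i x *\<^sub>R i)" by (subst euclidean_representation[symmetric]) simp
      qed
    qed
  qed
qed

lemma AE_slab_cell_of_lborel:
  assumes "AE z in (lborel :: (real \<times> (real ^ 'd)) measure). z \<in> {0..T} \<times> UNIV \<longrightarrow> Q z"
  shows "AE t in slab T. AE x in cell. Q (t, x)"
proof -
  have "AE z in lborel \<Otimes>\<^sub>M (lborel :: (real ^ 'd) measure). z \<in> {0..T} \<times> UNIV \<longrightarrow> Q z"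
    unfolding lborel_prod by (rule assms)
  from lborel_pair.AE_pair[OF this]
  have "AE t in lborel. AE x in (lborel :: (real ^ 'd) measure). t \<in> {0..T} \<longrightarrow> Q (t, x)" by simp
  then have *: "AE t in lborel. t \<in> {0..T} \<longrightarrow> (AE x in (lborel :: (real ^ 'd) measure). Q (t, x))" by simp
  have c: "AE x in cell. R x" if "AE x in lborel. R x" for R :: "real ^ 'd \<Rightarrow> bool"
    unfolding cell_def using that by (subst AE_density) auto
  show ?thesis
    unfolding slab_def
    by (subst AE_density) (use * in \<open>auto elim!: eventually_mono intro: c simp: indicator_def split: if_splits\<close>)
qed

section \<open>Lebesgue norms and dual balls\<close>

lemma borel_measurable_epowr: "(\<lambda>x. epowr x a) \<in> borel_measurable borel"
  unfolding epowr_def by measurable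

lemma Lp_norm_infinity_le:
  assumes "AE x in M. g x \<le> c" "g \<in> borel_measurable M"
  shows "Lp_norm \<infinity> M g \<le> c"
  using assms by (simp add: Lp_norm_def esssup_I)

text \<open>For \<open>q = \<infinity>\<close>: the essential supremum of a slice exceeds \<open>y\<close> exactly if the slice exceeds \<open>y\<close> on a set of
positive measure, and that measure is a Borel function of time.\<close>

lemma borel_measurable_Lp_norm_slice:
  fixes u :: "real \<times> (real ^ 'd) \<Rightarrow> real"
  assumes [measurable]: "u \<in> borel_measurable borel"
  shows "(\<lambda>t. Lp_norm q torus (\<lambda>x. ennreal (norm (u (t, x))))) \<in> borel_measurable borel"
proof -
  have sl[measurable]: "(\<lambda>x. u (t, x)) \<in> borel_measurable borel" for t by (rule borel_measurable_slice) measurable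
  show ?thesis
  proof (cases "q = \<infinity>")
    case False
    let ?p = "enn2real q"
    note [measurable] = borel_measurable_epowr
    have m: "(\<lambda>z. epowr (ennreal \<bar>u z\<bar>) ?p) \<in> borel_measurable borel" by measurable
    have "(\<integral>\<^sup>+x. epowr (ennreal \<bar>u (t, x)\<bar>) ?p \<partial>torus) = (\<integral>\<^sup>+x. epowr (ennreal \<bar>u (t, x)\<bar>) ?p \<partial>cell)" for t
      unfolding torus_def cell_def by (rule nn_integral_lebesgue_on_eq) auto
    moreover have "(\<lambda>t. \<integral>\<^sup>+x. epowr (ennreal \<bar>u (t, x)\<bar>) ?p \<partial>cell) \<in> borel_measurable borel"
      by (rule borel_measurable_nn_integral_cell[OF m])
    ultimately show ?thesis using False borel_measurable_epowr by (simp add: Lp_norm_def) measurable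
  next
    case True
    let ?E = "\<lambda>t. esssup torus (\<lambda>x. ennreal \<bar>u (t, x)\<bar>)"
    have tm: "(\<lambda>x. ennreal \<bar>u (t, x)\<bar>) \<in> borel_measurable torus" for t
      unfolding torus_def by (rule measurable_lebesgue_on_of_borel) measurable
    have gt: "y < ?E t \<longleftrightarrow> (\<integral>\<^sup>+x. indicator {z. y < ennreal \<bar>u z\<bar>} (t, x) \<partial>cell) \<noteq> 0" for y t
    proof -
      have "?E t \<le> y \<longleftrightarrow> (AE x in torus. ennreal \<bar>u (t, x)\<bar> \<le> y)"
        using esssup_I[OF tm, of t y] esssup_AE[of "\<lambda>x. ennreal \<bar>u (t, x)\<bar>" torus] by (auto elim: eventually_mono)
      also have "\<dots> \<longleftrightarrow> (AE x in cell. ennreal \<bar>u (t, x)\<bar> \<le> y)" by (rule AE_torus_iff)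
      also have "\<dots> \<longleftrightarrow> (\<integral>\<^sup>+x. indicator {z. y < ennreal \<bar>u z\<bar>} (t, x) \<partial>cell) = 0"
      proof (subst nn_integral_0_iff_AE)
        have "(\<lambda>z. indicator {z. y < ennreal \<bar>u z\<bar>} z :: ennreal) \<in> borel_measurable borel" by measurable
        from borel_measurable_slice[OF this]
        show "(\<lambda>x. indicator {z. y < ennreal \<bar>u z\<bar>} (t, x) :: ennreal) \<in> borel_measurable cell" by simp
      qed (auto simp: indicator_def not_less intro!: AE_cong)
      finally show ?thesis by (auto simp: not_le[symmetric])
    qed
    have "?E \<in> borel_measurable borel"
    proof (rule borel_measurableI_greater)
      fix y
      have [measurable]: "(\<lambda>t. \<integral>\<^sup>+x. indicator {z. y < ennreal \<bar>u z\<bar>} (t, x) \<partial>cell) \<in> borel_measurable borel"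
        by (rule borel_measurable_nn_integral_cell) measurable
      show "{t \<in> space borel. y < ?E t} \<in> sets borel" unfolding gt by measurable
    qed
    then show ?thesis using True by (simp only: Lp_norm_def if_True simp_thms real_norm_def)
  qed
qed

lemma LrLq_infinityI:
  fixes u :: "real \<times> (real ^ 'd) \<Rightarrow> real"
  assumes m: "u \<in> borel_measurable borel" and per: "\<And>t. periodic (\<lambda>x. u (t, x))"
    and bd: "\<And>t. Lp_norm q torus (\<lambda>x. ennreal (norm (u (t, x)))) \<le> ennreal A"
  shows "u \<in> LrLq T \<infinity> q"
proof -
  have "Lp_norm \<infinity> (lebesgue_on {0..T}) (\<lambda>t. Lp_norm q torus (\<lambda>x. ennreal (norm (u (t, x))))) \<le> ennreal A"
    by (intro Lp_norm_infinity_le measurable_lebesgue_on_of_borel borel_measurable_Lp_norm_slice m AE_I2 bd)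
  also have "\<dots> < \<infinity>" by simp
  finally show ?thesis using measurable_lebesgue_on_of_borel[OF m] per by (simp add: LrLq_def)
qed

lemma Lp_norm_one: 
  assumes "f \<in> borel_measurable borel"
  shows "Lp_norm 1 torus (\<lambda>x. ennreal \<bar>f x\<bar>) = (\<integral>\<^sup>+x. ennreal \<bar>f x\<bar> \<partial>cell)"
proof -
  have e: "epowr x 1 = x" for x by (auto simp: epowr_def ennreal_enn2real_if)
  have "(\<integral>\<^sup>+x. ennreal \<bar>f x\<bar> \<partial>torus) = (\<integral>\<^sup>+x. ennreal \<bar>f x\<bar> \<partial>cell)"
    unfolding torus_def cell_def by (rule nn_integral_lebesgue_on_eq) (use assms in measurable)
  then show ?thesis by (simp add: Lp_norm_def e)
qed

lemma epowr_ennreal: "x \<ge> 0 \<Longrightarrow> epowr (ennreal x) a = ennreal (x powr a)"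
  by (simp add: epowr_def)

lemma Lp_norm_finite_exponent:
  fixes f :: "real ^ 'd \<Rightarrow> real"
  assumes f: "f \<in> borel_measurable borel" and "q \<noteq> \<infinity>"
  shows "Lp_norm q torus (\<lambda>x. ennreal \<bar>f x\<bar>)
     = epowr (\<integral>\<^sup>+x. ennreal (\<bar>f x\<bar> powr enn2real q) \<partial>cell) (1 / enn2real q)"
proof -
  have "(\<integral>\<^sup>+x. ennreal (\<bar>f x\<bar> powr enn2real q) \<partial>torus) = (\<integral>\<^sup>+x. ennreal (\<bar>f x\<bar> powr enn2real q) \<partial>cell)"
    unfolding torus_def cell_def by (rule nn_integral_lebesgue_on_eq) (use f in measurable)
  then show ?thesis using assms(2) by (simp add: Lp_norm_def epowr_ennreal)
qed

text \<open>Test with the indicator of the set where \<open>\<bar>f\<bar>\<close> exceeds \<open>A + \<eta>\<close>.\<close>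

lemma dual_ball_AE_bound:
  assumes f: "f \<in> dual_ball 1 A" and A0: "A \<ge> 0"
  shows "AE x in cell. \<bar>f x\<bar> \<le> A"
proof -
  have [measurable]: "f \<in> borel_measurable borel" by (rule dual_ball_measurable[OF f])
  have "AE x in (cell :: (real ^ 'a) measure). \<bar>f x\<bar> \<le> A + 1 / real (Suc n)" for n
  proof -
    define \<eta> where "\<eta> = 1 / real (Suc n)"
    have \<eta>: "\<eta> > 0" by (simp add: \<eta>_def)
    define S where "S = {x. \<bar>f x\<bar> > A + \<eta>}"
    have [measurable]: "S \<in> sets borel" unfolding S_def by measurable
    have le1: "emeasure cell S \<le> 1" using emeasure_space[of cell S] by (simp add: emeasure_cell)
    define c where "c = measure cell S"
    have ec: "emeasure cell S = ennreal c"
      unfolding c_def by (rule finite_measure.emeasure_eq_measure[OF finite_measure_cell])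
    have c0: "c \<ge> 0" by (simp add: c_def)
    have "ennreal ((A + \<eta>) * c) = (\<integral>\<^sup>+x. ennreal (A + \<eta>) * indicator S x \<partial>cell)"
      using A0 \<eta> c0 by (simp add: nn_integral_cmult_indicator ec ennreal_mult)
    also have "\<dots> \<le> (\<integral>\<^sup>+x. ennreal (\<bar>f x\<bar> * indicator S x) \<partial>cell)"
      by (intro nn_integral_mono) (auto simp: S_def indicator_def intro!: ennreal_leI)
    also have "\<dots> \<le> ennreal (A * c)"
    proof (rule dual_ballD[OF f])
      have "(\<integral>\<^sup>+x. ennreal (indicator S x powr 1) \<partial>cell) = (\<integral>\<^sup>+x. indicator S x \<partial>cell)"
        by (intro nn_integral_cong) (simp add: indicator_def)
      then show "(\<integral>\<^sup>+x. ennreal (indicator S x powr 1) \<partial>cell) \<le> ennreal (c powr 1)" using ec c0 by simp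
    qed (use c0 in auto)
    finally have "\<eta> * c \<le> 0" using A0 c0 by (simp add: algebra_simps)
    then have "c = 0" using \<eta> c0 by (simp add: mult_le_0_iff)
    then have "AE x in cell. x \<notin> S" using ec by (intro AE_not_in) (simp add: null_sets_def)
    then show ?thesis by (auto simp: S_def \<eta>_def not_less)
  qed
  then have "AE x in (cell :: (real ^ 'a) measure). \<forall>n. \<bar>f x\<bar> \<le> A + 1 / real (Suc n)" by (simp add: AE_all_countable)
  then show ?thesis
  proof eventually_elim
    case (elim x)
    have "(\<lambda>n. A + 1 / real (Suc n)) \<longlonglongrightarrow> A + 0"
      by (intro tendsto_intros LIMSEQ_Suc[OF lim_1_over_n])
    then show ?case using elim by (intro LIMSEQ_le_const[of _ "A"]) auto
  qed
qed

text \<open>Test with \<open>\<bar>f\<bar> powr (q - 1)\<close>, truncated so that the quantity to be absorbed is known to be finite.\<close>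

lemma dual_ball_Lq_bound:
  assumes f: "f \<in> dual_ball r A" and A0: "A \<ge> 0" and r: "r > 1" and q: "q = r / (r - 1)"
  shows "(\<integral>\<^sup>+x. ennreal (\<bar>f x\<bar> powr q) \<partial>cell) \<le> ennreal (A powr q)"
proof -
  have [measurable]: "f \<in> borel_measurable borel" by (rule dual_ball_measurable[OF f])
  have q1: "q > 1" using r by (simp add: q field_simps)
  have qr: "(q - 1) * r = q" using r by (simp add: q field_simps)
  \<comment> \<open>truncation makes the integral of \<open>h n powr q\<close> finite, so that it can be cancelled\<close>
  define h where "h n x = min \<bar>f x\<bar> (real n)" for n x
  have hm[measurable]: "h n \<in> borel_measurable borel" for n unfolding h_def[abs_def] by measurable
  have h0: "0 \<le> h n x" for n x by (simp add: h_def)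
  have bound: "(\<integral>\<^sup>+x. ennreal (h n x powr q) \<partial>(cell :: (real ^ 'a) measure)) \<le> ennreal (A powr q)" for n
  proof -
    let ?I = "\<integral>\<^sup>+x. ennreal (h n x powr q) \<partial>(cell :: (real ^ 'a) measure)"
    have "?I \<le> (\<integral>\<^sup>+x. ennreal (real n powr q) \<partial>(cell :: (real ^ 'a) measure))"
      using q1 by (intro nn_integral_mono ennreal_leI powr_mono2) (auto simp: h_def)
    also have "\<dots> < \<infinity>" by (simp add: emeasure_cell)
    finally have "?I < \<infinity>" .
    then obtain I where I: "I \<ge> 0" "?I = ennreal I" by (blast dest: ennreal_finiteD)
    define c where "c = I powr (1 / r)"
    have cr: "c powr r = I" using r I by (simp add: c_def powr_powr)
    have "?I \<le> (\<integral>\<^sup>+x. ennreal (\<bar>f x\<bar> * h n x powr (q - 1)) \<partial>cell)"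
    proof (intro nn_integral_mono ennreal_leI)
      fix x
      have "h n x powr q = h n x * h n x powr (q - 1)"
        using h0[of n x] q1 by (cases "h n x = 0") (simp_all add: powr_mult_base)
      also have "\<dots> \<le> \<bar>f x\<bar> * h n x powr (q - 1)" by (intro mult_right_mono) (auto simp: h_def)
      finally show "h n x powr q \<le> \<bar>f x\<bar> * h n x powr (q - 1)" .
    qed
    also have "\<dots> \<le> ennreal (A * c)"
    proof (rule dual_ballD[OF f])
      show "(\<integral>\<^sup>+x. ennreal ((h n x powr (q - 1)) powr r) \<partial>cell) \<le> ennreal (c powr r)"
        unfolding powr_powr qr cr I ..
    qed (simp_all add: c_def)
    finally have IA: "I \<le> A * c" using I A0 by (simp add: c_def)
    have "I \<le> A powr q"
    proof (cases "I = 0")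
      case False
      then have Ip: "I > 0" using I by simp
      have "I = I powr (1 / q) * I powr (1 / r)"
      proof -
        have "1 / q + 1 / r = 1" using r by (simp add: q field_simps)
        then show ?thesis using Ip by (simp add: powr_add[symmetric])
      qed
      then have "I powr (1 / q) * c \<le> A * c" using IA by (simp add: c_def)
      then have "I powr (1 / q) \<le> A" using Ip by (simp add: c_def)
      then have "(I powr (1 / q)) powr q \<le> A powr q" using q1 by (intro powr_mono2) auto
      then show ?thesis using q1 Ip by (simp add: powr_powr)
    qed simp
    then show ?thesis unfolding I(2) by (rule ennreal_leI)
  qed
  have "(\<integral>\<^sup>+x. ennreal (\<bar>f x\<bar> powr q) \<partial>cell) = (\<integral>\<^sup>+x. liminf (\<lambda>n. ennreal (h n x powr q)) \<partial>cell)"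
  proof (rule nn_integral_cong)
    fix x
    obtain N where N: "\<bar>f x\<bar> \<le> real N" using real_arch_simple by blast
    have "(\<lambda>n. ennreal (h n x powr q)) \<longlonglongrightarrow> ennreal (\<bar>f x\<bar> powr q)"
      by (rule tendsto_eventually, rule eventually_sequentiallyI[of N]) (use N in \<open>auto simp: h_def min_def\<close>)
    from lim_imp_Liminf[OF _ this] show "ennreal (\<bar>f x\<bar> powr q) = liminf (\<lambda>n. ennreal (h n x powr q))" by simp
  qed
  also have "\<dots> \<le> liminf (\<lambda>n. \<integral>\<^sup>+x. ennreal (h n x powr q) \<partial>cell)"
    by (rule nn_integral_liminf) measurable
  also have "\<dots> \<le> liminf (\<lambda>n. ennreal (A powr q))"
    by (intro Liminf_mono always_eventually allI bound)
  also have "\<dots> = ennreal (A powr q)" by (simp add: Liminf_const)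
  finally show ?thesis .
qed

lemma Lq_in_dual_ball:
  fixes w :: "real ^ 'd \<Rightarrow> real"
  assumes [measurable]: "w \<in> borel_measurable borel" and r: "r > 1" and q: "q = r / (r - 1)"
    and fin: "(\<integral>\<^sup>+x. ennreal (\<bar>w x\<bar> powr q) \<partial>cell) < \<infinity>"
  shows "\<exists>A\<ge>0. w \<in> dual_ball r A"
proof -
  have q1: "q > 1" using r by (simp add: q field_simps)
  obtain I where I: "I \<ge> 0" "(\<integral>\<^sup>+x. ennreal (\<bar>w x\<bar> powr q) \<partial>cell) = ennreal I"
    using fin by (blast dest: ennreal_finiteD)
  \<comment> \<open>the summand \<open>1\<close> avoids division by zero for the zero function\<close>
  define A where "A = (I + 1) powr (1 / q)"
  have A0: "A > 0" using I by (simp add: A_def)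
  have Aq: "A powr q = I + 1" using q1 I by (simp add: A_def powr_powr)
  have "w \<in> dual_ball r A"
  proof (rule dual_ballI[where a="\<lambda>x. (\<bar>w x\<bar> / A) powr (q / r)"])
    have "(\<integral>\<^sup>+x. ennreal (((\<bar>w x\<bar> / A) powr (q / r)) powr r) \<partial>cell)
        = (\<integral>\<^sup>+x. ennreal (1 / (I + 1)) * ennreal (\<bar>w x\<bar> powr q) \<partial>cell)"
    proof (rule nn_integral_cong)
      fix x
      have "((\<bar>w x\<bar> / A) powr (q / r)) powr r = 1 / (I + 1) * \<bar>w x\<bar> powr q"
        using r A0 by (simp add: powr_powr powr_divide Aq)
      then show "ennreal (((\<bar>w x\<bar> / A) powr (q / r)) powr r) = ennreal (1 / (I + 1)) * ennreal (\<bar>w x\<bar> powr q)"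
        using I(1) by (simp only:) (rule ennreal_mult, auto)
    qed
    also have "\<dots> = ennreal (1 / (I + 1)) * ennreal I" by (simp add: nn_integral_cmult I)
    also have "\<dots> = ennreal (1 / (I + 1) * I)" using I(1) by (intro ennreal_mult[symmetric]) auto
    also have "\<dots> \<le> ennreal 1" using I(1) by (intro ennreal_leI) (simp add: field_simps)
    finally show "(\<integral>\<^sup>+x. ennreal (((\<bar>w x\<bar> / A) powr (q / r)) powr r) \<partial>cell) \<le> 1" by simp
    have "q / r * (r - 1) = 1" using r by (simp add: q)
    then show "AE x in cell. \<bar>w x\<bar> \<le> A * ((\<bar>w x\<bar> / A) powr (q / r)) powr (r - 1)"
      using A0 by (intro AE_I2) (simp add: powr_powr)
  qed (use r A0 in auto)
  then show ?thesis using A0 by (intro exI[of _ A]) auto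
qed

text \<open>The cell has measure one, so \<open>L\<^sup>r\<close> norms increase with \<open>r\<close>: this is Hoelder's inequality for \<open>h powr r\<close>
against the constant \<open>1\<close>.\<close>

lemma power_norm_mono_exponent:
  fixes h :: "real ^ 'd \<Rightarrow> real"
  assumes [measurable]: "h \<in> borel_measurable borel" and h0: "\<And>x. 0 \<le> h x" and r: "1 \<le> r" "r \<le> p" and c: "c \<ge> 0"
    and le: "(\<integral>\<^sup>+x. ennreal (h x powr p) \<partial>cell) \<le> ennreal (c powr p)"
  shows "(\<integral>\<^sup>+x. ennreal (h x powr r) \<partial>cell) \<le> ennreal (c powr r)"
proof -
  have "(\<lambda>_ :: real ^ 'd. 1) \<in> dual_ball (p / r) 1"
    using r by (intro dual_ballI[where a="\<lambda>_. 1"]) (auto simp: emeasure_cell)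
  then have "(\<integral>\<^sup>+x. ennreal (\<bar>1\<bar> * h x powr r) \<partial>cell) \<le> ennreal (1 * c powr r)"
    by (rule dual_ballD) (use r le in \<open>simp_all add: powr_powr\<close>)
  then show ?thesis by simp
qed

lemma epowr_le_iff:
  assumes "s > 0" "c \<ge> 0"
  shows "epowr X (1 / s) \<le> ennreal c \<longleftrightarrow> X \<le> ennreal (c powr s)"
proof (cases X rule: ennreal_cases)
  case (real x)
  have "x powr (1 / s) \<le> c \<longleftrightarrow> x \<le> c powr s"
  proof
    assume "x powr (1 / s) \<le> c"
    then have "(x powr (1 / s)) powr s \<le> c powr s" using assms by (intro powr_mono2) auto
    then show "x \<le> c powr s" using assms real by (simp add: powr_powr)
  next
    assume "x \<le> c powr s"
    then have "x powr (1 / s) \<le> (c powr s) powr (1 / s)" using assms real by (intro powr_mono2) auto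
    then show "x powr (1 / s) \<le> c" using assms by (simp add: powr_powr)
  qed
  then show ?thesis using assms real by (simp add: epowr_ennreal)
next
  case top
  then show ?thesis by (simp add: epowr_def top_unique)
qed

lemma power_norm_le_of_Lp_norm:
  fixes f g :: "real ^ 'd \<Rightarrow> 'b::euclidean_space"
  assumes g[measurable]: "g \<in> borel_measurable borel" and fg: "AE x in cell. f x = g x"
    and r: "1 \<le> r" "ennreal r \<le> p" and c: "c \<ge> 0"
    and le: "Lp_norm p torus (\<lambda>x. ennreal (norm (f x))) \<le> ennreal c"
  shows "(\<integral>\<^sup>+x. ennreal (norm (g x) powr r) \<partial>cell) \<le> ennreal (c powr r)"
proof (cases p rule: ennreal_cases)
  case top
  have "AE x in torus. ennreal (norm (f x)) \<le> esssup torus (\<lambda>x. ennreal (norm (f x)))" by (rule esssup_AE)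
  then have "AE x in torus. ennreal (norm (f x)) \<le> ennreal c"
    by eventually_elim (use le top in \<open>auto simp: Lp_norm_def intro: order_trans\<close>)
  then have "AE x in cell. norm (g x) \<le> c"
    using fg unfolding AE_torus_iff by eventually_elim (use c in simp)
  then have "(\<integral>\<^sup>+x. ennreal (norm (g x) powr r) \<partial>cell) \<le> (\<integral>\<^sup>+x. ennreal (c powr r) \<partial>(cell :: (real ^ 'd) measure))"
    by (intro nn_integral_mono_AE, elim eventually_mono) (use r in \<open>auto intro!: ennreal_leI powr_mono2\<close>)
  then show ?thesis by (simp add: emeasure_cell)
next
  case (real p')
  then have p': "r \<le> p'" using r by simp
  have "(\<integral>\<^sup>+x. epowr (ennreal (norm (f x))) p' \<partial>torus) = (\<integral>\<^sup>+x. ennreal (norm (g x) powr p') \<partial>cell)"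
    unfolding torus_def cell_def
    by (rule nn_integral_lebesgue_on_eq)
      (use fg[unfolded cell_def] in \<open>auto simp: epowr_ennreal elim: eventually_mono\<close>)
  then have "epowr (\<integral>\<^sup>+x. ennreal (norm (g x) powr p') \<partial>cell) (1 / p') \<le> ennreal c"
    using le real by (simp add: Lp_norm_def)
  then have "(\<integral>\<^sup>+x. ennreal (norm (g x) powr p') \<partial>cell) \<le> ennreal (c powr p')"
    using c p' r by (subst (asm) epowr_le_iff) auto
  then show ?thesis using p' r c by (intro power_norm_mono_exponent[of "\<lambda>x. norm (g x)" r p' c]) auto
qed

text \<open>A bounded function has \<open>L\<^sup>q\<close> norms that tend to its \<open>L\<^sup>1\<close> norm \<open>a\<close> as \<open>q\<close> decreases to one, that is as the
conjugate exponent \<open>r\<close> grows; so any \<open>A > a\<close> is an admissible radius for large \<open>r\<close>.\<close>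

lemma bounded_in_dual_ball:
  fixes w :: "real ^ 'd \<Rightarrow> real"
  assumes [measurable]: "w \<in> borel_measurable borel" and M: "\<And>x. \<bar>w x\<bar> \<le> M"
    and a: "(\<integral>\<^sup>+x. ennreal \<bar>w x\<bar> \<partial>cell) = ennreal a" "a \<ge> 0" and A: "a < A"
  shows "\<exists>r\<ge>1. w \<in> dual_ball r A"
proof -
  \<comment> \<open>with \<open>s = 1 / (r - 1)\<close> the comparison function is \<open>(\<bar>w\<bar> / A) powr s\<close>, whose \<open>r\<close>-th power is at most
    \<open>\<kappa> powr s * \<bar>w\<bar> / A\<close>; here \<open>M + 1\<close> instead of \<open>M\<close> only ensures that \<open>\<kappa>\<close> is positive\<close>
  define \<kappa> where "\<kappa> = (M + 1) / A"
  have M0: "M \<ge> 0" using M[of 0] by linarith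
  have A0: "A > 0" using A a(2) by simp
  have \<kappa>0: "\<kappa> > 0" using M0 A0 by (simp add: \<kappa>_def)
  have "((\<lambda>s. a / A * \<kappa> powr s) \<longlongrightarrow> a / A * \<kappa> powr 0) (at_right 0)"
    using \<kappa>0 by (intro tendsto_intros) auto
  moreover have "a / A * \<kappa> powr 0 < 1" using A A0 \<kappa>0 by simp
  ultimately have "eventually (\<lambda>s. a / A * \<kappa> powr s < 1) (at_right 0)" by (rule order_tendstoD)
  moreover have "eventually (\<lambda>s::real. s > 0) (at_right 0)" by (rule eventually_at_right_less)
  ultimately have "eventually (\<lambda>s::real. a / A * \<kappa> powr s < 1 \<and> s > 0) (at_right 0)" by (rule eventually_conj)
  then obtain s where s: "a / A * \<kappa> powr s < 1" "s > 0"
    using eventually_happens'[OF trivial_limit_at_right_real] by blast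
  define r where "r = 1 + 1 / s"
  have r1: "r > 1" "r - 1 = 1 / s" "s * r = s + 1" using s by (auto simp: r_def field_simps)
  have "w \<in> dual_ball r A"
  proof (rule dual_ballI[where a="\<lambda>x. (\<bar>w x\<bar> / A) powr s"])
    have "(\<integral>\<^sup>+x. ennreal (((\<bar>w x\<bar> / A) powr s) powr r) \<partial>cell) \<le> (\<integral>\<^sup>+x. ennreal (\<kappa> powr s / A) * ennreal \<bar>w x\<bar> \<partial>cell)"
    proof (rule nn_integral_mono)
      fix x
      have "((\<bar>w x\<bar> / A) powr s) powr r = (\<bar>w x\<bar> / A) powr (s + 1)"
        by (simp only: powr_powr r1(3))
      also have "\<dots> = \<bar>w x\<bar> / A * (\<bar>w x\<bar> / A) powr s"
        using s A0 by (cases "w x = 0") (auto simp: powr_add)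
      also have "\<dots> \<le> \<bar>w x\<bar> / A * \<kappa> powr s"
        using M[of x] A0 s by (intro mult_left_mono powr_mono2) (auto simp: \<kappa>_def divide_right_mono)
      finally have "ennreal (((\<bar>w x\<bar> / A) powr s) powr r) \<le> ennreal (\<kappa> powr s / A * \<bar>w x\<bar>)"
        by (intro ennreal_leI) (simp add: mult_ac)
      also have "\<dots> = ennreal (\<kappa> powr s / A) * ennreal \<bar>w x\<bar>"
        using A0 by (intro ennreal_mult) auto
      finally show "ennreal (((\<bar>w x\<bar> / A) powr s) powr r) \<le> ennreal (\<kappa> powr s / A) * ennreal \<bar>w x\<bar>" .
    qed
    also have "\<dots> = ennreal (\<kappa> powr s / A) * ennreal a" by (simp add: nn_integral_cmult a(1))
    also have "\<dots> = ennreal (\<kappa> powr s / A * a)" using A0 a(2) by (intro ennreal_mult[symmetric]) auto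
    also have "\<dots> \<le> ennreal 1" using s(1) by (intro ennreal_leI) (simp add: mult.commute)
    finally show "(\<integral>\<^sup>+x. ennreal (((\<bar>w x\<bar> / A) powr s) powr r) \<partial>cell) \<le> 1" by simp
    show "AE x in cell. \<bar>w x\<bar> \<le> A * ((\<bar>w x\<bar> / A) powr s) powr (r - 1)"
      using A0 s by (intro AE_I2) (simp add: powr_powr r1(2))
  qed (use r1 A0 in auto)
  then show ?thesis using r1 by (intro exI[of _ r]) auto
qed

section \<open>Existence for exponents above one\<close>

text \<open>The bound \<open>G\<close> does not depend on \<open>r\<close>. This matters for \<open>q = 1\<close>, where infinitely many exponents
are used and the resulting solutions are summed.\<close>

lemma incompressible_drift_of_LrLq:
  fixes b :: "real \<times> (real ^ 'd::finite) \<Rightarrow> real ^ 'd"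
  assumes T: "T > 0" and b: "b \<in> LrLq T 1 p" and div: "divergence_free T b"
  obtains b' G where "b' \<in> borel_measurable borel" "AE t in slab T. AE x in cell. b (t, x) = b' (t, x)" "G < (\<infinity>::ennreal)"
    "\<And>r. 1 \<le> r \<Longrightarrow> ennreal r \<le> p \<Longrightarrow> \<exists>H. incompressible_drift T r b' H \<and> (\<integral>\<^sup>+t. ennreal (H t) \<partial>slab T) \<le> G"
proof -
  define g where "g t = Lp_norm p torus (\<lambda>x. ennreal (norm (b (t, x))))" for t
  define G where "G = (\<integral>\<^sup>+t. g t \<partial>lebesgue_on {0..T})"
  have bm: "b \<in> borel_measurable (lebesgue_on ({0..T} \<times> UNIV))"
    and Gf: "Lp_norm 1 (lebesgue_on {0..T}) g < \<infinity>"
    using b unfolding LrLq_def g_def by auto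
  have e1: "epowr x 1 = x" for x by (auto simp: epowr_def ennreal_enn2real_if)
  have G: "G < \<infinity>" using Gf by (simp add: Lp_norm_def e1 G_def)
  have S: "{0..T} \<times> (UNIV :: (real ^ 'd) set) \<in> sets borel" by (intro borel_closed closed_Times) auto
  obtain b' where b'[measurable]: "b' \<in> borel_measurable borel"
    and "AE z in lborel. z \<in> {0..T} \<times> UNIV \<longrightarrow> b z = b' z"
    by (rule ex_borel_representative[OF bm S])
  from AE_slab_cell_of_lborel[OF this(2)] have bb': "AE t in slab T. AE x in cell. b (t, x) = b' (t, x)" .
  have sl[measurable]: "(\<lambda>x. b' (t, x)) \<in> borel_measurable borel" for t by (rule borel_measurable_slice[OF b'])
  have "\<exists>H. incompressible_drift T r b' H \<and> (\<integral>\<^sup>+t. ennreal (H t) \<partial>slab T) \<le> G" if r: "1 \<le> r" "ennreal r \<le> p" for r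
  proof -
    let ?I = "\<lambda>t. \<integral>\<^sup>+x. ennreal (norm (b' (t, x)) powr r) \<partial>cell"
    define n where "n t = epowr (?I t) (1 / r)" for t
    note [measurable] = borel_measurable_epowr
    have Im[measurable]: "?I \<in> borel_measurable borel"
      using borel_measurable_nn_integral_cell[of "\<lambda>z. ennreal (norm (b' z) powr r)"] by simp
    have nm[measurable]: "n \<in> borel_measurable borel" unfolding n_def[abs_def] by measurable
    have n_le: "AE t in slab T. n t \<le> g t"
      using bb'
    proof eventually_elim
      case (elim t)
      show ?case
      proof (cases "g t" rule: ennreal_cases)
        case (real c)
        then have "?I t \<le> ennreal (c powr r)"
          by (intro power_norm_le_of_Lp_norm[OF sl elim r]) (simp_all add: g_def)
        then show ?thesis unfolding n_def real(2) using r real(1) by (subst epowr_le_iff) auto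
      qed simp
    qed
    have "(\<integral>\<^sup>+t. n t \<partial>slab T) = (\<integral>\<^sup>+t. n t \<partial>lebesgue_on {0..T})"
      unfolding slab_def by (rule nn_integral_lebesgue_on_eq[symmetric]) auto
    also have "\<dots> \<le> G" unfolding G_def by (rule nn_integral_mono_AE) (use n_le in \<open>simp add: AE_time_iff\<close>)
    finally have nG: "(\<integral>\<^sup>+t. n t \<partial>slab T) \<le> G" .
    have n_fin: "AE t in slab T. n t \<noteq> \<infinity>"
      using nG G by (intro nn_integral_PInf_AE) auto
    define H where "H t = enn2real (n t)" for t
    have HG: "(\<integral>\<^sup>+t. ennreal (H t) \<partial>slab T) \<le> G"
      by (rule order_trans[OF _ nG]) (auto intro!: nn_integral_mono simp: H_def ennreal_enn2real_if)
    have dr: "drift T r b' H"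
    proof
      show "AE t in slab T. ?I t \<le> ennreal (H t powr r)"
        using n_fin
      proof eventually_elim
        case (elim t)
        then have "n t = ennreal (H t)" by (simp add: H_def ennreal_enn2real_if)
        then have "n t \<le> ennreal (H t)" by simp
        then show ?case unfolding n_def using r by (subst (asm) epowr_le_iff) (auto simp: H_def)
      qed
      show "H \<in> borel_measurable borel" unfolding H_def[abs_def] by measurable
      show "(\<integral>\<^sup>+t. ennreal (H t) \<partial>slab T) < \<infinity>" using HG G by (rule le_less_trans)
    qed (use T r b' in \<open>auto simp: H_def\<close>)
    then interpret drift T r b' H .
    have "incompressible_drift T r b' H"
    proof
      fix \<psi> :: "real \<times> (real ^ 'd) \<Rightarrow> real" assume \<psi>: "\<psi> \<in> test_functions {0<..<T}"
      then have sm: "smooth \<psi>" by (simp add: test_functions_def)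
      have gm: "(\<lambda>z. b' z \<bullet> grad \<psi> z) \<in> borel_measurable borel"
        using borel_measurable_grad[OF sm] b' by measurable
      have "(LINT t|lebesgue_on {0..T}. LINT x|torus. b (t, x) \<bullet> grad \<psi> (t, x)) = (\<integral>z. b' z \<bullet> grad \<psi> z \<partial>P)"
      proof (rule iterated_integral_eq[OF gm integrable_b_grad[OF sm]])
        show "AE t in slab T. AE x in cell. b (t, x) \<bullet> grad \<psi> (t, x) = b' (t, x) \<bullet> grad \<psi> (t, x)"
          using bb' by (elim eventually_mono) simp
      qed
      then show "(\<integral>z. b' z \<bullet> grad \<psi> z \<partial>P) = 0" using div \<psi> by (simp add: divergence_free_def)
    qed
    then show ?thesis using HG by blast
  qed
  with b' bb' G show ?thesis by (rule that)
qed

lemma distributional_solutionI: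
  fixes b b' :: "real \<times> (real ^ 'd::finite) \<Rightarrow> real ^ 'd"
  assumes b': "b' \<in> borel_measurable borel" "AE t in slab T. AE x in cell. b (t, x) = b' (t, x)"
    and w: "w \<in> borel_measurable borel" "AE x in cell. u0 x = w x"
    and u: "u \<in> borel_measurable borel" "\<And>t. periodic (\<lambda>x. u (t, x))"
    and bd: "\<And>t. Lp_norm q torus (\<lambda>x. ennreal (norm (u (t, x)))) \<le> ennreal A"
    and int: "\<And>\<phi>. \<phi> \<in> test_functions {..<T} \<Longrightarrow> integrable (slab T \<Otimes>\<^sub>M cell) (\<lambda>z. u z * backward_op b' \<phi> z)"
    and eq: "\<And>\<phi>. \<phi> \<in> test_functions {..<T} \<Longrightarrow> defect T b' w \<phi> u = 0"
  shows "distributional_solution T q b u0 u"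
  unfolding distributional_solution_def
proof (intro conjI ballI)
  show "u \<in> LrLq T \<infinity> q" by (rule LrLq_infinityI[OF u bd])
  fix \<phi> :: "real \<times> (real ^ 'd) \<Rightarrow> real" assume \<phi>: "\<phi> \<in> test_functions {..<T}"
  then have sm: "smooth \<phi>" by (simp add: test_functions_def)
  have 1: "(LINT t|lebesgue_on {0..T}. LINT x|torus.
       u (t, x) * (dt \<phi> (t, x) + b (t, x) \<bullet> grad \<phi> (t, x) + laplacian \<phi> (t, x)))
     = (\<integral>z. u z * backward_op b' \<phi> z \<partial>(slab T \<Otimes>\<^sub>M cell))"
  proof (rule iterated_integral_eq[OF _ int[OF \<phi>]])
    show "(\<lambda>z. u z * backward_op b' \<phi> z) \<in> borel_measurable borel"
      by (intro borel_measurable_times u borel_measurable_backward_op sm b')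
    show "AE t in slab T. AE x in cell. u (t, x) * (dt \<phi> (t, x) + b (t, x) \<bullet> grad \<phi> (t, x) + laplacian \<phi> (t, x))
        = u (t, x) * backward_op b' \<phi> (t, x)"
      using b'(2) by (elim eventually_mono) (simp add: backward_op_def)
  qed
  have 2: "(LINT x|torus. u0 x * \<phi> (0, x)) = (\<integral>x. w x * \<phi> (0, x) \<partial>cell)"
  proof (rule integral_torus_eq)
    show "(\<lambda>x. w x * \<phi> (0, x)) \<in> borel_measurable borel"
      by (intro borel_measurable_times w borel_measurable_slice smooth_borel_measurable sm)
    show "AE x in cell. u0 x * \<phi> (0, x) = w x * \<phi> (0, x)" using w(2) by eventually_elim simp
  qed
  show "(LINT t|lebesgue_on {0..T}. LINT x|torus.
       u (t, x) * (dt \<phi> (t, x) + b (t, x) \<bullet> grad \<phi> (t, x) + laplacian \<phi> (t, x)))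
     + (LINT x|torus. u0 x * \<phi> (0, x)) = 0"
    unfolding 1 2 using eq[OF \<phi>] by (simp add: defect_def)
qed

lemma borel_initial_datum:
  fixes u0 :: "real ^ 'd \<Rightarrow> real"
  assumes "u0 \<in> Lp_torus q"
  obtains w where "w \<in> borel_measurable borel" "AE x in cell. u0 x = w x"
proof -
  have "u0 \<in> borel_measurable (lebesgue_on UNIV)" using assms by (intro measurable_restrict_space1) (simp add: Lp_torus_def)
  then obtain w where w: "w \<in> borel_measurable borel" "AE x in lborel. x \<in> UNIV \<longrightarrow> u0 x = w x"
    by (rule ex_borel_representative) simp
  have "AE x in cell. u0 x = w x"
    unfolding cell_def using w(2) by (subst AE_density) (auto elim: eventually_mono)
  with w(1) show ?thesis by (rule that)
qed

lemma Lp_norm_datum: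
  fixes u0 w :: "real ^ 'd \<Rightarrow> real"
  assumes w: "w \<in> borel_measurable borel" and ae: "AE x in cell. u0 x = w x" and q: "q \<noteq> \<infinity>"
  shows "Lp_norm q torus (\<lambda>x. ennreal (norm (u0 x)))
     = epowr (\<integral>\<^sup>+x. ennreal (\<bar>w x\<bar> powr enn2real q) \<partial>cell) (1 / enn2real q)"
proof -
  have "Lp_norm q torus (\<lambda>x. ennreal (norm (u0 x))) = Lp_norm q torus (\<lambda>x. ennreal \<bar>w x\<bar>)"
    using ae q by (auto simp: Lp_norm_def AE_torus_iff intro!: arg_cong2[of _ _ _ _ epowr] nn_integral_cong_AE elim: eventually_mono)
  then show ?thesis using Lp_norm_finite_exponent[OF w q] by simp
qed

text \<open>The conjugate exponent \<open>r\<close> of \<open>q\<close> is finite, and \<open>1 / p + 1 / q \<le> 1\<close> says that \<open>r \<le> p\<close>, so the drift is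
integrable enough.\<close>

lemma existence_exponent_gt_1:
  fixes b :: "real \<times> (real ^ 'd::finite) \<Rightarrow> real ^ 'd" and u0 :: "real ^ 'd \<Rightarrow> real"
  assumes T: "T > 0" and p: "p \<ge> 1" and q: "q > 1" and pq: "1 / p + 1 / q \<le> 1"
    and b: "b \<in> LrLq T 1 p" "divergence_free T b" and u0: "u0 \<in> Lp_torus q"
  shows "\<exists>u. distributional_solution T q b u0 u"
proof -
  obtain b' G where b': "b' \<in> borel_measurable borel" "AE t in slab T. AE x in cell. b (t, x) = b' (t, x)"
    and dr: "\<And>r. 1 \<le> r \<Longrightarrow> ennreal r \<le> p \<Longrightarrow> \<exists>H. incompressible_drift T r b' H \<and> (\<integral>\<^sup>+t. ennreal (H t) \<partial>slab T) \<le> G"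
    by (rule incompressible_drift_of_LrLq[OF T b]) blast
  obtain w where w: "w \<in> borel_measurable borel" "AE x in cell. u0 x = w x" by (rule borel_initial_datum[OF u0])
  have u0n: "Lp_norm q torus (\<lambda>x. ennreal (norm (u0 x))) < \<infinity>" using u0 by (simp add: Lp_torus_def)
  have "\<exists>r A. 1 \<le> r \<and> ennreal r \<le> p \<and> 0 \<le> A \<and> w \<in> dual_ball r A \<and>
      (\<forall>f \<in> (dual_ball r A :: (real ^ 'd \<Rightarrow> real) set). Lp_norm q torus (\<lambda>x. ennreal (norm (f x))) \<le> ennreal A)"
  proof (cases "q = \<infinity>")
    case True
    then have "esssup torus (\<lambda>x. ennreal (norm (u0 x))) < \<infinity>" using u0n by (simp add: Lp_norm_def)
    then obtain A where A: "A \<ge> 0" "esssup torus (\<lambda>x. ennreal (norm (u0 x))) = ennreal A"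
      by (blast dest: ennreal_finiteD)
    have "AE x in torus. ennreal (norm (u0 x)) \<le> ennreal A" using esssup_AE[of "\<lambda>x. ennreal (norm (u0 x))" torus] A by simp
    then have "AE x in cell. \<bar>w x\<bar> \<le> A * 1 powr (1 - 1)"
      using w(2) unfolding AE_torus_iff by eventually_elim (use A in simp)
    then have "w \<in> dual_ball 1 A"
      by (intro dual_ballI[where a="\<lambda>_. 1"]) (use A w in \<open>auto simp: emeasure_cell\<close>)
    moreover have "Lp_norm q torus (\<lambda>x. ennreal (norm (f x))) \<le> ennreal A" if f: "f \<in> dual_ball 1 A" for f :: "real ^ 'd \<Rightarrow> real"
    proof -
      have "AE x in torus. ennreal (norm (f x)) \<le> ennreal A"
        using dual_ball_AE_bound[OF f A(1)] unfolding AE_torus_iff by eventually_elim (simp add: ennreal_leI)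
      moreover have "(\<lambda>x. ennreal (norm (f x))) \<in> borel_measurable torus"
        unfolding torus_def using dual_ball_measurable[OF f] by (intro measurable_lebesgue_on_of_borel) measurable
      ultimately show ?thesis unfolding True by (rule Lp_norm_infinity_le)
    qed
    ultimately show ?thesis using A p by - (rule exI[of _ 1], rule exI[of _ A], auto)
  next
    case False
    then obtain s where s: "q = ennreal s" "s > 1" using q by (cases q rule: ennreal_cases) auto
    define r where "r = s / (s - 1)"
    have r: "r > 1" "s = r / (r - 1)" using s by (auto simp: r_def field_simps)
    have rp: "ennreal r \<le> p"
    proof (cases p rule: ennreal_cases)
      case (real p')
      then have p': "p' \<ge> 1" using p by simp
      have "ennreal (1 / p' + 1 / s) \<le> ennreal 1"
        using pq real s p' divide_ennreal[of 1 p'] divide_ennreal[of 1 s] by (simp add: ennreal_plus)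
      then have "1 / p' + 1 / s \<le> 1" using p' s by (subst (asm) ennreal_le_iff) auto
      then have "r \<le> p'" using p' s by (simp add: r_def field_simps)
      then show ?thesis using real by (simp add: ennreal_leI)
    qed simp
    have "(\<integral>\<^sup>+x. ennreal (\<bar>w x\<bar> powr s) \<partial>cell) < \<infinity>"
    proof -
      have "epowr (\<integral>\<^sup>+x. ennreal (\<bar>w x\<bar> powr s) \<partial>cell) (1 / s) < \<infinity>"
        using u0n Lp_norm_datum[OF w False] s by simp
      then show ?thesis by (auto simp: epowr_def less_top split: if_splits)
    qed
    from Lq_in_dual_ball[OF w(1) r this] obtain A where A: "A \<ge> 0" "w \<in> dual_ball r A" by blast
    have "Lp_norm q torus (\<lambda>x. ennreal (norm (f x))) \<le> ennreal A" if f: "f \<in> dual_ball r A" for f :: "real ^ 'd \<Rightarrow> real"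
    proof -
      have "epowr (\<integral>\<^sup>+x. ennreal (\<bar>f x\<bar> powr s) \<partial>cell) (1 / s) \<le> ennreal A"
        using dual_ball_Lq_bound[OF f A(1) r] s A(1) by (subst epowr_le_iff) auto
      then show ?thesis using Lp_norm_finite_exponent[OF dual_ball_measurable[OF f] False] s by simp
    qed
    then show ?thesis using A r rp by - (rule exI[of _ r], rule exI[of _ A], auto)
  qed
  then obtain r A where r: "1 \<le> r" "ennreal r \<le> p" and A: "0 \<le> A" "w \<in> dual_ball r A"
    and ball: "\<And>f :: real ^ 'd \<Rightarrow> real. f \<in> dual_ball r A \<Longrightarrow> Lp_norm q torus (\<lambda>x. ennreal (norm (f x))) \<le> ennreal A" by blast
  obtain H where "incompressible_drift T r b' H" using dr[OF r] by blast
  then interpret incompressible_drift T r b' H .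
  obtain u where u: "u \<in> admissible r A" "\<forall>\<phi>\<in>test_functions {..<T}. defect T b' w \<phi> u = 0"
    using exists_admissible_solution[OF A(2,1)] by blast
  have "distributional_solution T q b u0 u"
  proof (rule distributional_solutionI[OF b' w])
    show "Lp_norm q torus (\<lambda>x. ennreal (norm (u (t, x)))) \<le> ennreal A" for t by (rule ball[OF admissibleD(3)[OF u(1)]])
    show "integrable P (\<lambda>z. u z * backward_op b' \<phi> z)" if "\<phi> \<in> test_functions {..<T}" for \<phi>
      using that by (intro integrable_admissible_backward_op[OF u(1) A(1)]) (simp add: test_functions_def)
  qed (use u admissibleD[OF u(1)] in auto)
  then show ?thesis by blast
qed

section \<open>The exponent one\<close>

lemma ennreal_abs_pointwise_lim_sum_le:
  "ennreal \<bar>pointwise_lim (\<lambda>n z. \<Sum>k<n. f k z) z\<bar> \<le> (\<Sum>k. ennreal \<bar>f k z\<bar>)"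
proof (cases "pointwise_lim (\<lambda>n z. \<Sum>k<n. f k z) z = 0")
  case False
  then have "(\<lambda>n. \<Sum>k<n. f k z) \<longlonglongrightarrow> pointwise_lim (\<lambda>n z. \<Sum>k<n. f k z) z"
    using pointwise_lim_cases[of "\<lambda>n z. \<Sum>k<n. f k z" z] by auto
  then have "(\<lambda>n. ennreal \<bar>\<Sum>k<n. f k z\<bar>) \<longlonglongrightarrow> ennreal \<bar>pointwise_lim (\<lambda>n z. \<Sum>k<n. f k z) z\<bar>"
    by (intro tendsto_ennrealI tendsto_rabs)
  then show ?thesis
  proof (rule LIMSEQ_le_const2, intro exI allI impI)
    fix n
    have "ennreal \<bar>\<Sum>k<n. f k z\<bar> \<le> ennreal (\<Sum>k<n. \<bar>f k z\<bar>)" by (intro ennreal_leI sum_abs)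
    also have "\<dots> = (\<Sum>k<n. ennreal \<bar>f k z\<bar>)" by (simp add: sum_ennreal)
    also have "\<dots> \<le> (\<Sum>k. ennreal \<bar>f k z\<bar>)" by (intro sum_le_suminf) auto
    finally show "ennreal \<bar>\<Sum>k<n. f k z\<bar> \<le> (\<Sum>k. ennreal \<bar>f k z\<bar>)" .
  qed
qed simp

lemma nn_integral_mult_slice_le:
  fixes \<phi> :: "real \<times> (real ^ 'd) \<Rightarrow> real"
  assumes "smooth \<phi>"
  shows "\<exists>B\<ge>0. \<forall>g\<in>borel_measurable borel.
    (\<integral>\<^sup>+x. ennreal (norm (g x * \<phi> (t, x))) \<partial>cell) \<le> ennreal B * (\<integral>\<^sup>+x. ennreal \<bar>g x\<bar> \<partial>cell)"
proof -
  obtain B where B: "B \<ge> 0" "\<And>x. x \<in> cbox 0 1 \<Longrightarrow> \<bar>\<phi> (t, x)\<bar> \<le> B"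
    using test_function_bounded_on_cell[OF assms, of t] by blast
  have "(\<integral>\<^sup>+x. ennreal (norm (g x * \<phi> (t, x))) \<partial>cell) \<le> ennreal B * (\<integral>\<^sup>+x. ennreal \<bar>g x\<bar> \<partial>cell)"
    if [measurable]: "g \<in> borel_measurable borel" for g :: "real ^ 'd \<Rightarrow> real"
  proof -
    have "(\<integral>\<^sup>+x. ennreal (norm (g x * \<phi> (t, x))) \<partial>cell) \<le> (\<integral>\<^sup>+x. ennreal B * ennreal \<bar>g x\<bar> \<partial>cell)"
    proof (intro nn_integral_mono_AE AE_cell_I)
      fix x :: "real ^ 'd" assume "x \<in> cbox 0 1"
      then have "norm (g x * \<phi> (t, x)) \<le> B * \<bar>g x\<bar>"
        using B by (simp add: abs_mult mult.commute[of "\<bar>g x\<bar>"] mult_right_mono)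
      then show "ennreal (norm (g x * \<phi> (t, x))) \<le> ennreal B * ennreal \<bar>g x\<bar>"
        using B(1) by (simp add: ennreal_leI flip: ennreal_mult)
    qed
    then show ?thesis by (simp add: nn_integral_cmult)
  qed
  with B(1) show ?thesis by blast
qed

text \<open>Both series converge absolutely in norms that control the weak formulation, so summation and
integration may be interchanged.\<close>

lemma defect_pointwise_lim_sum:
  fixes u :: "nat \<Rightarrow> real \<times> (real ^ 'd::finite) \<Rightarrow> real" and v :: "nat \<Rightarrow> real ^ 'd \<Rightarrow> real"
  assumes b[measurable]: "b \<in> borel_measurable borel" and sm: "smooth \<phi>"
    and um[measurable]: "\<And>k. u k \<in> borel_measurable borel" and vm[measurable]: "\<And>k. v k \<in> borel_measurable borel"
    and u_bd: "(\<Sum>k. \<integral>\<^sup>+z. ennreal (\<bar>u k z\<bar> * (1 + norm (b z))) \<partial>(slab T \<Otimes>\<^sub>M cell)) < \<infinity>"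
    and v_bd: "(\<Sum>k. \<integral>\<^sup>+x. ennreal \<bar>v k x\<bar> \<partial>cell) < \<infinity>"
    and v_sum: "\<And>x. (\<lambda>k. v k x) sums w x"
    and zero: "\<And>k. defect T b (v k) \<phi> (u k) = 0"
  shows "integrable (slab T \<Otimes>\<^sub>M cell) (\<lambda>z. pointwise_lim (\<lambda>n z. \<Sum>k<n. u k z) z * backward_op b \<phi> z)"
    and "defect T b w \<phi> (pointwise_lim (\<lambda>n z. \<Sum>k<n. u k z)) = 0"
proof -
  let ?P = "slab T \<Otimes>\<^sub>M (cell :: (real ^ 'd) measure)" and ?U = "pointwise_lim (\<lambda>n z. \<Sum>k<n. u k z)"
  have am[measurable]: "backward_op b \<phi> \<in> borel_measurable borel" by (rule borel_measurable_backward_op[OF sm b])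
  obtain C where C: "C \<ge> 0" "AE z in ?P. \<bar>backward_op b \<phi> z\<bar> \<le> C * (1 + norm (b z))" by (rule backward_op_bound[OF sm])
  have general: "integrable M (\<lambda>z. \<Sum>k. f k z)" "(\<lambda>k. \<integral>z. f k z \<partial>M) sums (\<integral>z. (\<Sum>k. f k z) \<partial>M)"
      "AE z in M. summable (\<lambda>k. \<bar>f k z\<bar>)"
    if [measurable]: "\<And>k. f k \<in> borel_measurable M" and fin: "(\<Sum>k. \<integral>\<^sup>+z. ennreal \<bar>f k z\<bar> \<partial>M) < \<infinity>"
    for M :: "'z measure" and f :: "nat \<Rightarrow> 'z \<Rightarrow> real"
  proof -
    have "(\<integral>\<^sup>+z. (\<Sum>k. ennreal \<bar>f k z\<bar>) \<partial>M) = (\<Sum>k. \<integral>\<^sup>+z. ennreal \<bar>f k z\<bar> \<partial>M)"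
      by (rule nn_integral_suminf) measurable
    then have "AE z in M. (\<Sum>k. ennreal \<bar>f k z\<bar>) \<noteq> \<infinity>"
      using fin by (intro nn_integral_PInf_AE) auto
    then show ae: "AE z in M. summable (\<lambda>k. \<bar>f k z\<bar>)"
      by eventually_elim (auto intro: summable_suminf_not_top simp: infinity_ennreal_def)
    have lt: "(\<integral>\<^sup>+z. ennreal \<bar>f k z\<bar> \<partial>M) < \<infinity>" for k
      using fin ennreal_suminf_lessD[of "\<lambda>k. \<integral>\<^sup>+z. ennreal \<bar>f k z\<bar> \<partial>M" \<infinity>] by blast
    have i: "integrable M (f k)" for k using lt by (intro integrableI_bounded) auto
    have "ennreal (\<integral>z. \<bar>f k z\<bar> \<partial>M) = (\<integral>\<^sup>+z. ennreal \<bar>f k z\<bar> \<partial>M)" for k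
      using i by (intro nn_integral_eq_integral[symmetric]) auto
    then have s: "summable (\<lambda>k. \<integral>z. \<bar>f k z\<bar> \<partial>M)"
      using fin by (intro summable_suminf_not_top) auto
    show "integrable M (\<lambda>z. \<Sum>k. f k z)" "(\<lambda>k. \<integral>z. f k z \<partial>M) sums (\<integral>z. (\<Sum>k. f k z) \<partial>M)"
      using i ae s by (auto intro!: integrable_suminf sums_integral)
  qed
  have "(\<Sum>k. \<integral>\<^sup>+z. ennreal \<bar>u k z * backward_op b \<phi> z\<bar> \<partial>?P)
     \<le> (\<Sum>k. ennreal C * (\<integral>\<^sup>+z. ennreal (\<bar>u k z\<bar> * (1 + norm (b z))) \<partial>?P))"
  proof (rule suminf_le)
    fix k
    have "(\<integral>\<^sup>+z. ennreal \<bar>u k z * backward_op b \<phi> z\<bar> \<partial>?P) \<le> (\<integral>\<^sup>+z. ennreal C * ennreal (\<bar>u k z\<bar> * (1 + norm (b z))) \<partial>?P)"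
    proof (rule nn_integral_mono_AE, use C(2) in eventually_elim)
      case (elim z)
      have "\<bar>u k z * backward_op b \<phi> z\<bar> \<le> \<bar>u k z\<bar> * (C * (1 + norm (b z)))"
        using elim by (simp add: abs_mult mult_left_mono)
      also have "\<dots> = C * (\<bar>u k z\<bar> * (1 + norm (b z)))" by simp
      finally show ?case using C(1) by (simp add: ennreal_leI flip: ennreal_mult)
    qed
    then show "(\<integral>\<^sup>+z. ennreal \<bar>u k z * backward_op b \<phi> z\<bar> \<partial>?P) \<le> ennreal C * (\<integral>\<^sup>+z. ennreal (\<bar>u k z\<bar> * (1 + norm (b z))) \<partial>?P)"
      by (subst (asm) nn_integral_cmult) measurable
  qed auto
  also have "\<dots> < \<infinity>" using u_bd by (simp add: ennreal_suminf_cmult ennreal_mult_less_top)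
  finally have fin1: "(\<Sum>k. \<integral>\<^sup>+z. ennreal \<bar>u k z * backward_op b \<phi> z\<bar> \<partial>?P) < \<infinity>" .
  have m1: "(\<lambda>z. u k z * backward_op b \<phi> z) \<in> borel_measurable ?P" for k by measurable
  note g1 = general[of "\<lambda>k z. u k z * backward_op b \<phi> z" ?P, OF m1 fin1]
  have "(\<Sum>k. \<integral>\<^sup>+z. ennreal \<bar>u k z\<bar> \<partial>?P) \<le> (\<Sum>k. \<integral>\<^sup>+z. ennreal (\<bar>u k z\<bar> * (1 + norm (b z))) \<partial>?P)"
    by (intro suminf_le nn_integral_mono ennreal_leI) (auto simp: algebra_simps)
  then have fin3: "(\<Sum>k. \<integral>\<^sup>+z. ennreal \<bar>u k z\<bar> \<partial>?P) < \<infinity>" using u_bd by (rule le_less_trans)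
  have m3: "u k \<in> borel_measurable ?P" for k by measurable
  have Ueq: "AE z in ?P. (\<Sum>k. u k z * backward_op b \<phi> z) = ?U z * backward_op b \<phi> z"
    using general(3)[of u ?P, OF m3 fin3]
  proof eventually_elim
    case (elim z)
    then have s: "summable (\<lambda>k. u k z)" by (rule summable_rabs_cancel)
    then have L: "(\<lambda>n. \<Sum>k<n. u k z) \<longlonglongrightarrow> (\<Sum>k. u k z)" by (rule summable_LIMSEQ)
    then have "convergent (\<lambda>n. \<Sum>k<n. u k z)" by (auto simp: convergent_def)
    then have "(\<lambda>n. \<Sum>k<n. u k z) \<longlonglongrightarrow> ?U z" by (rule pointwise_lim_tendsto[of "\<lambda>n z. \<Sum>k<n. u k z" z])
    with L have "?U z = (\<Sum>k. u k z)" by (rule LIMSEQ_unique[symmetric])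
    then show ?case using s by (simp add: suminf_mult2)
  qed
  have Um[measurable]: "?U \<in> borel_measurable borel" by (rule borel_measurable_pointwise_lim) measurable
  have sm1: "(\<lambda>z. \<Sum>k. u k z * backward_op b \<phi> z) \<in> borel_measurable ?P" using g1(1) by auto
  have Um1: "(\<lambda>z. ?U z * backward_op b \<phi> z) \<in> borel_measurable ?P" by measurable
  show "integrable ?P (\<lambda>z. ?U z * backward_op b \<phi> z)"
    using g1(1) by (rule integrable_cong_AE_imp[OF _ Um1 Ueq])
  have 1: "(\<lambda>k. \<integral>z. u k z * backward_op b \<phi> z \<partial>?P) sums (\<integral>z. ?U z * backward_op b \<phi> z \<partial>?P)"
    using g1(2) integral_cong_AE[OF sm1 Um1 Ueq] by simp
  obtain B where B: "B \<ge> 0" "\<forall>g\<in>borel_measurable borel.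
    (\<integral>\<^sup>+x. ennreal (norm (g x * \<phi> (0, x))) \<partial>cell) \<le> ennreal B * (\<integral>\<^sup>+x. ennreal \<bar>g x\<bar> \<partial>cell)"
    using nn_integral_mult_slice_le[OF sm, of 0] by blast
  have "(\<Sum>k. \<integral>\<^sup>+x. ennreal \<bar>v k x * \<phi> (0, x)\<bar> \<partial>cell) \<le> (\<Sum>k. ennreal B * (\<integral>\<^sup>+x. ennreal \<bar>v k x\<bar> \<partial>cell))"
    using B(2) vm by (intro suminf_le) auto
  also have "\<dots> < \<infinity>" using v_bd by (simp add: ennreal_suminf_cmult ennreal_mult_less_top)
  finally have fin2: "(\<Sum>k. \<integral>\<^sup>+x. ennreal \<bar>v k x * \<phi> (0, x)\<bar> \<partial>cell) < \<infinity>" .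
  have [measurable]: "(\<lambda>x. \<phi> (0, x)) \<in> borel_measurable borel"
    by (intro borel_measurable_slice smooth_borel_measurable sm)
  have m2: "(\<lambda>x. v k x * \<phi> (0, x)) \<in> borel_measurable cell" for k by measurable
  have "(\<Sum>k. v k x * \<phi> (0, x)) = w x * \<phi> (0, x)" for x
    using sums_mult2[OF v_sum[of x], of "\<phi> (0, x)"] by (rule sums_unique[symmetric])
  then have 2: "(\<lambda>k. \<integral>x. v k x * \<phi> (0, x) \<partial>cell) sums (\<integral>x. w x * \<phi> (0, x) \<partial>cell)"
    using general(2)[of "\<lambda>k x. v k x * \<phi> (0, x)" cell, OF m2 fin2] by simp
  have "(\<lambda>k. defect T b (v k) \<phi> (u k)) sums defect T b w \<phi> ?U"
    unfolding defect_def by (rule sums_add[OF 1 2])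
  then have "(\<lambda>k. 0 :: real) sums defect T b w \<phi> ?U" by (simp add: zero)
  then show "defect T b w \<phi> ?U = 0" by (simp add: sums_iff)
qed

text \<open>The levels of the datum are bounded, so each of them has a solution by the case of larger exponents;
the radii can be chosen summable since the \<open>L\<^sup>1\<close> norms of the levels are.\<close>

lemma existence_exponent_1:
  fixes b :: "real \<times> (real ^ 'd::finite) \<Rightarrow> real ^ 'd" and u0 :: "real ^ 'd \<Rightarrow> real"
  assumes T: "T > 0" and b: "b \<in> LrLq T 1 \<infinity>" "divergence_free T b" and u0: "u0 \<in> Lp_torus 1"
  shows "\<exists>u. distributional_solution T 1 b u0 u"
proof -
  obtain b' G where b': "b' \<in> borel_measurable borel" "AE t in slab T. AE x in cell. b (t, x) = b' (t, x)" and G: "G < \<infinity>"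
    and dr: "\<And>r. 1 \<le> r \<Longrightarrow> ennreal r \<le> \<infinity> \<Longrightarrow> \<exists>H. incompressible_drift T r b' H \<and> (\<integral>\<^sup>+t. ennreal (H t) \<partial>slab T) \<le> G"
    by (rule incompressible_drift_of_LrLq[OF T b]) blast
  obtain w where w[measurable]: "w \<in> borel_measurable borel" and uw: "AE x in cell. u0 x = w x" by (rule borel_initial_datum[OF u0])
  have e1: "epowr x 1 = x" for x by (auto simp: epowr_def ennreal_enn2real_if)
  have w_fin: "(\<integral>\<^sup>+x. ennreal \<bar>w x\<bar> \<partial>cell) < \<infinity>"
    using u0 Lp_norm_datum[OF w uw, of 1] by (simp add: Lp_torus_def e1)
  \<comment> \<open>the part of the datum where \<open>\<bar>w\<bar>\<close> lies in \<open>[k, k + 1)\<close>\<close>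
  define v where "v k x = (if real k \<le> \<bar>w x\<bar> \<and> \<bar>w x\<bar> < real k + 1 then w x else 0)" for k x
  have v_eq: "v k x = (if k = nat \<lfloor>\<bar>w x\<bar>\<rfloor> then w x else 0)" for k x
  proof -
    have "(real k \<le> \<bar>w x\<bar> \<and> \<bar>w x\<bar> < real k + 1) \<longleftrightarrow> \<lfloor>\<bar>w x\<bar>\<rfloor> = int k" by (simp add: floor_eq_iff)
    also have "\<dots> \<longleftrightarrow> k = nat \<lfloor>\<bar>w x\<bar>\<rfloor>" by auto
    finally show ?thesis by (simp add: v_def)
  qed
  have vm[measurable]: "v k \<in> borel_measurable borel" for k unfolding v_def[abs_def] by measurable
  have v_sums: "(\<lambda>k. v k x) sums w x" for x
    unfolding v_eq by (rule sums_single)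
  have v_bd: "\<bar>v k x\<bar> \<le> real k + 1" for k x by (simp add: v_def)
  have v_suminf: "(\<Sum>k. ennreal \<bar>v k x\<bar>) = ennreal \<bar>w x\<bar>" for x
  proof -
    have "(\<lambda>k. ennreal \<bar>v k x\<bar>) sums ennreal \<bar>w x\<bar>"
      using sums_single[of "nat \<lfloor>\<bar>w x\<bar>\<rfloor>" "\<lambda>_. ennreal \<bar>w x\<bar>"]
      by (rule back_subst[of "\<lambda>f. f sums ennreal \<bar>w x\<bar>"]) (auto simp: v_eq)
    then show ?thesis by (rule sums_unique[symmetric])
  qed
  have v_total: "(\<Sum>k. \<integral>\<^sup>+x. ennreal \<bar>v k x\<bar> \<partial>cell) < \<infinity>"
    using w_fin by (subst nn_integral_suminf[symmetric]) (auto simp: v_suminf)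
  have "\<forall>k. \<exists>a. a \<ge> 0 \<and> (\<integral>\<^sup>+x. ennreal \<bar>v k x\<bar> \<partial>cell) = ennreal a"
    using ennreal_finiteD[OF ennreal_suminf_lessD[OF v_total]] by blast
  from choice[OF this] obtain a where a: "\<And>k. a k \<ge> 0" "\<And>k. (\<integral>\<^sup>+x. ennreal \<bar>v k x\<bar> \<partial>cell) = ennreal (a k)" by blast
  \<comment> \<open>strictly above the \<open>L\<^sup>1\<close> norm, as \<open>bounded_in_dual_ball\<close> requires, and still summable\<close>
  define A where "A k = a k + (1/2) ^ k" for k
  have A0: "A k \<ge> 0" for k using a(1)[of k] by (simp add: A_def)
  have A_total: "(\<Sum>k. ennreal (A k)) < \<infinity>"
  proof -
    have "(\<Sum>k. ennreal (A k)) = (\<Sum>k. ennreal (a k) + ennreal ((1/2) ^ k))"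
      using a(1) by (simp add: A_def ennreal_plus)
    also have "\<dots> = (\<Sum>k. ennreal (a k)) + (\<Sum>k. ennreal ((1/2) ^ k))"
      by (intro suminf_add[symmetric]) auto
    also have "(\<Sum>k. ennreal ((1/2) ^ k)) = ennreal (\<Sum>k. (1/2) ^ k)"
      by (rule suminf_ennreal2) (auto intro: summable_geometric)
    finally show ?thesis using v_total by (simp add: a(2))
  qed
  have "\<forall>k. \<exists>u. u \<in> borel_measurable borel \<and> (\<forall>t. periodic (\<lambda>x. u (t, x))) \<and>
      (\<forall>t. (\<integral>\<^sup>+x. ennreal \<bar>u (t, x)\<bar> \<partial>cell) \<le> ennreal (A k)) \<and>
      (\<integral>\<^sup>+z. ennreal (\<bar>u z\<bar> * (1 + norm (b' z))) \<partial>(slab T \<Otimes>\<^sub>M cell)) \<le> ennreal (A k) * (ennreal T + G) \<and>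
      (\<forall>\<phi>\<in>test_functions {..<T}. defect T b' (v k) \<phi> u = 0)"
  proof (rule allI, goal_cases)
    case (1 k)
    obtain r where r: "1 \<le> r" "v k \<in> dual_ball r (A k)"
      using bounded_in_dual_ball[OF vm v_bd a(2,1)[of k], where A="A k"] by (auto simp: A_def)
    obtain H where H: "incompressible_drift T r b' H" "(\<integral>\<^sup>+t. ennreal (H t) \<partial>slab T) \<le> G" using dr[OF r(1)] by auto
    interpret incompressible_drift T r b' H by (rule H(1))
    obtain u where u: "u \<in> admissible r (A k)" "\<forall>\<phi>\<in>test_functions {..<T}. defect T b' (v k) \<phi> u = 0"
      using exists_admissible_solution[OF r(2) A0] by blast
    have "(\<integral>\<^sup>+z. ennreal (\<bar>u z\<bar> * (1 + norm (b' z))) \<partial>P) \<le> ennreal (A k) * (ennreal T + (\<integral>\<^sup>+t. ennreal (H t) \<partial>slab T))"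
      by (rule admissible_weight[OF u(1) A0])
    also have "\<dots> \<le> ennreal (A k) * (ennreal T + G)" by (intro mult_left_mono add_left_mono H) auto
    finally show ?case using u admissibleD(1,2)[OF u(1)] dual_ball_L1[OF admissibleD(3)[OF u(1)]] by blast
  qed
  from choice[OF this] obtain u where u[measurable]: "\<And>k. u k \<in> borel_measurable borel"
    and u_per: "\<And>k t. periodic (\<lambda>x. u k (t, x))"
    and u_L1: "\<And>k t. (\<integral>\<^sup>+x. ennreal \<bar>u k (t, x)\<bar> \<partial>cell) \<le> ennreal (A k)"
    and u_wt: "\<And>k. (\<integral>\<^sup>+z. ennreal (\<bar>u k z\<bar> * (1 + norm (b' z))) \<partial>(slab T \<Otimes>\<^sub>M cell)) \<le> ennreal (A k) * (ennreal T + G)"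
    and u_eq: "\<And>k \<phi>. \<phi> \<in> test_functions {..<T} \<Longrightarrow> defect T b' (v k) \<phi> (u k) = 0" by blast
  let ?U = "pointwise_lim (\<lambda>n z. \<Sum>k<n. u k z)"
  obtain C where C: "C \<ge> 0" "(\<Sum>k. ennreal (A k)) = ennreal C" using ennreal_finiteD[OF A_total] by blast
  have u_total: "(\<Sum>k. \<integral>\<^sup>+z. ennreal (\<bar>u k z\<bar> * (1 + norm (b' z))) \<partial>(slab T \<Otimes>\<^sub>M cell)) < \<infinity>"
  proof -
    have "(\<Sum>k. \<integral>\<^sup>+z. ennreal (\<bar>u k z\<bar> * (1 + norm (b' z))) \<partial>(slab T \<Otimes>\<^sub>M cell)) \<le> (\<Sum>k. (ennreal T + G) * ennreal (A k))"
      using u_wt by (intro suminf_le) (auto simp: mult.commute)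
    also have "\<dots> = (ennreal T + G) * (\<Sum>k. ennreal (A k))" by (rule ennreal_suminf_cmult)
    also have "\<dots> < \<infinity>" using A_total G by (simp add: ennreal_mult_less_top)
    finally show ?thesis .
  qed
  have Um[measurable]: "?U \<in> borel_measurable borel" by (rule borel_measurable_pointwise_lim) measurable
  have "distributional_solution T 1 b u0 ?U"
  proof (rule distributional_solutionI[OF b' w uw Um])
    fix t
    show "periodic (\<lambda>x. ?U (t, x))" using u_per[of _ t] by (simp add: periodic_def pointwise_lim_def)
    have sl[measurable]: "(\<lambda>x. u k (t, x)) \<in> borel_measurable borel" for k by (rule borel_measurable_slice) measurable
    have slU: "(\<lambda>x. ?U (t, x)) \<in> borel_measurable borel" by (rule borel_measurable_slice[OF Um])
    have "(\<integral>\<^sup>+x. ennreal \<bar>?U (t, x)\<bar> \<partial>cell) \<le> (\<integral>\<^sup>+x. (\<Sum>k. ennreal \<bar>u k (t, x)\<bar>) \<partial>cell)"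
      by (intro nn_integral_mono ennreal_abs_pointwise_lim_sum_le)
    also have "\<dots> = (\<Sum>k. \<integral>\<^sup>+x. ennreal \<bar>u k (t, x)\<bar> \<partial>cell)" by (rule nn_integral_suminf) measurable
    also have "\<dots> \<le> (\<Sum>k. ennreal (A k))" by (intro suminf_le u_L1) auto
    finally show "Lp_norm 1 torus (\<lambda>x. ennreal (norm (?U (t, x)))) \<le> ennreal C"
      using C Lp_norm_one[OF slU] by simp
  next
    fix \<phi> :: "real \<times> (real ^ 'd) \<Rightarrow> real" assume \<phi>: "\<phi> \<in> test_functions {..<T}"
    then have sm: "smooth \<phi>" by (simp add: test_functions_def)
    show "integrable (slab T \<Otimes>\<^sub>M cell) (\<lambda>z. ?U z * backward_op b' \<phi> z)" "defect T b' w \<phi> ?U = 0"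
      by (rule defect_pointwise_lim_sum[OF b'(1) sm u vm u_total v_total v_sums u_eq[OF \<phi>]])+
  qed
  then show ?thesis by blast
qed

section \<open>The existence theorem\<close>

theorem proposition2p2:
  fixes T :: real and p q :: ennreal
    and b :: "real \<times> (real ^ 'd::finite) \<Rightarrow> real ^ 'd"
    and u0 :: "real ^ 'd \<Rightarrow> real"
  assumes "T > 0"
    and "p \<ge> 1" and "q \<ge> 1" and "1 / p + 1 / q \<le> 1"
    and "b \<in> LrLq T 1 p" and "divergence_free T b"
    and "u0 \<in> Lp_torus q"
  shows "\<exists>u. distributional_solution T q b u0 u"
proof (cases "q = 1")
  case True
  have "p = \<infinity>"
  proof (cases p rule: ennreal_cases)
    case (real p')
    then have p': "p' \<ge> 1" using assms(2) by simp
    have "ennreal (1 / p' + 1) \<le> ennreal 1"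
      using assms(4) True real p' divide_ennreal[of 1 p'] by (simp add: ennreal_plus)
    then have "1 / p' + 1 \<le> 1" using p' by (subst (asm) ennreal_le_iff) auto
    then show ?thesis using p' by (simp add: field_simps)
  qed simp
  then show ?thesis using existence_exponent_1 assms True by blast
next
  case False
  then have "q > 1" using assms(3) by simp
  then show ?thesis using existence_exponent_gt_1 assms by blast
qed

end
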